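(* Let $M\curvearrowright X$ be a bounded-to-one Borel action of a finitely generated commutative monoid $M$ on a standard Borel space $X$. Then \[ \operatorname{asdim}_{\mathsf B}(M\curvearrowright X)\leq \operatorname{rk}(M). \]
   Context: An action of a monoid $M$ on $X$ assigns to each $a\in M$ a map $x\mapsto ax$ with $1x=x$ and $(ab)x=a(bx)$. It is bounded-to-one if for every $a\in M$ there is a finite upper bound (depending on $a$) on the cardinalities of the fibers of $x\mapsto ax$. An action of a countable monoid on a standard Borel space is Borel if every map $x\mapsto ax$ is Borel. For a finite generating set $S$ of $M$, the Schreier graph $G_S^X$ has vertex set $X$ and undirected edges $\{x,sx\}$ ($x\in X$, $s\in S$), loops discarded; it carries its path metric, with value $\infty$ between different connected components. The $r$-components of a subset of an (extended) metric space are the equivalence classes generated by $r$-chains, i.e. finite sequences of points of the subset with successive distances at most $r$. For a locally finite Borel graph $G$ on $X$, $\operatorname{asdim}_{\mathsf B}(G)\leq n$ means that for every $r>0$ there is a cover of $X$ by $n+1$ Borel sets $U_0,\dots,U_n$ such that the $r$-components of each $U_i$ (for the path metric of $G$) have diameter at most some finite $R(r)$. For a Borel action, $\operatorname{asdim}_{\mathsf B}(M\curvearrowright X):=\operatorname{asdim}_{\mathsf B}(G_S^X)$ for a finite generating set $S$. Rank: $M^{\mathrm{gp}}$ is the group completion of $M$ (the abelian group of formal fractions $[a,b]$, $a,b\in M$, with $[a,b]=[a',b']$ iff $ab'c=a'bc$ for some $c\in M$). For finitely generated $M$, $M^{\mathrm{gp}}\cong\mathbb Z^n\oplus T$ with $T$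 finite, and $\operatorname{rk}(M):=n$. *)

theory Defs
  imports "HOL-Analysis.Analysis" "HOL-Algebra.Product_Groups"
begin

section \<open>Standard Borel spaces and Borel actions\<close>

text \<open>
  Only the underlying measurable space of a value of type \<open>'x measure\<close> is used, never its measure.
  Borel sets are the elements of \<open>sets \<Omega>\<close>.
\<close>

definition standard_borel :: "'x measure \<Rightarrow> bool" where
  "standard_borel \<Omega> \<longleftrightarrow>
     (\<exists>T. completely_metrizable_space T \<and> second_countable T \<and> topspace T = space \<Omega> \<and>
          sets \<Omega> = sigma_sets (topspace T) {U. openin T U})"

definition borel_monoid_action ::
    "('m, 'c) monoid_scheme \<Rightarrow> 'x measure \<Rightarrow> ('m \<Rightarrow> 'x \<Rightarrow> 'x) \<Rightarrow> bool" where
  "borel_monoid_action M \<Omega> act \<longleftrightarrow>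
     (\<forall>a\<in>carrier M. act a \<in> \<Omega> \<rightarrow>\<^sub>M \<Omega>) \<and>
     (\<forall>x\<in>space \<Omega>. act \<one>\<^bsub>M\<^esub> x = x) \<and>
     (\<forall>a\<in>carrier M. \<forall>b\<in>carrier M. \<forall>x\<in>space \<Omega>. act (a \<otimes>\<^bsub>M\<^esub> b) x = act a (act b x))"

definition bounded_to_one ::
    "('m, 'c) monoid_scheme \<Rightarrow> 'x measure \<Rightarrow> ('m \<Rightarrow> 'x \<Rightarrow> 'x) \<Rightarrow> bool" where
  "bounded_to_one M \<Omega> act \<longleftrightarrow>
     (\<forall>a\<in>carrier M. \<exists>k::nat. \<forall>y\<in>space \<Omega>.
        finite {x \<in> space \<Omega>. act a x = y} \<and> card {x \<in> space \<Omega>. act a x = y} \<le> k)"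

definition monoid_generates :: "('m, 'c) monoid_scheme \<Rightarrow> 'm set \<Rightarrow> bool" where
  "monoid_generates M S \<longleftrightarrow> S \<subseteq> carrier M \<and> \<Inter>{H. submonoid H M \<and> S \<subseteq> H} = carrier M"


section \<open>Group completion and rank\<close>

definition gp_rel :: "('m, 'c) monoid_scheme \<Rightarrow> (('m \<times> 'm) \<times> ('m \<times> 'm)) set" where
  "gp_rel M = {((a, b), (a', b')). a \<in> carrier M \<and> b \<in> carrier M \<and> a' \<in> carrier M \<and> b' \<in> carrier M \<and>
     (\<exists>c\<in>carrier M. a \<otimes>\<^bsub>M\<^esub> b' \<otimes>\<^bsub>M\<^esub> c = a' \<otimes>\<^bsub>M\<^esub> b \<otimes>\<^bsub>M\<^esub> c)}"

text \<open>
  The formal fraction \<open>[a, b]\<close> is the class \<open>gp_rel M `` {(a, b)}\<close>. The unions in the product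
  range over all representatives and collapse to the single class \<open>[a a', b b']\<close>;
  see \<open>group_completion_mult\<close> below.
\<close>

definition group_completion :: "('m, 'c) monoid_scheme \<Rightarrow> ('m \<times> 'm) set monoid" where
  "group_completion M =
     \<lparr>carrier = (carrier M \<times> carrier M) // gp_rel M,
      monoid.mult = (\<lambda>P Q. \<Union>(a, b)\<in>P. \<Union>(a', b')\<in>Q. gp_rel M `` {(a \<otimes>\<^bsub>M\<^esub> a', b \<otimes>\<^bsub>M\<^esub> b')}),
      one = gp_rel M `` {(\<one>\<^bsub>M\<^esub>, \<one>\<^bsub>M\<^esub>)}\<rparr>"

text \<open>
  The finite group \<open>T\<close> may be taken over \<open>nat\<close>, since every finite group is isomorphic to one
  whose carrier is a set of natural numbers.
\<close>

definition monoid_rank :: "('m, 'c) monoid_scheme \<Rightarrow> nat" where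
  "monoid_rank M =
     (THE n. \<exists>T :: nat monoid. comm_group T \<and> finite (carrier T) \<and>
        group_completion M \<cong> product_group {..<n} (\<lambda>_. integer_group) \<times>\<times> T)"


section \<open>Schreier graphs and Borel asymptotic dimension\<close>

text \<open>
  A graph on \<open>space \<Omega>\<close> is given by its symmetric irreflexive adjacency relation \<open>E\<close>; a walk of
  length \<open>k\<close> from \<open>x\<close> to \<open>y\<close> is witnessed by \<open>(x, y) \<in> E ^^ k\<close>.
\<close>

definition schreier_graph ::
    "'x measure \<Rightarrow> 'm set \<Rightarrow> ('m \<Rightarrow> 'x \<Rightarrow> 'x) \<Rightarrow> ('x \<times> 'x) set" where
  "schreier_graph \<Omega> S act =
     {(x, y). x \<in> space \<Omega> \<and> y \<in> space \<Omega> \<and> x \<noteq> y \<and> (\<exists>s\<in>S. y = act s x \<or> x = act s y)}"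

definition path_metric :: "('x \<times> 'x) set \<Rightarrow> 'x \<Rightarrow> 'x \<Rightarrow> ennreal" where
  "path_metric E x y = (INF k\<in>{k. (x, y) \<in> E ^^ k}. of_nat k)"

definition r_components :: "('x \<Rightarrow> 'x \<Rightarrow> ennreal) \<Rightarrow> real \<Rightarrow> 'x set \<Rightarrow> 'x set set" where
  "r_components d r A = A // {(x, y). x \<in> A \<and> y \<in> A \<and> d x y \<le> ennreal r}\<^sup>*"

definition ediameter :: "('x \<Rightarrow> 'x \<Rightarrow> ennreal) \<Rightarrow> 'x set \<Rightarrow> ennreal" where
  "ediameter d C = (SUP x\<in>C. SUP y\<in>C. d x y)"

definition borel_asdim_le :: "'x measure \<Rightarrow> ('x \<times> 'x) set \<Rightarrow> nat \<Rightarrow> bool" where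
  "borel_asdim_le \<Omega> E n \<longleftrightarrow>
     (\<forall>r>0. \<exists>U :: nat \<Rightarrow> 'x set. \<exists>R::real.
        (\<forall>i\<le>n. U i \<in> sets \<Omega>) \<and> (\<Union>i\<le>n. U i) = space \<Omega> \<and>
        (\<forall>i\<le>n. \<forall>C\<in>r_components (path_metric E) r (U i). ediameter (path_metric E) C \<le> ennreal R))"

definition borel_asdim :: "'x measure \<Rightarrow> ('x \<times> 'x) set \<Rightarrow> enat" where
  "borel_asdim \<Omega> E = (INF n\<in>{n. borel_asdim_le \<Omega> E n}. enat n)"

definition borel_asdim_action ::
    "'x measure \<Rightarrow> 'm set \<Rightarrow> ('m \<Rightarrow> 'x \<Rightarrow> 'x) \<Rightarrow> enat" where
  "borel_asdim_action \<Omega> S act = borel_asdim \<Omega> (schreier_graph \<Omega> S act)"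


section \<open>Consistency of the definitions\<close>

lemma borel_asdim_le_mono:
  assumes "borel_asdim_le \<Omega> E m" "m \<le> n"
  shows "borel_asdim_le \<Omega> E n"
  unfolding borel_asdim_le_def
proof (intro allI impI)
  fix r :: real assume "r > 0"
  then obtain U :: "nat \<Rightarrow> 'a set" and R :: real where U: "\<forall>i\<le>m. U i \<in> sets \<Omega>" "(\<Union>i\<le>m. U i) = space \<Omega>"
    "\<forall>i\<le>m. \<forall>C\<in>r_components (path_metric E) r (U i). ediameter (path_metric E) C \<le> ennreal R"
    using assms(1)[unfolded borel_asdim_le_def, rule_format, OF \<open>r > 0\<close>] by (elim exE conjE) (rule that)
  define V where "V i = (if i \<le> m then U i else {})" for i
  have "(\<Union>i\<le>n. V i) = (\<Union>i\<le>m. U i)"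
    using assms(2) unfolding V_def by (force split: if_splits)
  moreover have "\<forall>i\<le>n. \<forall>C\<in>r_components (path_metric E) r (V i). ediameter (path_metric E) C \<le> ennreal R"
    using U(3) by (auto simp: V_def r_components_def)
  moreover have "\<forall>i\<le>n. V i \<in> sets \<Omega>"
    using U(1) by (simp add: V_def)
  ultimately show "\<exists>U R. (\<forall>i\<le>n. U i \<in> sets \<Omega>) \<and> (\<Union>i\<le>n. U i) = space \<Omega> \<and>
      (\<forall>i\<le>n. \<forall>C\<in>r_components (path_metric E) r (U i). ediameter (path_metric E) C \<le> ennreal R)"
    using U(2) by (intro exI[of _ V] exI[of _ R]) simp
qed

lemma borel_asdim_le_iff: "borel_asdim \<Omega> E \<le> enat n \<longleftrightarrow> borel_asdim_le \<Omega> E n"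
proof
  assume *: "borel_asdim \<Omega> E \<le> enat n"
  have "{n. borel_asdim_le \<Omega> E n} \<noteq> {}"
  proof
    assume "{n. borel_asdim_le \<Omega> E n} = {}"
    with * show False by (simp add: borel_asdim_def top_enat_def del: Collect_empty_eq)
  qed
  then obtain k where "k \<in> {n. borel_asdim_le \<Omega> E n}" by blast
  then have "borel_asdim \<Omega> E \<in> enat ` {n. borel_asdim_le \<Omega> E n}"
    unfolding borel_asdim_def by (intro wellorder_InfI[of "enat k"] imageI)
  then obtain m where "borel_asdim \<Omega> E = enat m" "borel_asdim_le \<Omega> E m" by (elim imageE) simp
  then show "borel_asdim_le \<Omega> E n" using * borel_asdim_le_mono[of \<Omega> E m n] by simp
next
  assume "borel_asdim_le \<Omega> E n"
  then show "borel_asdim \<Omega> E \<le> enat n" by (simp add: borel_asdim_def INF_lower)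
qed

context comm_monoid
begin

lemma equiv_gp_rel: "equiv (carrier G \<times> carrier G) (gp_rel G)"
proof (rule equivI)
  show "gp_rel G \<subseteq> (carrier G \<times> carrier G) \<times> (carrier G \<times> carrier G)"
    by (auto simp: gp_rel_def)
  show "refl_on (carrier G \<times> carrier G) (gp_rel G)"
    by (auto simp: refl_on_def gp_rel_def)
  show "sym (gp_rel G)" by (auto simp: sym_def gp_rel_def eq_commute)
  show "trans (gp_rel G)"
  proof (rule transI, clarify)
    fix a b a' b' a'' b''
    assume 1: "((a, b), (a', b')) \<in> gp_rel G" and 2: "((a', b'), (a'', b'')) \<in> gp_rel G"
    then have cl: "a \<in> carrier G" "b \<in> carrier G" "a' \<in> carrier G" "b' \<in> carrier G"
      "a'' \<in> carrier G" "b'' \<in> carrier G" by (auto simp: gp_rel_def)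
    from 1 2 obtain c d where c: "c \<in> carrier G" "a \<otimes> b' \<otimes> c = a' \<otimes> b \<otimes> c"
      and d: "d \<in> carrier G" "a' \<otimes> b'' \<otimes> d = a'' \<otimes> b' \<otimes> d" by (auto simp: gp_rel_def)
    have "a \<otimes> b'' \<otimes> (b' \<otimes> c \<otimes> d) = (a \<otimes> b' \<otimes> c) \<otimes> (b'' \<otimes> d)"
      using cl c(1) d(1) by (simp add: m_ac)
    also have "\<dots> = (a' \<otimes> b'' \<otimes> d) \<otimes> (b \<otimes> c)"
      using cl c d(1) by (simp only: c(2)) (simp add: m_ac)
    also have "\<dots> = a'' \<otimes> b \<otimes> (b' \<otimes> c \<otimes> d)"
      using cl c(1) d(1) by (simp only: d(2)) (simp add: m_ac)
    finally show "((a, b), (a'', b'')) \<in> gp_rel G"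
      using cl c(1) d(1) unfolding gp_rel_def by blast
  qed
qed

lemma group_completion_mult:
  assumes "a \<in> carrier G" "b \<in> carrier G" "a' \<in> carrier G" "b' \<in> carrier G"
  shows "gp_rel G `` {(a, b)} \<otimes>\<^bsub>group_completion G\<^esub> gp_rel G `` {(a', b')} =
         gp_rel G `` {(a \<otimes> a', b \<otimes> b')}"
proof -
  let ?f = "\<lambda>p q. gp_rel G `` {(fst p \<otimes> fst q, snd p \<otimes> snd q)}"
  have "congruent2 (gp_rel G) (gp_rel G) ?f"
  proof (rule congruent2I', clarify)
    fix a b x y a' b' x' y'
    assume 1: "((a, b), (x, y)) \<in> gp_rel G" and 2: "((a', b'), (x', y')) \<in> gp_rel G"
    then have cl: "a \<in> carrier G" "b \<in> carrier G" "x \<in> carrier G" "y \<in> carrier G"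
      "a' \<in> carrier G" "b' \<in> carrier G" "x' \<in> carrier G" "y' \<in> carrier G" by (auto simp: gp_rel_def)
    from 1 2 obtain c d where c: "c \<in> carrier G" "a \<otimes> y \<otimes> c = x \<otimes> b \<otimes> c"
      and d: "d \<in> carrier G" "a' \<otimes> y' \<otimes> d = x' \<otimes> b' \<otimes> d" by (auto simp: gp_rel_def)
    have "a \<otimes> a' \<otimes> (y \<otimes> y') \<otimes> (c \<otimes> d) = (a \<otimes> y \<otimes> c) \<otimes> (a' \<otimes> y' \<otimes> d)"
      using cl c(1) d(1) by (simp add: m_ac)
    also have "\<dots> = x \<otimes> x' \<otimes> (b \<otimes> b') \<otimes> (c \<otimes> d)"
      using cl c(1) d(1) by (simp only: c(2) d(2)) (simp add: m_ac)
    finally have "((a \<otimes> a', b \<otimes> b'), (x \<otimes> x', y \<otimes> y')) \<in> gp_rel G"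
      using cl c(1) d(1) unfolding gp_rel_def by blast
    then show "?f (a, b) (a', b') = ?f (x, y) (x', y')"
      using equiv_class_eq[OF equiv_gp_rel] by simp
  qed
  from UN_equiv_class2[OF equiv_gp_rel equiv_gp_rel this, of "(a, b)" "(a', b')"] assms
  show ?thesis by (simp add: group_completion_def case_prod_unfold)
qed

lemma comm_group_group_completion: "comm_group (group_completion G)"
proof -
  have carr: "carrier (group_completion G) =
      {gp_rel G `` {(a, b)} | a b. a \<in> carrier G \<and> b \<in> carrier G}"
    by (auto simp: group_completion_def quotient_def)
  have one: "\<one>\<^bsub>group_completion G\<^esub> = gp_rel G `` {(\<one>, \<one>)}"
    by (simp add: group_completion_def)
  show ?thesis
  proof (rule comm_groupI)
    fix P assume "P \<in> carrier (group_completion G)"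
    then obtain a b where P: "P = gp_rel G `` {(a, b)}" "a \<in> carrier G" "b \<in> carrier G"
      by (auto simp: carr)
    then have "((b \<otimes> a, a \<otimes> b), (\<one>, \<one>)) \<in> gp_rel G"
      by (auto simp: gp_rel_def m_comm)
    then have "gp_rel G `` {(b, a)} \<otimes>\<^bsub>group_completion G\<^esub> P = \<one>\<^bsub>group_completion G\<^esub>"
      using P equiv_class_eq[OF equiv_gp_rel] by (simp add: group_completion_mult one)
    then show "\<exists>Q\<in>carrier (group_completion G). Q \<otimes>\<^bsub>group_completion G\<^esub> P = \<one>\<^bsub>group_completion G\<^esub>"
      using P by (auto simp: carr)
  next
    fix P Q assume "P \<in> carrier (group_completion G)" "Q \<in> carrier (group_completion G)"
    then show "P \<otimes>\<^bsub>group_completion G\<^esub> Q \<in> carrier (group_completion G)"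
      unfolding carr by (force simp: group_completion_mult)
  qed (auto simp: carr one group_completion_mult m_ac)
qed

end

end

theory Submission
  imports Defs "HOL-Algebra.FiniteProduct" "HOL-Library.Function_Algebras"
begin

text \<open>
  The generators act by commuting maps \<open>T v\<close>, \<open>v \<in> \<nat>\<^sup>S\<close>; shifting by a large constant vector lets a point
  see a whole ball of \<open>\<int>\<^sup>S\<close> in front of it. Selecting markers greedily in the view of each point, along a
  finite Borel colouring, produces for every scale \<open>\<rho>\<close> a cover by \<open>4 ^ |S|\<close> Borel sets such that
  \<open>\<rho>\<close>-close points of one set have a common bounded forward image. Let \<open>n\<close> be the corank of the
  relations known to hold. Among points satisfying no further short relation, the displacement to the common image
  yields coordinates in \<open>\<int>\<^sup>n\<close>, and the standard cover of \<open>\<int>\<^sup>n\<close> by \<open>n + 1\<close> families pulls back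
  with bounds that do not depend on \<open>\<rho>\<close>. As the number of sets does not depend on \<open>\<rho>\<close> either, they can be
  merged one after the other at increasing scales. The remaining points lie in finitely many Borel sets on each of
  which one more relation holds, so induction on \<open>n\<close> applies, and these sets are merged as well.

  The existence of finite Borel colourings rests on the theorem of Lusin and Souslin that a bounded-to-one Borel map
  between standard Borel spaces maps Borel sets to Borel sets.
\<close>

section \<open>Borel codes and images under bounded-to-one maps\<close>

text \<open>The maps need not be invertible, so a marker may look chosen to one viewer and not to
  another. Separation and maximality of markers are therefore asserted only relative to a single
  viewer, and two nearby viewers are made to agree only at a radius where enlarging the view reveals
  no new label. For the same reason proximity is measured by a bounded common forward image
  (\<open>near\<close>). The order in which constants are fixed is decisive. Displacements to the
  common image are bounded by a \<open>Q\<close> that grows with \<rho> and with the number of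
  colours, so a final estimate through \<open>Q\<close> would be circular. \<open>Q\<close> enters
  only into the length \<open>W\<close> of the relations to be excluded, and the set where such a
  relation holds is merged last, when no later scale depends on its bound. Bounded fibres serve
  twice: they bound the degrees of the graphs to be coloured, and they make images, hence
  neighbourhoods in these graphs, Borel.\<close>

definition agree :: "nat \<Rightarrow> (nat \<Rightarrow> nat) \<Rightarrow> (nat \<Rightarrow> nat) \<Rightarrow> bool" where
  "agree n \<alpha> \<beta> \<longleftrightarrow> (\<forall>i<n. \<alpha> i = \<beta> i)"

lemma agree_refl [simp]: "agree n \<alpha> \<alpha>"
  by (simp add: agree_def)

lemma agree_sym: "agree n \<alpha> \<beta> \<Longrightarrow> agree n \<beta> \<alpha>"
  by (simp add: agree_def)

lemma agree_trans: "agree n \<alpha> \<beta> \<Longrightarrow> agree n \<beta> \<gamma> \<Longrightarrow> agree n \<alpha> \<gamma>"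
  by (simp add: agree_def)

lemma agree_mono: "agree n \<alpha> \<beta> \<Longrightarrow> m \<le> n \<Longrightarrow> agree m \<alpha> \<beta>"
  by (simp add: agree_def)

text \<open>This is closedness of the image of \<open>B\<close> under \<open>l\<close> in Baire
  space: a sequence all of whose finite prefixes are realised in \<open>B\<close> is itself a
  code.\<close>

definition baire_closed :: "'x set \<Rightarrow> ('x \<Rightarrow> nat \<Rightarrow> nat) \<Rightarrow> bool" where
  "baire_closed B l \<longleftrightarrow> (\<forall>\<alpha>. (\<forall>n. \<exists>x\<in>B. agree n (l x) \<alpha>) \<longrightarrow> (\<exists>x\<in>B. l x = \<alpha>))"

text \<open>Openness in the topology pulled back along \<open>l\<close> from Baire space. Only
  \<open>X \<inter> U\<close> matters, so complements may be written \<open>- U\<close>.\<close>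

definition code_open :: "'x set \<Rightarrow> ('x \<Rightarrow> nat \<Rightarrow> nat) \<Rightarrow> 'x set \<Rightarrow> bool" where
  "code_open X l U \<longleftrightarrow> (\<forall>x\<in>X \<inter> U. \<exists>n. \<forall>y\<in>X. agree n (l y) (l x) \<longrightarrow> y \<in> U)"

text \<open>A code identifies the space with a closed subset of Baire space carrying a finer topology; it is refined
  so that prescribed Borel sets become clopen.\<close>

definition polish_code :: "'x topology \<Rightarrow> ('x \<Rightarrow> nat \<Rightarrow> nat) \<Rightarrow> bool" where
  "polish_code T l \<longleftrightarrow> baire_closed (topspace T) l \<and> (\<forall>V. openin T V \<longrightarrow> code_open (topspace T) l V)"

lemma polish_codeD:
  assumes "polish_code T l"
  shows "(\<And>n. \<exists>x\<in>topspace T. agree n (l x) \<alpha>) \<Longrightarrow> \<exists>x\<in>topspace T. l x = \<alpha>"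
    and "openin T V \<Longrightarrow> x \<in> V \<Longrightarrow> \<exists>n. \<forall>y\<in>topspace T. agree n (l y) (l x) \<longrightarrow> y \<in> V"
  using assms openin_subset[of T V] unfolding polish_code_def baire_closed_def code_open_def by blast+

lemma second_countable_base_sequence:
  fixes T :: "'x topology"
  assumes "second_countable T"
  obtains B :: "nat \<Rightarrow> 'x set" where "\<And>i. openin T (B i)"
    "\<And>V x. openin T V \<Longrightarrow> x \<in> V \<Longrightarrow> \<exists>i. x \<in> B i \<and> B i \<subseteq> V"
proof -
  obtain \<B> where \<B>: "countable \<B>" "\<forall>V\<in>\<B>. openin T V"
    "\<forall>U x. openin T U \<and> x \<in> U \<longrightarrow> (\<exists>V\<in>\<B>. x \<in> V \<and> V \<subseteq> U)"
    using assms unfolding second_countable_def by blast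
  let ?B = "from_nat_into (insert {} \<B>)"
  have r: "range ?B = insert {} \<B>"
    using \<B>(1) by (intro range_from_nat_into) auto
  show thesis
  proof (rule that[of ?B])
    fix i
    have "?B i \<in> insert {} \<B>" using r by blast
    then show "openin T (?B i)" using \<B>(2) by auto
  next
    fix V x assume "openin T V" "x \<in> V"
    then obtain W where "W \<in> \<B>" "x \<in> W" "W \<subseteq> V" using \<B>(3) by blast
    moreover then obtain i where "?B i = W" using r by (metis insertCI rangeE)
    ultimately show "\<exists>i. x \<in> ?B i \<and> ?B i \<subseteq> V" by blast
  qed
qed

text \<open>Membership bits for a countable base would already make open sets code-open, but codes
  could then converge to a sequence that is no code. Each positive bit therefore carries a witness,
  a base set whose closure stays inside, and the odd coordinates name base sets inside balls of
  radius \<open>1/2^n\<close>. Points with converging codes then form a Cauchy sequence, and the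
  witnesses keep its limit in the right base sets.\<close>

lemma polish_code_exists:
  fixes T :: "'x topology"
  assumes "completely_metrizable_space T" "second_countable T"
  obtains l where "polish_code T l"
proof -
  obtain M d where "Metric_space M d" and mc: "Metric_space.mcomplete M d"
    and T: "T = Metric_space.mtopology M d"
    using assms(1) unfolding completely_metrizable_space_def by blast
  then interpret Metric_space M d by blast
  have top: "topspace T = M" by (simp add: T)
  obtain B :: "nat \<Rightarrow> 'x set" where Bop: "\<And>i. openin T (B i)"
    and Bbase: "\<And>V x. openin T V \<Longrightarrow> x \<in> V \<Longrightarrow> \<exists>i. x \<in> B i \<and> B i \<subseteq> V"
    by (rule second_countable_base_sequence[OF assms(2)]) (rule that)
  have BM: "B i \<subseteq> M" for i using openin_subset[OF Bop] top by auto
  define in_ball where "in_ball n i \<longleftrightarrow> (\<exists>c\<in>M. B i \<subseteq> mball c (1/2^n))" for n i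
  define inside where "inside i j \<longleftrightarrow> T closure_of B j \<subseteq> B i" for i j
  \<comment> \<open>The value 0 marks a point outside the base set, hence the \<open>Suc\<close> on
    the witness. Least indices make the code a function of the point; minimality survives limits
    because finitely many membership bits decide it.\<close>
  define l where "l x m = (if even m then
      (if x \<in> B (m div 2) then Suc (LEAST j. x \<in> B j \<and> inside (m div 2) j) else 0)
      else (LEAST i. x \<in> B i \<and> in_ball (m div 2) i))" for x m
  have ex_in_ball: "\<exists>i. x \<in> B i \<and> in_ball n i" if "x \<in> M" for x n
    using Bbase[of "mball x (1/2^n)" x] that unfolding in_ball_def T by auto
  have ex_inside: "\<exists>j. x \<in> B j \<and> inside i j" if x: "x \<in> B i" for x i
  proof -
    obtain e where e: "e > 0" "mball x e \<subseteq> B i"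
      using Bop[of i] x unfolding T openin_mtopology by blast
    have xM: "x \<in> M" using BM x by blast
    obtain j where j: "x \<in> B j" "B j \<subseteq> mball x (e/2)"
      using Bbase[of "mball x (e/2)" x] e(1) xM by (auto simp: T)
    have "B j \<subseteq> mcball x (e/2)" using j(2) by auto
    then have "T closure_of B j \<subseteq> mcball x (e/2)"
      unfolding T by (intro closure_of_minimal) auto
    also have "\<dots> \<subseteq> mball x e" using e(1) by (auto simp: subset_iff)
    finally show ?thesis using j(1) e(2) unfolding inside_def by blast
  qed
  have bit: "l x (2*i) \<noteq> 0 \<longleftrightarrow> x \<in> B i" for x i by (simp add: l_def)
  show thesis
  proof (rule that[of l], unfold polish_code_def baire_closed_def code_open_def, safe)
    fix \<alpha> assume "\<forall>n. \<exists>x\<in>topspace T. agree n (l x) \<alpha>"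
    then obtain y where y: "\<And>n. y n \<in> M" "\<And>n. agree n (l (y n)) \<alpha>"
      unfolding top by metis
    have ly: "l (y k) m = \<alpha> m" if "m < k" for k m using y(2)[of k] that by (auto simp: agree_def)
    have yB: "y k \<in> B i \<longleftrightarrow> \<alpha> (2*i) \<noteq> 0" if "2*i < k" for k i
      using bit[of "y k" i] ly[OF that] by simp
    have odd: "y k \<in> B (\<alpha> (2*n+1)) \<and> in_ball n (\<alpha> (2*n+1))" if "2*n+1 < k" for n k
    proof -
      have "\<alpha> (2*n+1) = (LEAST i. y k \<in> B i \<and> in_ball n i)"
        using ly[OF that] by (simp add: l_def)
      then show ?thesis using LeastI_ex[OF ex_in_ball[OF y(1)[of k], of n]] by simp
    qed
    have even: "y k \<in> B j \<and> inside i j" if "2*i < k" "\<alpha> (2*i) = Suc j" for i j k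
    proof -
      have "y k \<in> B i" using yB that by simp
      moreover then have "j = (LEAST j. y k \<in> B j \<and> inside i j)"
        using ly[OF that(1)] that(2) by (simp add: l_def)
      ultimately show ?thesis using LeastI_ex[OF ex_inside[of "y k" i]] by simp
    qed
    have "MCauchy y"
      unfolding MCauchy_def
    proof safe
      fix n show "y n \<in> M" by (rule y)
    next
      fix e :: real assume "e > 0"
      then obtain n where n: "(1/2::real)^n < e/2" using real_arch_pow_inv[of "e/2" "1/2"] by auto
      show "\<exists>N. \<forall>n n'. N \<le> n \<longrightarrow> N \<le> n' \<longrightarrow> d (y n) (y n') < e"
      proof (intro exI allI impI)
        fix k k' assume k: "2*n+2 \<le> k" "2*n+2 \<le> k'"
        obtain c where c: "c \<in> M" "B (\<alpha> (2*n+1)) \<subseteq> mball c (1/2^n)"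
          using odd[of n k] k by (auto simp: in_ball_def)
        then have "d c (y k) < 1/2^n" "d c (y k') < 1/2^n"
          using odd[of n k] odd[of n k'] k by auto
        moreover have "d (y k) (y k') \<le> d c (y k) + d c (y k')"
          using triangle''[of "y k" "y k'" c] y(1) c(1) commute by (metis triangle)
        ultimately show "d (y k) (y k') < e" using n by (simp add: power_one_over)
      qed
    qed
    then obtain x where x: "limitin mtopology y x sequentially"
      using mc unfolding mcomplete_def by blast
    then have xM: "x \<in> M" by (simp add: limitin_mspace)
    have xB: "x \<in> B i \<longleftrightarrow> \<alpha> (2*i) \<noteq> 0" for i
    proof
      assume "x \<in> B i"
      then have "eventually (\<lambda>k. y k \<in> B i) sequentially"
        using x Bop[of i] unfolding limitin_def T by blast
      then have "eventually (\<lambda>k. y k \<in> B i \<and> 2*i < k) sequentially"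
        using eventually_gt_at_top[of "2*i"] by eventually_elim simp
      then show "\<alpha> (2*i) \<noteq> 0" using yB eventually_happens'[OF sequentially_bot] by blast
    next
      assume "\<alpha> (2*i) \<noteq> 0"
      then obtain j where j: "\<alpha> (2*i) = Suc j" using not0_implies_Suc by blast
      have "eventually (\<lambda>k. y k \<in> T closure_of B j) sequentially"
        using eventually_gt_at_top[of "2*i"]
      proof eventually_elim
        case (elim k)
        then show ?case using even[OF elim j] closure_of_subset[of "B j" T] BM top by blast
      qed
      then have "x \<in> T closure_of B j"
        using limitin_closedin[OF x, of "T closure_of B j"] by (simp add: T)
      then show "x \<in> B i" using even[of i "Suc (2*i)", OF _ j] unfolding inside_def by auto
    qed
    have "l x m = \<alpha> m" for m
    proof (cases "even m")
      case True
      then obtain i where m: "m = 2*i" by blast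
      show ?thesis
      proof (cases "x \<in> B i")
        case False
        then show ?thesis using xB[of i] m by (simp add: l_def)
      next
        case T: True
        then obtain j where j: "\<alpha> (2*i) = Suc j" using xB not0_implies_Suc by blast
        \<comment> \<open>An index beyond \<open>2*j\<close> and \<open>2*i\<close>: there
          \<open>y ?k\<close> has the same membership bits as \<open>x\<close> for all base sets up
          to \<open>B j\<close>, so both have the same least witness.\<close>
        let ?k = "2*j + 2*i + 1"
        have "Suc j = l (y ?k) (2*i)" using ly[of "2*i" ?k] j by simp
        then have "j = (LEAST j. y ?k \<in> B j \<and> inside i j)"
          using yB[of i ?k] j by (simp add: l_def)
        then have "\<And>q. q < j \<Longrightarrow> \<not> (y ?k \<in> B q \<and> inside i q)"
          using not_less_Least by metis
        then have nq: "\<And>q. q < j \<Longrightarrow> \<not> (x \<in> B q \<and> inside i q)"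
          using xB yB by simp
        have "x \<in> B j \<and> inside i j"
          using even[of i ?k j] j yB[of j ?k] xB by simp
        then have "(LEAST j. x \<in> B j \<and> inside i j) = j"
          using nq by (intro Least_equality) (auto simp: not_less[symmetric])
        then show ?thesis using T j m by (simp add: l_def)
      qed
    next
      case False
      then obtain n where m: "m = 2*n+1" using oddE by blast
      define j where "j = \<alpha> m"
      let ?k = "2*j + m + 1"
      have "l (y ?k) m = j" using ly[of m ?k] by (simp add: j_def)
      then have "j = (LEAST j. y ?k \<in> B j \<and> in_ball n j)" using m by (simp add: l_def)
      then have "\<And>q. q < j \<Longrightarrow> \<not> (y ?k \<in> B q \<and> in_ball n q)"
        using not_less_Least by metis
      then have nq: "\<And>q. q < j \<Longrightarrow> \<not> (x \<in> B q \<and> in_ball n q)"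
        using xB yB by simp
      have "x \<in> B j \<and> in_ball n j"
        using odd[of n ?k] m yB[of j ?k] xB by (simp add: j_def)
      then have "(LEAST j. x \<in> B j \<and> in_ball n j) = j"
        using nq by (intro Least_equality) (auto simp: not_less[symmetric])
      then show ?thesis using m by (simp add: l_def j_def)
    qed
    then have "l x = \<alpha>" by blast
    then show "\<exists>x\<in>topspace T. l x = \<alpha>" using xM top by blast
  next
    fix V x assume V: "openin T V" "x \<in> topspace T" "x \<in> V"
    obtain i where i: "x \<in> B i" "B i \<subseteq> V" using Bbase[OF V(1,3)] by blast
    have "y \<in> V" if "agree (2*i+1) (l y) (l x)" for y
    proof -
      have "l y (2*i) = l x (2*i)" using that by (simp add: agree_def)
      then have "y \<in> B i" using bit[of x i] bit[of y i] i(1) by simp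
      then show ?thesis using i(2) by blast
    qed
    then show "\<exists>n. \<forall>y\<in>topspace T. agree n (l y) (l x) \<longrightarrow> y \<in> V" by blast
  qed
qed

lemma code_open_refine:
  assumes "code_open X l U"
    and "\<And>m. \<exists>n. \<forall>x\<in>X. \<forall>y\<in>X. agree n (l' y) (l' x) \<longrightarrow> agree m (l y) (l x)"
  shows "code_open X l' U"
  unfolding code_open_def
proof
  fix x assume x: "x \<in> X \<inter> U"
  then obtain m where m: "\<forall>y\<in>X. agree m (l y) (l x) \<longrightarrow> y \<in> U"
    using assms(1) unfolding code_open_def by blast
  obtain n where "\<forall>x\<in>X. \<forall>y\<in>X. agree n (l' y) (l' x) \<longrightarrow> agree m (l y) (l x)"
    using assms(2) by blast
  then show "\<exists>n. \<forall>y\<in>X. agree n (l' y) (l' x) \<longrightarrow> y \<in> U" using m x by blast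
qed

text \<open>Interleaving makes every prefix of one \<open>l m\<close> readable from a long prefix of
  \<open>l'\<close>. A limit of \<open>l'\<close> yields one point per code; were two of them
  different, disjoint open neighbourhoods, each open for its own code, would share an approximating
  point.\<close>

lemma polish_code_combine:
  fixes l :: "nat \<Rightarrow> 'x \<Rightarrow> nat \<Rightarrow> nat"
  assumes l: "\<And>m. polish_code T (l m)" and "Hausdorff_space T"
  obtains l' where "polish_code T l'" "\<And>m U. code_open (topspace T) (l m) U \<Longrightarrow> code_open (topspace T) l' U"
proof -
  define l' where "l' x k = (case prod_decode k of (m, i) \<Rightarrow> l m x i)" for x k
  have ref': "\<exists>n. \<forall>x \<alpha>. agree n (l' x) \<alpha> \<longrightarrow> agree p (l m x) (\<lambda>i. \<alpha> (prod_encode (m, i)))" for m p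
  proof -
    define n where "n = Suc (Max (insert 0 ((\<lambda>i. prod_encode (m, i)) ` {..<p})))"
    have n: "prod_encode (m, i) < n" if "i < p" for i
      unfolding n_def using that by (intro le_imp_less_Suc Max_ge) auto
    have "l m x i = \<alpha> (prod_encode (m, i))" if "agree n (l' x) \<alpha>" "i < p" for x \<alpha> i
    proof -
      have "l' x (prod_encode (m, i)) = \<alpha> (prod_encode (m, i))" using n[OF that(2)] that(1)
        by (simp add: agree_def)
      then show ?thesis by (simp add: l'_def)
    qed
    then show ?thesis unfolding agree_def by blast
  qed
  have ref: "\<exists>n. \<forall>x y. agree n (l' y) (l' x) \<longrightarrow> agree p (l m y) (l m x)" for m p
  proof -
    obtain n where n: "\<And>x \<alpha>. agree n (l' x) \<alpha> \<Longrightarrow> agree p (l m x) (\<lambda>i. \<alpha> (prod_encode (m, i)))"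
      using ref'[of p m] by blast
    have "agree p (l m y) (l m x)" if "agree n (l' y) (l' x)" for x y
      using n[OF that] by (simp add: l'_def)
    then show ?thesis by blast
  qed
  have op: "code_open (topspace T) l' U" if "code_open (topspace T) (l m) U" for m U
    by (rule code_open_refine[OF that]) (use ref in blast)
  show thesis
  proof (rule that[of l'])
    show "polish_code T l'"
      unfolding polish_code_def
    proof (intro conjI allI impI)
      fix V assume "openin T V"
      then show "code_open (topspace T) l' V" using l[of 0] op[of 0] unfolding polish_code_def by blast
    next
      show "baire_closed (topspace T) l'"
        unfolding baire_closed_def
      proof (intro allI impI)
        fix \<alpha> assume \<alpha>: "\<forall>n. \<exists>x\<in>topspace T. agree n (l' x) \<alpha>"
        have "\<exists>x\<in>topspace T. l m x = (\<lambda>i. \<alpha> (prod_encode (m, i)))" for m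
        proof (rule polish_codeD(1)[OF l])
          fix p
          show "\<exists>x\<in>topspace T. agree p (l m x) (\<lambda>i. \<alpha> (prod_encode (m, i)))"
            using ref'[of p m] \<alpha> by blast
        qed
        then have "\<forall>m. \<exists>x. x \<in> topspace T \<and> l m x = (\<lambda>i. \<alpha> (prod_encode (m, i)))" by blast
        then obtain x where x: "\<And>m. x m \<in> topspace T" "\<And>m. l m (x m) = (\<lambda>i. \<alpha> (prod_encode (m, i)))"
          by (metis (lifting))
        have xm: "x m = x 0" for m
        proof (rule ccontr)
          assume "x m \<noteq> x 0"
          then obtain V W where VW: "openin T V" "openin T W" "x m \<in> V" "x 0 \<in> W" "disjnt V W"
            using assms(2) x(1)[of m] x(1)[of 0] unfolding Hausdorff_space_def by blast
          obtain p where p: "\<forall>y\<in>topspace T. agree p (l m y) (l m (x m)) \<longrightarrow> y \<in> V"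
            using polish_codeD(2)[OF l VW(1,3)] by blast
          obtain q where q: "\<forall>y\<in>topspace T. agree q (l 0 y) (l 0 (x 0)) \<longrightarrow> y \<in> W"
            using polish_codeD(2)[OF l VW(2,4)] by blast
          obtain n where n: "\<forall>x. agree n (l' x) \<alpha> \<longrightarrow> agree p (l m x) (\<lambda>i. \<alpha> (prod_encode (m, i)))"
            using ref' by blast
          obtain n' where n': "\<forall>x. agree n' (l' x) \<alpha> \<longrightarrow> agree q (l 0 x) (\<lambda>i. \<alpha> (prod_encode (0, i)))"
            using ref' by blast
          obtain y where y: "y \<in> topspace T" "agree (max n n') (l' y) \<alpha>" using \<alpha> by blast
          then have "agree n (l' y) \<alpha>" "agree n' (l' y) \<alpha>"
            by (auto intro: agree_mono)
          then have "y \<in> V" "y \<in> W" using n n' p q x(2) y(1) by auto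
          then show False using VW(5) by (auto simp: disjnt_def)
        qed
        have "l m (x 0) i = \<alpha> (prod_encode (m, i))" for m i using x(2)[of m] unfolding xm[of m] by simp
        then have "l' (x 0) k = \<alpha> k" for k
          unfolding l'_def by (cases "prod_decode k") (metis case_prod_conv prod_decode_inverse)
        then show "\<exists>x\<in>topspace T. l' x = \<alpha>" using x(1) by blast
      qed
    qed
  qed (rule op)
qed

text \<open>Adding the bit of \<open>U\<close> alone could destroy closedness, since points of
  \<open>U\<close> may approach its boundary. The new coordinate also records how long a prefix
  guarantees membership in \<open>U\<close>; it is eventually constant along an approximating
  sequence, so the limit cannot leave \<open>U\<close>.\<close>

lemma polish_code_clopen:
  assumes l: "polish_code T l" and U: "code_open (topspace T) l U"
  obtains l' where "polish_code T l'" "\<And>V. code_open (topspace T) l V \<Longrightarrow> code_open (topspace T) l' V"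
    "code_open (topspace T) l' (- U)"
proof -
  let ?X = "topspace T"
  define P where "P x n \<longleftrightarrow> (\<forall>y\<in>?X. agree n (l y) (l x) \<longrightarrow> y \<in> U)" for x n
  define l' where "l' x = case_nat (if x \<in> U then Suc (LEAST n. P x n) else 0) (l x)" for x
  have Pcong: "P x n = P y n" if "agree n (l x) (l y)" for x y n
    unfolding P_def using agree_trans agree_sym that by metis
  have ref: "agree m (l y) (l x)" if "agree (Suc m) (l' y) (l' x)" for x y m
    using that unfolding agree_def l'_def by force
  have op: "code_open ?X l' V" if "code_open ?X l V" for V
    by (rule code_open_refine[OF that]) (use ref in blast)
  show thesis
  proof (rule that[of l'])
    show "polish_code T l'"
      unfolding polish_code_def
    proof (intro conjI allI impI)
      fix V assume "openin T V"
      then show "code_open ?X l' V" using l op unfolding polish_code_def by blast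
    next
      show "baire_closed ?X l'"
        unfolding baire_closed_def
      proof (intro allI impI)
        fix \<alpha> assume \<alpha>: "\<forall>n. \<exists>x\<in>?X. agree n (l' x) \<alpha>"
        have tl: "agree n (l x) (\<lambda>i. \<alpha> (Suc i))" if "agree (Suc n) (l' x) \<alpha>" for n x
          using that unfolding agree_def l'_def by force
        have "\<exists>x\<in>?X. l x = (\<lambda>i. \<alpha> (Suc i))"
          using polish_codeD(1)[OF l] \<alpha> tl by metis
        then obtain x where x: "x \<in> ?X" "l x = (\<lambda>i. \<alpha> (Suc i))" by blast
        have "l' x 0 = \<alpha> 0"
        proof (cases "x \<in> U")
          case True
          then obtain n where n: "P x n" using U x(1) unfolding code_open_def P_def by blast
          obtain y where y: "y \<in> ?X" "agree (Suc (n + \<alpha> 0)) (l' y) \<alpha>" using \<alpha> by blast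
          then have a: "agree (n + \<alpha> 0) (l y) (l x)" using tl x(2) by metis
          have "y \<in> U" using n y(1) a agree_mono unfolding P_def by (meson le_add1)
          then have y0: "\<alpha> 0 = Suc (LEAST n. P y n)" using y(2) by (auto simp: agree_def l'_def dest: spec[of _ 0])
          have "(LEAST n. P y n) = (LEAST n. P x n)"
          proof (rule Least_equality[symmetric])
            have "P y n" using n Pcong a agree_mono by (metis le_add1)
            then have "P y (LEAST n. P y n)" by (rule LeastI)
            moreover have "agree (LEAST n. P y n) (l y) (l x)"
              by (rule agree_mono[OF a]) (use y0 in simp)
            ultimately show "P x (LEAST n. P y n)" using Pcong by blast
          next
            fix q assume q: "P x q"
            show "(LEAST n. P y n) \<le> q"
            proof (rule ccontr)
              assume "\<not> (LEAST n. P y n) \<le> q"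
              then have "q < (LEAST n. P y n)" by simp
              moreover then have "P y q" using q Pcong[of q y x] a y0 agree_mono by fastforce
              ultimately show False using not_less_Least by blast
            qed
          qed
          then show ?thesis using True y0 by (simp add: l'_def)
        next
          case False
          obtain y where y: "y \<in> ?X" "agree (Suc (\<alpha> 0)) (l' y) \<alpha>" using \<alpha> by blast
          then have a: "agree (\<alpha> 0) (l y) (l x)" using tl x(2) by metis
          have "y \<notin> U"
          proof
            assume "y \<in> U"
            then have y0: "\<alpha> 0 = Suc (LEAST n. P y n)" using y(2) by (auto simp: agree_def l'_def dest: spec[of _ 0])
            obtain n where "P y n" using U \<open>y \<in> U\<close> y(1) unfolding code_open_def P_def by blast
            then have "P y (LEAST n. P y n)" by (rule LeastI)
            moreover have "agree (LEAST n. P y n) (l x) (l y)"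
              by (rule agree_mono[OF agree_sym[OF a]]) (use y0 in simp)
            ultimately show False using x(1) False unfolding P_def by blast
          qed
          then show ?thesis using y(2) False by (auto simp: agree_def l'_def dest: spec[of _ 0])
        qed
        then have "l' x k = \<alpha> k" for k using x(2) by (cases k) (auto simp: l'_def)
        then show "\<exists>x\<in>?X. l' x = \<alpha>" using x(1) by blast
      qed
    qed
    show "code_open ?X l' (- U)"
      unfolding code_open_def
    proof
      fix x assume "x \<in> ?X \<inter> - U"
      then have "\<forall>y\<in>?X. agree 1 (l' y) (l' x) \<longrightarrow> y \<in> - U" by (auto simp: agree_def l'_def split: if_splits)
      then show "\<exists>n. \<forall>y\<in>?X. agree n (l' y) (l' x) \<longrightarrow> y \<in> - U" by blast
    qed
  qed (rule op)
qed

lemma code_open_Union: "(\<And>i. i \<in> I \<Longrightarrow> code_open X l (U i)) \<Longrightarrow> code_open X l (\<Union>i\<in>I. U i)"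
  unfolding code_open_def by (metis IntE IntI UN_E UN_I)

lemma code_open_cong: "X \<inter> U = X \<inter> V \<Longrightarrow> code_open X l U = code_open X l V"
  unfolding code_open_def by blast

text \<open>Carrying a set together with its complement settles complements by symmetry. For a
  countable union, the combined code makes the union open, and one more refinement makes it
  clopen.\<close>

lemma polish_code_borel:
  assumes T: "completely_metrizable_space T" "second_countable T"
    and B: "B \<in> sigma_sets (topspace T) {U. openin T U}"
  shows "\<exists>l. polish_code T l \<and> code_open (topspace T) l B \<and> code_open (topspace T) l (- B)"
  using B
proof (induction rule: sigma_sets.induct)
  case (Basic U)
  obtain l where l: "polish_code T l" using polish_code_exists[OF T] by blast
  then have U: "code_open (topspace T) l U" using Basic unfolding polish_code_def by blast
  show ?case using polish_code_clopen[OF l U] U by metis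
next
  case Empty
  obtain l where l: "polish_code T l" using polish_code_exists[OF T] by blast
  then show ?case unfolding code_open_def by blast
next
  case (Compl B)
  moreover have "code_open (topspace T) l (- (topspace T - B)) = code_open (topspace T) l B"
    "code_open (topspace T) l (topspace T - B) = code_open (topspace T) l (- B)" for l
    by (rule code_open_cong; blast)+
  ultimately show ?case by metis
next
  case (Union B)
  then obtain l where l: "\<And>i. polish_code T (l i)" "\<And>i. code_open (topspace T) (l i) (B i)" by metis
  have "Hausdorff_space T"
    using T(1) completely_metrizable_imp_metrizable_space metrizable_imp_Hausdorff_space by blast
  then obtain l' where l': "polish_code T l'"
    "\<And>m U. code_open (topspace T) (l m) U \<Longrightarrow> code_open (topspace T) l' U"
    by (rule polish_code_combine[OF l(1)]) (rule that)
  then have U: "code_open (topspace T) l' (\<Union>i. B i)" using l(2) by (intro code_open_Union) blast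
  show ?case using polish_code_clopen[OF l'(1) U] U by metis
qed

section \<open>Simultaneous Borel separation of finitely many sets\<close>

definition separated :: "'y measure \<Rightarrow> 'i set \<Rightarrow> ('i \<Rightarrow> 'y set) \<Rightarrow> bool" where
  "separated N I Q \<longleftrightarrow> (\<exists>B. (\<forall>i\<in>I. B i \<in> sets N \<and> Q i \<subseteq> B i) \<and> (\<Inter>i\<in>I. B i) = {})"

text \<open>\<open>separated\<close> asks for an empty common intersection of the enclosing sets,
  not for pairwise disjointness; this is Lusin's separation for two sets and Novikov's for more.
  Given enclosures for each \<open>P n\<close>, those of index \<open>j\<close> are united and the
  others intersected: a common point would lie in \<open>B n j\<close> for some \<open>n\<close> and
  in every other \<open>B n i\<close>.\<close>

lemma separated_UN1:
  assumes "\<And>n::nat. separated N I (Q(j := P n))" "Q j \<subseteq> (\<Union>n. P n)" "j \<in> I"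
  shows "separated N I Q"
proof -
  have "\<forall>n. \<exists>B. (\<forall>i\<in>I. B i \<in> sets N \<and> (Q(j := P n)) i \<subseteq> B i) \<and> (\<Inter>i\<in>I. B i) = {}"
    using assms(1) unfolding separated_def by blast
  then obtain B where B: "\<And>n. \<forall>i\<in>I. B n i \<in> sets N \<and> (Q(j := P n)) i \<subseteq> B n i"
    "\<And>n. (\<Inter>i\<in>I. B n i) = {}" by metis
  define C where "C i = (if i = j then \<Union>n. B n j else \<Inter>n. B n i)" for i
  have "C i \<in> sets N \<and> Q i \<subseteq> C i" if "i \<in> I" for i
  proof (cases "i = j")
    case True
    have "P n \<subseteq> B n j" for n using B(1)[of n] assms(3) by fastforce
    then have "Q j \<subseteq> C j" using assms(2) unfolding C_def by (simp add: subset_iff) blast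
    moreover have "B n j \<in> sets N" for n using B(1) assms(3) by blast
    then have "C j \<in> sets N" unfolding C_def by auto
    ultimately show ?thesis using True by simp
  next
    case False
    have "Q i \<subseteq> B n i" for n using B(1)[of n] that False by fastforce
    moreover have "B n i \<in> sets N" for n using B(1) that by blast
    ultimately show ?thesis using False unfolding C_def by (auto intro!: sets.countable_INT'')
  qed
  moreover have "(\<Inter>i\<in>I. C i) = {}"
  proof (rule ccontr)
    assume "(\<Inter>i\<in>I. C i) \<noteq> {}"
    then obtain y where y: "\<And>i. i \<in> I \<Longrightarrow> y \<in> C i" by blast
    then have "y \<in> C j" using assms(3) by blast
    then obtain n where "y \<in> B n j" by (auto simp: C_def)
    moreover have "y \<in> B n i" if "i \<in> I" "i \<noteq> j" for i using y[OF that(1)] that(2) by (simp add: C_def)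
    ultimately have "y \<in> (\<Inter>i\<in>I. B n i)" by blast
    then show False using B(2) by blast
  qed
  ultimately show ?thesis unfolding separated_def by blast
qed

text \<open>The members are decomposed one index at a time while the others still stand for an
  arbitrary piece, hence the quantifier over \<open>c\<close> in the induction.\<close>

lemma separated_UN:
  fixes P :: "'i \<Rightarrow> nat \<Rightarrow> 'y set"
  assumes "finite I" and sep: "\<And>c. separated N I (\<lambda>i. P i (c i))"
  shows "separated N I (\<lambda>i. \<Union>n. P i n)"
proof -
  have "J \<subseteq> I \<Longrightarrow> \<forall>c. separated N I (\<lambda>i. if i \<in> J then \<Union>n. P i n else P i (c i))" if "finite J" for J
    using that
  proof (induction J)
    case empty
    then show ?case using sep by simp
  next
    case (insert j J)
    show ?case
    proof
      fix c
      show "separated N I (\<lambda>i. if i \<in> insert j J then \<Union>n. P i n else P i (c i))"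
      proof (rule separated_UN1[where j = j and P = "P j"])
        fix n
        have "(\<lambda>i. if i \<in> insert j J then \<Union>n. P i n else P i (c i))(j := P j n) =
            (\<lambda>i. if i \<in> J then \<Union>n. P i n else P i ((c(j := n)) i))"
          using insert.hyps(2) by (auto simp: fun_eq_iff)
        moreover have "\<forall>c. separated N I (\<lambda>i. if i \<in> J then \<Union>n. P i n else P i (c i))"
          using insert by blast
        ultimately show "separated N I ((\<lambda>i. if i \<in> insert j J then \<Union>n. P i n else P i (c i))(j := P j n))"
          by metis
      qed (use insert.prems in auto)
    qed
  qed
  from this[OF assms(1)] have "separated N I (\<lambda>i. if i \<in> I then \<Union>n. P i n else P i 0)"
    by (auto dest: spec[of _ "\<lambda>_. 0"])
  then show ?thesis unfolding separated_def by auto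
qed

definition cyl :: "'x set \<Rightarrow> ('x \<Rightarrow> nat \<Rightarrow> nat) \<Rightarrow> nat \<Rightarrow> (nat \<Rightarrow> nat) \<Rightarrow> 'x set" where
  "cyl B l n \<alpha> = {x \<in> B. agree n (l x) \<alpha>}"

lemma cyl_Suc: "cyl B l n \<alpha> = (\<Union>m. cyl B l (Suc n) (\<alpha>(n := m)))"
  by (auto simp: cyl_def agree_def less_Suc_eq)

lemma cyl_cong: "agree n \<alpha> \<beta> \<Longrightarrow> cyl B l n \<alpha> = cyl B l n \<beta>"
  unfolding cyl_def using agree_trans agree_sym by blast

lemma cyl_mono: "m \<le> n \<Longrightarrow> cyl B l n \<alpha> \<subseteq> cyl B l m \<alpha>"
  unfolding cyl_def using agree_mono by blast

text \<open>Lusin's separation argument: were the images not separable, neither would be those of smaller and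
  smaller cylinders, which shrink to more than \<open>K\<close> distinct points with the same image.\<close>

lemma separated_cylinders:
  fixes f :: "'x \<Rightarrow> 'y" and l :: "'x \<Rightarrow> nat \<Rightarrow> nat" and a :: "'i \<Rightarrow> nat \<Rightarrow> nat"
  assumes Y: "Hausdorff_space Y" "topspace Y = space N" "\<And>V. openin Y V \<Longrightarrow> V \<in> sets N"
    and fB: "f ` B \<subseteq> space N"
    and closed: "baire_closed B l"
    and cont: "\<And>x V. x \<in> B \<Longrightarrow> openin Y V \<Longrightarrow> f x \<in> V \<Longrightarrow> \<exists>n. f ` cyl B l n (l x) \<subseteq> V"
    and fib: "\<And>y. finite {x \<in> B. f x = y} \<and> card {x \<in> B. f x = y} \<le> K"
    and I: "finite I" "card I > K"
    and a: "\<And>i j. i \<in> I \<Longrightarrow> j \<in> I \<Longrightarrow> i \<noteq> j \<Longrightarrow> \<not> agree n (a i) (a j)"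
  shows "separated N I (\<lambda>i. f ` cyl B l n (a i))"
proof (rule ccontr)
  assume not_sep: "\<not> separated N I (\<lambda>i. f ` cyl B l n (a i))"
  define P where "P k A \<longleftrightarrow> \<not> separated N I (\<lambda>i. f ` cyl B l (n + k) (A i))" for k A
  have step: "\<exists>A'. P (Suc k) A' \<and> (\<forall>i. agree (n + k) (A' i) (A i))" if "P k A" for k and A :: "'i \<Rightarrow> nat \<Rightarrow> nat"
  proof -
    have "f ` cyl B l (n + k) (A i) = (\<Union>m. f ` cyl B l (Suc (n + k)) ((A i)(n + k := m)))" for i
      by (subst cyl_Suc) (rule image_UN)
    then have "\<not> separated N I (\<lambda>i. \<Union>m. f ` cyl B l (Suc (n + k)) ((A i)(n + k := m)))"
      using that unfolding P_def by simp
    then obtain c where "\<not> separated N I (\<lambda>i. f ` cyl B l (Suc (n + k)) ((A i)(n + k := c i)))"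
      using separated_UN[OF I(1), of N "\<lambda>i m. f ` cyl B l (Suc (n + k)) ((A i)(n + k := m))"] by blast
    then show ?thesis
      by (intro exI[of _ "\<lambda>i. (A i)(n + k := c i)"]) (auto simp: P_def agree_def)
  qed
  have "\<exists>A. A 0 = a \<and> (\<forall>k. P k (A k) \<and> (\<forall>i. agree (n + k) (A (Suc k) i) (A k i)))"
    using dependent_nat_choice[of "\<lambda>k A. P k A \<and> (k = 0 \<longrightarrow> A = a)" "\<lambda>k A A'. \<forall>i. agree (n + k) (A' i) (A i)"]
      step not_sep by (auto simp: P_def)
  then obtain A where A: "A 0 = a" "\<And>k. P k (A k)" "\<And>k i. agree (n + k) (A (Suc k) i) (A k i)" by blast
  have Amono: "agree (n + k) (A k' i) (A k i)" if "k \<le> k'" for k k' i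
    using that
  proof (induction rule: dec_induct)
    case (step m)
    have "agree (n + k) (A (Suc m) i) (A m i)" using A(3)[of m i] step.hyps by (auto intro: agree_mono)
    then show ?case using step.IH agree_trans by blast
  qed simp
  \<comment> \<open>Coordinate \<open>m\<close> no longer changes after stage \<open>Suc m\<close>,
    so this is the limit of the stages.\<close>
  define \<alpha> where "\<alpha> i m = A (Suc m) i m" for i m
  have \<alpha>A: "agree (n + k) (\<alpha> i) (A k i)" for k i
    unfolding agree_def
  proof (intro allI impI)
    fix m assume m: "m < n + k"
    show "\<alpha> i m = A k i m"
    proof (cases "k \<le> Suc m")
      case True
      then show ?thesis using Amono[OF True, of i] m by (simp add: agree_def \<alpha>_def)
    next
      case False
      then have "agree (n + Suc m) (A k i) (A (Suc m) i)" by (intro Amono) simp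
      then show ?thesis by (simp add: agree_def \<alpha>_def)
    qed
  qed
  have ns: "\<not> separated N I (\<lambda>i. f ` cyl B l (n + k) (\<alpha> i))" for k
    using A(2)[of k] unfolding P_def by (simp only: cyl_cong[OF \<alpha>A[of k]] simp_thms)
  have img: "f ` cyl B l k (\<alpha> i) \<subseteq> space N" for k i using fB by (auto simp: cyl_def)
  have "\<exists>x\<in>B. l x = \<alpha> i" if i: "i \<in> I" for i
  proof -
    have "\<exists>x\<in>B. agree k (l x) (\<alpha> i)" for k
    proof (rule ccontr)
      assume "\<not> (\<exists>x\<in>B. agree k (l x) (\<alpha> i))"
      then have "cyl B l k (\<alpha> i) = {}" by (auto simp: cyl_def)
      then have "cyl B l (n + k) (\<alpha> i) = {}" using cyl_mono[of k "n + k" B l "\<alpha> i"] by auto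
      then have "separated N I (\<lambda>i. f ` cyl B l (n + k) (\<alpha> i))"
        unfolding separated_def using img i
        by (intro exI[of _ "\<lambda>j. if j = i then {} else space N"]) auto
      then show False using ns by blast
    qed
    then show ?thesis using closed unfolding baire_closed_def by blast
  qed
  then have "\<forall>i\<in>I. \<exists>x. x \<in> B \<and> l x = \<alpha> i" by blast
  then obtain x where "\<forall>i\<in>I. x i \<in> B \<and> l (x i) = \<alpha> i" by (rule bchoice[THEN exE])
  then have x: "\<And>i. i \<in> I \<Longrightarrow> x i \<in> B" "\<And>i. i \<in> I \<Longrightarrow> l (x i) = \<alpha> i" by blast+
  have inj: "inj_on x I"
  proof (rule inj_onI, rule ccontr)
    fix i j assume ij: "i \<in> I" "j \<in> I" "x i = x j" "i \<noteq> j"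
    then have "\<alpha> i = \<alpha> j" using x(2) by metis
    then have "agree n (a i) (a j)" using \<alpha>A[of 0 i] \<alpha>A[of 0 j] A(1) agree_trans agree_sym by (metis add_0_right)
    then show False using a ij by blast
  qed
  have "\<exists>i\<in>I. \<exists>j\<in>I. f (x i) \<noteq> f (x j)"
  proof (rule ccontr)
    assume *: "\<not> ?thesis"
    have "I \<noteq> {}" using I by auto
    then obtain i where i: "i \<in> I" by blast
    then have "x ` I \<subseteq> {z \<in> B. f z = f (x i)}" using * x(1) by blast
    then have "card (x ` I) \<le> card {z \<in> B. f z = f (x i)}" using fib[of "f (x i)"] by (intro card_mono) auto
    then have "card I \<le> K" using fib[of "f (x i)"] card_image[OF inj] by linarith
    then show False using I by simp
  qed
  then obtain i j where ij: "i \<in> I" "j \<in> I" "f (x i) \<noteq> f (x j)" by blast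
  then have "f (x i) \<in> topspace Y" "f (x j) \<in> topspace Y" using x(1) fB Y(2) by auto
  then obtain V W where VW: "openin Y V" "openin Y W" "f (x i) \<in> V" "f (x j) \<in> W" "disjnt V W"
    using Y(1) ij(3) unfolding Hausdorff_space_def by metis
  obtain p where p: "f ` cyl B l p (\<alpha> i) \<subseteq> V" using cont[OF x(1)[OF ij(1)] VW(1,3)] x(2)[OF ij(1)] by auto
  obtain q where q: "f ` cyl B l q (\<alpha> j) \<subseteq> W" using cont[OF x(1)[OF ij(2)] VW(2,4)] x(2)[OF ij(2)] by auto
  have "f ` cyl B l (n + (p + q)) (\<alpha> i) \<subseteq> V" "f ` cyl B l (n + (p + q)) (\<alpha> j) \<subseteq> W"
    using p q image_mono[OF cyl_mono[of p "n + (p + q)" B l "\<alpha> i"], of f]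
      image_mono[OF cyl_mono[of q "n + (p + q)" B l "\<alpha> j"], of f] by auto
  then have "separated N I (\<lambda>i. f ` cyl B l (n + (p + q)) (\<alpha> i))"
    unfolding separated_def
  proof (intro exI[of _ "\<lambda>k. if k = i then V else if k = j then W else space N"] conjI ballI)
    show "(\<Inter>k\<in>I. if k = i then V else if k = j then W else space N) = {}"
      using ij VW(5) unfolding disjnt_def by (auto split: if_splits)
  qed (use img[of "n + (p+q)"] Y(3) VW(1,2) in auto)
  then show False using ns by blast
qed

text \<open>Koenig's lemma for a finitely branching tree. \<open>ext s\<close> keeps the
  construction on nodes with descendants of every length: were no child of such a node extendible,
  the finitely many children in \<open>T\<close> would all have died out by one level
  \<open>M\<close>, against a descendant of length \<open>M\<close>.\<close>

lemma koenig_lists: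
  assumes pre: "\<And>s n. s \<in> T \<Longrightarrow> take n s \<in> T"
    and fin: "\<And>n. finite {s \<in> T. length s = n}" and ne: "\<And>n. \<exists>s\<in>T. length s = n"
  obtains \<alpha> :: "nat \<Rightarrow> nat" where "\<And>n. map \<alpha> [0..<n] \<in> T"
proof -
  define ext where "ext s \<longleftrightarrow> (\<forall>n\<ge>length s. \<exists>t\<in>T. length t = n \<and> take (length s) t = s)" for s :: "nat list"
  have step: "\<exists>m. ext (s @ [m])" if "ext s" for s
  proof (rule ccontr)
    assume "\<not> ?thesis"
    then have "\<forall>m. \<exists>n\<ge>Suc (length s). \<forall>t\<in>T. length t = n \<longrightarrow> take (Suc (length s)) t \<noteq> s @ [m]"
      by (auto simp: ext_def)
    then obtain N where N: "\<And>m. N m \<ge> Suc (length s)"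
      "\<And>m t. t \<in> T \<Longrightarrow> length t = N m \<Longrightarrow> take (Suc (length s)) t \<noteq> s @ [m]" by metis
    have "{m. s @ [m] \<in> T} = (\<lambda>m. s @ [m]) -` {t \<in> T. length t = Suc (length s)}" by auto
    then have fc: "finite {m. s @ [m] \<in> T}"
      using finite_vimageI[OF fin[of "Suc (length s)"], of "\<lambda>m. s @ [m]"] by (simp add: inj_def)
    define M where "M = Max (insert (Suc (length s)) (N ` {m. s @ [m] \<in> T}))"
    have M: "M \<ge> Suc (length s)" "\<And>m. s @ [m] \<in> T \<Longrightarrow> N m \<le> M"
      unfolding M_def using fc by auto
    obtain t where t: "t \<in> T" "length t = M" "take (length s) t = s"
      using \<open>ext s\<close> M(1) unfolding ext_def by (metis Suc_leD)
    define m where "m = t ! length s"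
    have tk: "take (Suc (length s)) t = s @ [m]"
      using t M(1) by (simp add: take_Suc_conv_app_nth m_def)
    then have "s @ [m] \<in> T" using pre[OF t(1)] by metis
    then have "N m \<le> M" using M(2) by blast
    moreover have "take (N m) t \<in> T" using pre t(1) by blast
    moreover have "take (Suc (length s)) (take (N m) t) = s @ [m]" using N(1)[of m] tk by (simp add: min_absorb1)
    ultimately show False using N(2)[of "take (N m) t" m] t(2) by simp
  qed
  have "ext []" using ne by (auto simp: ext_def)
  then obtain s where s: "s 0 = []" "\<And>n. ext (s n)" "\<And>n. \<exists>m. s (Suc n) = s n @ [m]"
    using dependent_nat_choice[of "\<lambda>n s. ext s \<and> (n = 0 \<longrightarrow> s = [])" "\<lambda>n s s'. \<exists>m. s' = s @ [m]"] step
    by (metis (no_types, lifting) Suc_neq_Zero)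
  then obtain \<alpha> where \<alpha>: "\<And>n. s (Suc n) = s n @ [\<alpha> n]" by metis
  have "s n = map \<alpha> [0..<n]" for n by (induction n) (auto simp: s(1) \<alpha>)
  moreover have "s n \<in> T" for n
  proof -
    obtain t where "t \<in> T" "length t = length (s n)" "take (length (s n)) t = s n"
      using s(2)[of n] unfolding ext_def by blast
    then show ?thesis by simp
  qed
  ultimately show thesis using that by metis
qed

text \<open>The image is a union over branches of intersections along the branch, a Souslin
  operation that need not be Borel. Borel enclosures \<open>C s\<close> are chosen so that no point
  lies in more than \<open>K\<close> of those of one level. Each point then spans a finitely
  branching tree, and Koenig's lemma lets union and intersection change places, which leaves only
  countable operations.\<close>

theorem bounded_to_one_image_coded:
  fixes f :: "'x \<Rightarrow> 'y" and l :: "'x \<Rightarrow> nat \<Rightarrow> nat"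
  assumes Y: "regular_space Y" "Hausdorff_space Y" "topspace Y = space N" "\<And>V. openin Y V \<Longrightarrow> V \<in> sets N"
    and fB: "f ` B \<subseteq> space N"
    and closed: "baire_closed B l"
    and cont: "\<And>x V. x \<in> B \<Longrightarrow> openin Y V \<Longrightarrow> f x \<in> V \<Longrightarrow> \<exists>n. f ` cyl B l n (l x) \<subseteq> V"
    and fib: "\<And>y. finite {x \<in> B. f x = y} \<and> card {x \<in> B. f x = y} \<le> K"
  shows "f ` B \<in> sets N"
proof -
  define Q where "Q s = f ` cyl B l (length s) (\<lambda>m. s ! m)" for s :: "nat list"
  define \<I> where "\<I> = {I :: nat list set. finite I \<and> card I = Suc K \<and> (\<exists>n. \<forall>s\<in>I. length s = n)}"
  have "countable {I :: nat list set. finite I}"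
    using countable_Collect_finite_subset[of "UNIV :: nat list set"] by simp
  then have cI: "countable {I \<in> \<I>. P I}" for P
    by (rule countable_subset[rotated]) (auto simp: \<I>_def)
  have "separated N I Q" if "I \<in> \<I>" for I
  proof -
    have I: "finite I" "card I = Suc K" using that unfolding \<I>_def by blast+
    have "\<exists>n. \<forall>s\<in>I. length s = n" using that unfolding \<I>_def by simp
    then obtain n where "\<forall>s\<in>I. length s = n" by (rule exE)
    then have n: "\<And>s. s \<in> I \<Longrightarrow> length s = n" by blast
    have "separated N I (\<lambda>s. f ` cyl B l n (\<lambda>m. s ! m))"
    proof (rule separated_cylinders[OF Y(2-4) fB closed cont fib])
      fix s t assume st: "s \<in> I" "t \<in> I" "s \<noteq> t"
      then show "\<not> agree n (\<lambda>m. s ! m) (\<lambda>m. t ! m)"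
        using n[OF st(1)] n[OF st(2)] by (auto simp: agree_def intro: nth_equalityI)
    qed (use I in auto)
    then show ?thesis using n by (auto simp: separated_def Q_def)
  qed
  then obtain BI where BI: "\<And>I s. I \<in> \<I> \<Longrightarrow> s \<in> I \<Longrightarrow> BI I s \<in> sets N"
    "\<And>I s. I \<in> \<I> \<Longrightarrow> s \<in> I \<Longrightarrow> Q s \<subseteq> BI I s" "\<And>I. I \<in> \<I> \<Longrightarrow> (\<Inter>s\<in>I. BI I s) = {}"
    unfolding separated_def by metis
  \<comment> \<open>The closure forces the sets to shrink to one value along a branch; the other
    factor collects the enclosures of \<open>Q s\<close> from all families of \<open>Suc K\<close>
    cylinders of one level that contain \<open>s\<close>.\<close>
  define C where "C s = Y closure_of Q s \<inter> (\<Inter>I\<in>{I \<in> \<I>. s \<in> I}. BI I s)" for s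
  have Qsp: "Q s \<subseteq> topspace Y" for s using fB Y(3) by (auto simp: Q_def cyl_def)
  have clo: "Y closure_of A \<in> sets N" for A
  proof -
    have "topspace Y - Y closure_of A \<in> sets N"
      by (intro Y(4)) (simp add: openin_diff)
    then have "space N - (topspace Y - Y closure_of A) \<in> sets N" by (rule sets.compl_sets)
    moreover have "space N - (topspace Y - Y closure_of A) = Y closure_of A"
      using closure_of_subset_topspace[of Y A] Y(3) by auto
    ultimately show ?thesis by simp
  qed
  have C_sets: "C s \<in> sets N" for s
  proof -
    have "C s = Y closure_of Q s \<inter> (\<Inter>I\<in>{I \<in> \<I>. s \<in> I}. BI I s \<inter> space N) \<inter> space N"
      unfolding C_def using closure_of_subset_topspace[of Y "Q s"] Y(3) by auto
    also have "\<dots> \<in> sets N"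
    proof (cases "{I \<in> \<I>. s \<in> I} = {}")
      case True
      show ?thesis unfolding True using clo by auto
    next
      case False
      then show ?thesis using clo BI(1) cI by (intro sets.Int sets.countable_INT') auto
    qed
    finally show ?thesis .
  qed
  have QC: "Q s \<subseteq> C s" for s
    unfolding C_def using closure_of_subset[OF Qsp] BI(2) by blast
  define T where "T y = {s. \<forall>n. y \<in> C (take n s)}" for y
  have eq: "f ` B = (\<Inter>n. \<Union>s\<in>{s. length s = n}. \<Inter>k\<in>{..n}. C (take k s))" (is "_ = ?R")
  proof
    show "f ` B \<subseteq> ?R"
    proof
      fix y assume "y \<in> f ` B"
      then obtain x where x: "x \<in> B" "y = f x" by blast
      have "y \<in> (\<Union>s\<in>{s. length s = n}. \<Inter>k\<in>{..n}. C (take k s))" for n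
      proof (intro UN_I INT_I)
        show "map (l x) [0..<n] \<in> {s. length s = n}" by simp
        fix k assume "k \<in> {..n}"
        then have "x \<in> cyl B l (length (take k (map (l x) [0..<n]))) (\<lambda>m. take k (map (l x) [0..<n]) ! m)"
          using x(1) by (auto simp: cyl_def agree_def)
        then have "y \<in> Q (take k (map (l x) [0..<n]))" unfolding Q_def x(2) by blast
        then show "y \<in> C (take k (map (l x) [0..<n]))" using QC by blast
      qed
      then show "y \<in> ?R" by blast
    qed
    show "?R \<subseteq> f ` B"
    proof
      fix y assume yR: "y \<in> ?R"
      have ne: "\<exists>s\<in>T y. length s = n" for n
      proof -
        obtain s where s: "length s = n" "\<And>k. k \<le> n \<Longrightarrow> y \<in> C (take k s)"
          using INT_D[OF yR UNIV_I, of n] by auto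
        have "y \<in> C (take k s)" for k
          using s(2)[of "min k n"] s(1) by (cases "k \<le> n") (auto simp: min_def)
        then show ?thesis using s(1) unfolding T_def by blast
      qed
      have small: "card A \<le> K" if A: "A \<subseteq> {s \<in> T y. length s = n}" "finite A" for A n
      proof (rule ccontr)
        assume "\<not> card A \<le> K"
        then obtain I where I: "I \<subseteq> A" "card I = Suc K" "finite I"
          using obtain_subset_with_card_n[of "Suc K" A] by (metis not_less_eq_eq)
        have "\<forall>s\<in>I. length s = n" using I(1) A(1) by blast
        then have "I \<in> \<I>" unfolding \<I>_def using I by blast
        moreover have "y \<in> BI I s" if "s \<in> I" for s
        proof -
          have "y \<in> C (take (length s) s)" using that I(1) A(1) unfolding T_def by blast
          then show ?thesis using \<open>I \<in> \<I>\<close> that unfolding C_def by auto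
        qed
        ultimately show False using BI(3)[of I] by blast
      qed
      have fin: "finite {s \<in> T y. length s = n}" for n
      proof (rule ccontr)
        assume "infinite {s \<in> T y. length s = n}"
        then obtain A where "finite A" "card A = Suc K" "A \<subseteq> {s \<in> T y. length s = n}"
          using infinite_arbitrarily_large by blast
        then show False using small[of A n] by simp
      qed
      have pre: "take n s \<in> T y" if "s \<in> T y" for n s
        using that unfolding T_def by (simp add: min_def)
      obtain \<alpha> where \<alpha>: "\<And>n. map \<alpha> [0..<n] \<in> T y" using koenig_lists[of "T y", OF pre fin ne] by blast
      have "Q (map \<alpha> [0..<n]) = f ` cyl B l n \<alpha>" for n
        unfolding Q_def by (simp, intro arg_cong[of _ _ "\<lambda>A. f ` A"] cyl_cong) (simp add: agree_def)
      moreover have "y \<in> C (map \<alpha> [0..<n])" for n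
      proof -
        have "y \<in> C (take n (map \<alpha> [0..<n]))" using \<alpha>[of n] unfolding T_def by blast
        then show ?thesis by simp
      qed
      ultimately have ycl: "y \<in> Y closure_of (f ` cyl B l n \<alpha>)" for n unfolding C_def by (metis IntD1)
      then have "\<exists>x\<in>B. agree n (l x) \<alpha>" for n
      proof -
        have "cyl B l n \<alpha> \<noteq> {}" using ycl[of n] by auto
        then show ?thesis by (auto simp: cyl_def)
      qed
      then obtain x where x: "x \<in> B" "l x = \<alpha>" using closed unfolding baire_closed_def by blast
      have "y = f x"
      proof (rule ccontr)
        assume "y \<noteq> f x"
        have ysp: "y \<in> topspace Y" using ycl[of 0] by (auto simp: in_closure_of)
        have "f x \<in> topspace Y" using x(1) fB Y(3) by auto
        then obtain V W where VW: "openin Y V" "openin Y W" "f x \<in> V" "y \<in> W" "disjnt V W"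
          using Y(2) ysp \<open>y \<noteq> f x\<close> unfolding Hausdorff_space_def by metis
        obtain n where "f ` cyl B l n \<alpha> \<subseteq> V" using cont[OF x(1) VW(1,3)] x(2) by auto
        moreover have "W \<inter> f ` cyl B l n \<alpha> \<noteq> {}"
          using ycl[of n] VW(2,4) unfolding in_closure_of by blast
        ultimately show False using VW(5) by (auto simp: disjnt_def)
      qed
      then show "y \<in> f ` B" using x(1) by blast
    qed
  qed
  have "(\<Inter>k\<in>{..n}. C (take k s)) \<in> sets N" for n s using C_sets by (intro sets.finite_INT) auto
  then show ?thesis unfolding eq
    by (intro sets.countable_INT) (auto intro!: sets.countable_UN')
qed

text \<open>A single code makes \<open>B\<close> closed and the preimages of all base sets of the
  target open, so \<open>f\<close> becomes a continuous map on a closed part of Baire space.\<close>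

theorem standard_borel_bounded_to_one_image:
  fixes f :: "'x \<Rightarrow> 'y"
  assumes M: "standard_borel M" and N: "standard_borel N" and f: "f \<in> M \<rightarrow>\<^sub>M N" and B: "B \<in> sets M"
    and fib: "\<And>y. y \<in> space N \<Longrightarrow> finite {x \<in> space M. f x = y} \<and> card {x \<in> space M. f x = y} \<le> K"
  shows "f ` B \<in> sets N"
proof -
  obtain X where X: "completely_metrizable_space X" "second_countable X" "topspace X = space M"
    "sets M = sigma_sets (topspace X) {U. openin X U}"
    using M unfolding standard_borel_def by blast
  obtain Y where Y: "completely_metrizable_space Y" "second_countable Y" "topspace Y = space N"
    "sets N = sigma_sets (topspace Y) {U. openin Y U}"
    using N unfolding standard_borel_def by blast
  have YH: "Hausdorff_space Y" "regular_space Y"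
    using Y(1) completely_metrizable_imp_metrizable_space metrizable_imp_Hausdorff_space
      metrizable_imp_regular_space by blast+
  have XH: "Hausdorff_space X"
    using X(1) completely_metrizable_imp_metrizable_space metrizable_imp_Hausdorff_space by blast
  have Yop: "V \<in> sets N" if "openin Y V" for V using that Y(4) by auto
  obtain U :: "nat \<Rightarrow> 'y set" where U: "\<And>i. openin Y (U i)"
    "\<And>V y. openin Y V \<Longrightarrow> y \<in> V \<Longrightarrow> \<exists>i. y \<in> U i \<and> U i \<subseteq> V"
    by (rule second_countable_base_sequence[OF Y(2)]) (rule that)
  define D where "D m = (case m of 0 \<Rightarrow> B | Suc i \<Rightarrow> f -` U i \<inter> space M)" for m
  have "D m \<in> sets M" for m
    unfolding D_def using B measurable_sets[OF f Yop[OF U(1)]] by (cases m) auto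
  then have "\<exists>l. polish_code X l \<and> code_open (topspace X) l (D m) \<and> code_open (topspace X) l (- D m)" for m
    using polish_code_borel[OF X(1,2)] X(4) by metis
  then obtain l where l: "\<And>m. polish_code X (l m)" "\<And>m. code_open (topspace X) (l m) (D m)"
    "\<And>m. code_open (topspace X) (l m) (- D m)" by metis
  obtain l' where l': "polish_code X l'"
    "\<And>m U. code_open (topspace X) (l m) U \<Longrightarrow> code_open (topspace X) l' U"
    by (rule polish_code_combine[OF l(1) XH]) (rule that)
  have BX: "B \<subseteq> topspace X" using sets.sets_into_space[OF B] X(3) by simp
  have Bop: "code_open (topspace X) l' (- B)" using l'(2)[OF l(3)[of 0]] by (simp add: D_def)
  have fop: "code_open (topspace X) l' (f -` U i \<inter> space M)" for i
    using l'(2)[OF l(2)[of "Suc i"]] by (simp add: D_def)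
  show ?thesis
  proof (rule bounded_to_one_image_coded[OF YH(2,1) Y(3) Yop])
    show "f ` B \<subseteq> space N" using measurable_space[OF f] BX X(3) by auto
    show "baire_closed B l'"
      unfolding baire_closed_def
    proof (intro allI impI)
      fix \<alpha> assume \<alpha>: "\<forall>n. \<exists>x\<in>B. agree n (l' x) \<alpha>"
      then have "\<exists>x\<in>topspace X. l' x = \<alpha>" using BX by (intro polish_codeD(1)[OF l'(1)]) blast
      then obtain x where x: "x \<in> topspace X" "l' x = \<alpha>" by blast
      have "x \<in> B"
      proof (rule ccontr)
        assume "x \<notin> B"
        then obtain n where "\<forall>y\<in>topspace X. agree n (l' y) (l' x) \<longrightarrow> y \<in> - B"
          using Bop x(1) unfolding code_open_def by blast
        then show False using \<alpha> BX x(2) by blast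
      qed
      then show "\<exists>x\<in>B. l' x = \<alpha>" using x by blast
    qed
    show "\<exists>n. f ` cyl B l' n (l' x) \<subseteq> V" if x: "x \<in> B" "openin Y V" "f x \<in> V" for x V
    proof -
      obtain i where i: "f x \<in> U i" "U i \<subseteq> V" using U(2)[OF x(2,3)] by blast
      then have "x \<in> topspace X \<inter> (f -` U i \<inter> space M)" using x(1) BX X(3) by auto
      then obtain n where "\<forall>y\<in>topspace X. agree n (l' y) (l' x) \<longrightarrow> y \<in> f -` U i \<inter> space M"
        using fop[of i] unfolding code_open_def by blast
      then have "f ` cyl B l' n (l' x) \<subseteq> V" using i(2) BX unfolding cyl_def by blast
      then show ?thesis by blast
    qed
    show "finite {x \<in> B. f x = y} \<and> card {x \<in> B. f x = y} \<le> K" for y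
    proof (cases "y \<in> space N")
      case True
      have "{x \<in> B. f x = y} \<subseteq> {x \<in> space M. f x = y}" using BX X(3) by auto
      then show ?thesis using fib[OF True] by (meson card_mono finite_subset le_trans)
    next
      case False
      then have "{x \<in> B. f x = y} = {}" using measurable_space[OF f] BX X(3) by auto
      then show ?thesis by (simp only: finite.emptyI card.empty) simp
    qed
  qed
qed

section \<open>Borel colourings\<close>

lemma standard_borelE:
  assumes "standard_borel M"
  obtains T B where "Hausdorff_space T" "topspace T = space M" "\<And>V. openin T V \<Longrightarrow> V \<in> sets M"
    "\<And>i::nat. openin T (B i)" "\<And>V x. openin T V \<Longrightarrow> x \<in> V \<Longrightarrow> \<exists>i. x \<in> B i \<and> B i \<subseteq> V"
proof -
  obtain T where T: "completely_metrizable_space T" "second_countable T" "topspace T = space M"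
    "sets M = sigma_sets (topspace T) {U. openin T U}"
    using assms unfolding standard_borel_def by blast
  obtain B where B: "\<And>i::nat. openin T (B i)" "\<And>V x. openin T V \<Longrightarrow> x \<in> V \<Longrightarrow> \<exists>i. x \<in> B i \<and> B i \<subseteq> V"
    by (rule second_countable_base_sequence[OF T(2)]) (rule that)
  have "Hausdorff_space T"
    using T(1) completely_metrizable_imp_metrizable_space metrizable_imp_Hausdorff_space by blast
  moreover have "V \<in> sets M" if "openin T V" for V using that T(4) by auto
  ultimately show thesis using that T(3) B by blast
qed

text \<open>Different values are separated by two disjoint base sets, and there are only countably
  many such pairs.\<close>

lemma standard_borel_eq_sets:
  assumes "standard_borel N" and f: "f \<in> M \<rightarrow>\<^sub>M N" and g: "g \<in> M \<rightarrow>\<^sub>M N"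
  shows "{x \<in> space M. f x = g x} \<in> sets M"
proof -
  obtain T B where T: "Hausdorff_space T" "topspace T = space N" "\<And>V. openin T V \<Longrightarrow> V \<in> sets N"
    and B: "\<And>i::nat. openin T (B i)" "\<And>V x. openin T V \<Longrightarrow> x \<in> V \<Longrightarrow> \<exists>i. x \<in> B i \<and> B i \<subseteq> V"
    using standard_borelE[OF assms(1)] by metis
  have eq: "{x \<in> space M. f x = g x} =
      space M - (\<Union>i. \<Union>j\<in>{j. B i \<inter> B j = {}}. (f -` B i \<inter> space M) \<inter> (g -` B j \<inter> space M))"
    (is "_ = space M - ?U")
  proof -
    have "f x \<noteq> g x \<longleftrightarrow> x \<in> ?U" if x: "x \<in> space M" for x
    proof
      assume ne: "f x \<noteq> g x"
      have "f x \<in> topspace T" "g x \<in> topspace T" using x measurable_space[OF f] measurable_space[OF g] T(2) by auto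
      then obtain V W where VW: "openin T V" "openin T W" "f x \<in> V" "g x \<in> W" "disjnt V W"
        using T(1) ne unfolding Hausdorff_space_def by metis
      obtain i where i: "f x \<in> B i" "B i \<subseteq> V" using B(2)[OF VW(1,3)] by blast
      obtain j where j: "g x \<in> B j" "B j \<subseteq> W" using B(2)[OF VW(2,4)] by blast
      have "B i \<inter> B j = {}" using i j VW(5) unfolding disjnt_def by blast
      then show "x \<in> ?U" using i j x by blast
    next
      assume "x \<in> ?U"
      then obtain i j where "B i \<inter> B j = {}" "f x \<in> B i" "g x \<in> B j" by blast
      then show "f x \<noteq> g x" by auto
    qed
    then show ?thesis by blast
  qed
  have "f -` B i \<inter> space M \<in> sets M" "g -` B i \<inter> space M \<in> sets M" for i
    using measurable_sets[OF f T(3)[OF B(1)]] measurable_sets[OF g T(3)[OF B(1)]] by auto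
  then have "?U \<in> sets M"
    by (intro sets.countable_UN sets.countable_UN' image_subsetI subsetI) auto
  then show ?thesis unfolding eq by auto
qed

text \<open>The sets \<open>P i\<close> are Borel and independent, and they cover the space because
  some \<open>U i\<close> separates a point from its finitely many neighbours. Running through them
  and adding whatever has no neighbour chosen so far is a greedy algorithm with countably many Borel
  steps.\<close>

lemma borel_maximal_independent:
  fixes Adj :: "'x \<Rightarrow> 'x \<Rightarrow> bool" and U :: "nat \<Rightarrow> 'x set"
  assumes U: "\<And>i. U i \<in> sets M" "\<And>x F. x \<in> space M \<Longrightarrow> finite F \<Longrightarrow> F \<subseteq> space M - {x} \<Longrightarrow> \<exists>i. x \<in> U i \<and> F \<inter> U i = {}"
    and sym: "\<And>x y. Adj x y \<Longrightarrow> Adj y x" and irr: "\<And>x. \<not> Adj x x"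
    and nb: "\<And>B. B \<in> sets M \<Longrightarrow> {x \<in> space M. \<exists>y\<in>B. Adj x y} \<in> sets M"
    and deg: "\<And>x. x \<in> space M \<Longrightarrow> finite {y \<in> space M. Adj x y}"
    and Y: "Y \<in> sets M"
  shows "\<exists>I\<in>sets M. I \<subseteq> Y \<and> (\<forall>x\<in>I. \<forall>y\<in>I. \<not> Adj x y) \<and> (\<forall>y\<in>Y - I. \<exists>x\<in>I. Adj y x)"
proof -
  define Nb where "Nb B = {x \<in> space M. \<exists>y\<in>B. Adj x y}" for B
  define P where "P i = U i - Nb (U i)" for i
  define I where "I = rec_nat {} (\<lambda>n J. J \<union> (P n \<inter> Y - Nb J))"
  have I0: "I 0 = {}" and IS: "I (Suc n) = I n \<union> (P n \<inter> Y - Nb (I n))" for n by (simp_all add: I_def)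
  have sp: "Y \<subseteq> space M" "\<And>i. U i \<subseteq> space M" using sets.sets_into_space Y U(1) by blast+
  have I_sets: "I n \<in> sets M" for n
    by (induction n) (use U(1) nb Y in \<open>auto simp: I0 IS P_def Nb_def\<close>)
  have P_ind: "\<not> Adj x y" if "x \<in> P i" "y \<in> P i" for x y i
    using that sp(2)[of i] by (auto simp: P_def Nb_def)
  have IY: "I n \<subseteq> Y" for n by (induction n) (auto simp: I0 IS)
  have ind: "\<forall>x\<in>I n. \<forall>y\<in>I n. \<not> Adj x y" for n
  proof (induction n)
    case (Suc n)
    show ?case
    proof (intro ballI notI)
      fix x y assume xy: "x \<in> I (Suc n)" "y \<in> I (Suc n)" "Adj x y"
      have "x \<in> space M" "y \<in> space M" using xy IY[of "Suc n"] sp(1) by auto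
      then have "\<not> (x \<in> I n \<and> y \<notin> Nb (I n) \<and> y \<notin> I n)" "\<not> (y \<in> I n \<and> x \<notin> Nb (I n) \<and> x \<notin> I n)"
        using xy(3) sym[OF xy(3)] by (auto simp: Nb_def)
      then show False using xy Suc P_ind by (auto simp: IS)
    qed
  qed (simp add: I0)
  have mono: "I m \<subseteq> I n" if "m \<le> n" for m n
    using that by (rule lift_Suc_mono_le[rotated]) (auto simp: IS)
  show ?thesis
  proof (rule bexI[of _ "\<Union>n. I n"], intro conjI ballI)
    show "(\<Union>n. I n) \<in> sets M" using I_sets by auto
    show "(\<Union>n. I n) \<subseteq> Y" using IY by blast
  next
    fix x y assume "x \<in> (\<Union>n. I n)" "y \<in> (\<Union>n. I n)"
    then obtain m n where "x \<in> I m" "y \<in> I n" by blast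
    then have "x \<in> I (max m n)" "y \<in> I (max m n)" using mono[of m "max m n"] mono[of n "max m n"] by auto
    then show "\<not> Adj x y" using ind by blast
  next
    fix y assume y: "y \<in> Y - (\<Union>n. I n)"
    then have ys: "y \<in> space M" using sp by blast
    obtain i where i: "y \<in> U i" "{z \<in> space M. Adj y z} \<inter> U i = {}"
      using U(2)[OF ys deg[OF ys]] irr by blast
    then have "y \<in> P i" using sp(2)[of i] by (auto simp: P_def Nb_def)
    moreover have "y \<notin> I (Suc i)" using y by blast
    ultimately have "y \<in> Nb (I i)" using y unfolding IS by blast
    then show "\<exists>x\<in>\<Union>n. I n. Adj y x" by (auto simp: Nb_def)
  qed
qed

text \<open>Maximal independent sets are peeled off in turn. A vertex surviving
  \<open>\<Delta> + 1\<close> rounds would have a neighbour in each of as many disjoint sets, more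
  than its degree allows.\<close>

lemma borel_bounded_degree_coloring:
  fixes Adj :: "'x \<Rightarrow> 'x \<Rightarrow> bool" and U :: "nat \<Rightarrow> 'x set"
  assumes U: "\<And>i. U i \<in> sets M" "\<And>x F. x \<in> space M \<Longrightarrow> finite F \<Longrightarrow> F \<subseteq> space M - {x} \<Longrightarrow> \<exists>i. x \<in> U i \<and> F \<inter> U i = {}"
    and sym: "\<And>x y. Adj x y \<Longrightarrow> Adj y x" and irr: "\<And>x. \<not> Adj x x"
    and nb: "\<And>B. B \<in> sets M \<Longrightarrow> {x \<in> space M. \<exists>y\<in>B. Adj x y} \<in> sets M"
    and deg: "\<And>x. x \<in> space M \<Longrightarrow> finite {y \<in> space M. Adj x y} \<and> card {y \<in> space M. Adj x y} \<le> \<Delta>"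
  shows "\<exists>c :: 'x \<Rightarrow> nat. (\<forall>x\<in>space M. c x \<le> \<Delta>) \<and> (\<forall>j. {x \<in> space M. c x = j} \<in> sets M) \<and>
    (\<forall>x\<in>space M. \<forall>y\<in>space M. Adj x y \<longrightarrow> c x \<noteq> c y)"
proof -
  have "\<forall>Y\<in>sets M. \<exists>I. I \<in> sets M \<and> I \<subseteq> Y \<and> (\<forall>x\<in>I. \<forall>y\<in>I. \<not> Adj x y) \<and> (\<forall>y\<in>Y - I. \<exists>x\<in>I. Adj y x)"
  proof
    fix Y assume Y: "Y \<in> sets M"
    have "\<exists>I\<in>sets M. I \<subseteq> Y \<and> (\<forall>x\<in>I. \<forall>y\<in>I. \<not> Adj x y) \<and> (\<forall>y\<in>Y - I. \<exists>x\<in>I. Adj y x)"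
      by (rule borel_maximal_independent[where U = U and Adj = Adj])
        (fact U sym irr nb deg[THEN conjunct1] Y)+
    then show "\<exists>I. I \<in> sets M \<and> I \<subseteq> Y \<and> (\<forall>x\<in>I. \<forall>y\<in>I. \<not> Adj x y) \<and> (\<forall>y\<in>Y - I. \<exists>x\<in>I. Adj y x)"
      unfolding Bex_def .
  qed
  then obtain mis where "\<forall>Y\<in>sets M. mis Y \<in> sets M \<and> mis Y \<subseteq> Y \<and>
      (\<forall>x\<in>mis Y. \<forall>y\<in>mis Y. \<not> Adj x y) \<and> (\<forall>y\<in>Y - mis Y. \<exists>x\<in>mis Y. Adj y x)"
    by (rule bchoice[THEN exE])
  then have mis: "\<And>Y. Y \<in> sets M \<Longrightarrow> mis Y \<in> sets M" "\<And>Y. Y \<in> sets M \<Longrightarrow> mis Y \<subseteq> Y"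
    "\<And>Y x y. Y \<in> sets M \<Longrightarrow> x \<in> mis Y \<Longrightarrow> y \<in> mis Y \<Longrightarrow> \<not> Adj x y"
    "\<And>Y y. Y \<in> sets M \<Longrightarrow> y \<in> Y - mis Y \<Longrightarrow> \<exists>x\<in>mis Y. Adj y x"
    by blast+
  define Y where "Y = rec_nat (space M) (\<lambda>n Z. Z - mis Z)"
  have Y0: "Y 0 = space M" and YS: "Y (Suc n) = Y n - mis (Y n)" for n by (simp_all add: Y_def)
  have Ys: "Y n \<in> sets M" for n by (induction n) (auto simp: Y0 YS mis(1))
  have Ymono: "Y n \<subseteq> Y m" if "m \<le> n" for m n
    using that by (induction rule: dec_induct) (auto simp: YS)
  have disj: "mis (Y m) \<inter> mis (Y n) = {}" if "m < n" for m n
    using Ymono[of "Suc m" n] that mis(2)[OF Ys[of n]] by (auto simp: YS)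
  have sp: "mis (Y n) \<subseteq> space M" for n using sets.sets_into_space[OF mis(1)[OF Ys]] .
  have "Y (Suc \<Delta>) = {}"
  proof (rule ccontr)
    assume "Y (Suc \<Delta>) \<noteq> {}"
    then obtain x where x: "x \<in> Y (Suc \<Delta>)" by blast
    then have xs: "x \<in> space M" using sets.sets_into_space[OF Ys] by blast
    have "\<exists>y\<in>mis (Y k). Adj x y" if "k \<le> \<Delta>" for k
      using mis(4)[OF Ys, of x k] Ymono[of "Suc k" "Suc \<Delta>"] x that by (auto simp: YS)
    then have "\<forall>k\<in>{..\<Delta>}. \<exists>y. y \<in> mis (Y k) \<and> Adj x y" by blast
    then obtain y where y: "\<forall>k\<in>{..\<Delta>}. y k \<in> mis (Y k) \<and> Adj x (y k)" by (rule bchoice[THEN exE])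
    have "inj_on y {..\<Delta>}"
    proof (rule inj_onI, rule ccontr)
      fix i j assume ij: "i \<in> {..\<Delta>}" "j \<in> {..\<Delta>}" "y i = y j" "i \<noteq> j"
      then have "y i \<in> mis (Y i) \<inter> mis (Y j)" using y by (metis IntI)
      then show False using ij(4) disj[of i j] disj[of j i] by (cases "i < j") auto
    qed
    then have "card (y ` {..\<Delta>}) = Suc \<Delta>" by (simp add: card_image)
    moreover have "card (y ` {..\<Delta>}) \<le> card {z \<in> space M. Adj x z}"
      using deg[OF xs] y sp by (intro card_mono) auto
    ultimately show False using deg[OF xs] by simp
  qed
  have ex: "\<exists>k\<le>\<Delta>. x \<in> mis (Y k)" if "x \<in> space M" for x
  proof (rule ccontr)
    assume *: "\<not> ?thesis"
    have "x \<in> Y k" if "k \<le> Suc \<Delta>" for k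
      using that by (induction k) (use * \<open>x \<in> space M\<close> in \<open>auto simp: Y0 YS\<close>)
    then show False using \<open>Y (Suc \<Delta>) = {}\<close> by blast
  qed
  define c where "c x = (LEAST k. x \<in> mis (Y k))" for x
  have c: "x \<in> mis (Y (c x))" if "x \<in> space M" for x
    unfolding c_def using ex[OF that] by (metis LeastI_ex)
  have c_eq: "c x = k" if "x \<in> mis (Y k)" for x k
    using c[of x] sp[of k] that disj[of "c x" k] disj[of k "c x"] by (metis IntI empty_iff linorder_neqE_nat subsetD)
  show ?thesis
  proof (intro exI[of _ c] conjI ballI allI impI)
    fix x assume "x \<in> space M" then show "c x \<le> \<Delta>" using ex c_eq by metis
  next
    fix j
    have "{x \<in> space M. c x = j} = mis (Y j)" using c c_eq sp[of j] by blast
    then show "{x \<in> space M. c x = j} \<in> sets M" using mis(1)[OF Ys] by simp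
  next
    fix x y assume "x \<in> space M" "y \<in> space M" "Adj x y"
    then show "c x \<noteq> c y" using c[of x] c[of y] mis(3)[OF Ys] by metis
  qed
qed

text \<open>In the graph joining \<open>f z\<close> to \<open>g z\<close> where these differ, the
  neighbours of a set are the \<open>f\<close>-image of its \<open>g\<close>-preimage and vice
  versa. Both images are Borel because the maps are bounded-to-one, and fibre sizes bound the degree
  by \<open>K + L\<close>.\<close>

lemma borel_coloring_of_two_maps:
  fixes f g :: "'x \<Rightarrow> 'x"
  assumes M: "standard_borel M" and f: "f \<in> M \<rightarrow>\<^sub>M M" and g: "g \<in> M \<rightarrow>\<^sub>M M"
    and ff: "\<And>y. y \<in> space M \<Longrightarrow> finite {x \<in> space M. f x = y} \<and> card {x \<in> space M. f x = y} \<le> K"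
    and fg: "\<And>y. y \<in> space M \<Longrightarrow> finite {x \<in> space M. g x = y} \<and> card {x \<in> space M. g x = y} \<le> L"
  shows "\<exists>(N::nat) c. (\<forall>x\<in>space M. c x < N) \<and> (\<forall>j. {x \<in> space M. c x = j} \<in> sets M) \<and>
    (\<forall>z\<in>space M. f z \<noteq> g z \<longrightarrow> c (f z) \<noteq> c (g z))"
proof -
  obtain T B where T: "Hausdorff_space T" "topspace T = space M" "\<And>V. openin T V \<Longrightarrow> V \<in> sets M"
    and B: "\<And>i::nat. openin T (B i)" "\<And>V x. openin T V \<Longrightarrow> x \<in> V \<Longrightarrow> \<exists>i. x \<in> B i \<and> B i \<subseteq> V"
    using standard_borelE[OF M] by metis
  define Adj where "Adj x y \<longleftrightarrow> x \<noteq> y \<and> (\<exists>z\<in>space M. x = f z \<and> y = g z \<or> x = g z \<and> y = f z)" for x y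
  define Z where "Z = {z \<in> space M. f z \<noteq> g z}"
  have "Z = space M - {z \<in> space M. f z = g z}" by (auto simp: Z_def)
  then have Z: "Z \<in> sets M" using standard_borel_eq_sets[OF M f g] by auto
  have fs: "f z \<in> space M" "g z \<in> space M" if "z \<in> space M" for z
    using measurable_space[OF f that] measurable_space[OF g that] .
  have "\<exists>c :: 'x \<Rightarrow> nat. (\<forall>x\<in>space M. c x \<le> K + L) \<and> (\<forall>j. {x \<in> space M. c x = j} \<in> sets M) \<and>
    (\<forall>x\<in>space M. \<forall>y\<in>space M. Adj x y \<longrightarrow> c x \<noteq> c y)"
  proof (rule borel_bounded_degree_coloring)
    show "B i \<in> sets M" for i using T(3) B(1) .
    show "\<exists>i. x \<in> B i \<and> F \<inter> B i = {}" if "x \<in> space M" "finite F" "F \<subseteq> space M - {x}" for x F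
    proof -
      have "closedin T F"
        using that T(1,2) by (intro closedin_Hausdorff_finite) auto
      then have "openin T (topspace T - F)" by blast
      then show ?thesis using B(2)[of "topspace T - F" x] that T(2) by blast
    qed
    show "Adj y x" if "Adj x y" for x y using that unfolding Adj_def by blast
    show "\<not> Adj x x" for x by (simp add: Adj_def)
    show "{x \<in> space M. \<exists>y\<in>A. Adj x y} \<in> sets M" if A: "A \<in> sets M" for A
    proof -
      have "{x \<in> space M. \<exists>y\<in>A. Adj x y} = f ` ((g -` A \<inter> space M) \<inter> Z) \<union> g ` ((f -` A \<inter> space M) \<inter> Z)"
      proof safe
        fix x y assume "y \<in> A" "Adj x y" "x \<notin> g ` ((f -` A \<inter> space M) \<inter> Z)"
        then show "x \<in> f ` ((g -` A \<inter> space M) \<inter> Z)" unfolding Adj_def Z_def by auto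
      next
        fix z assume z: "z \<in> space M" "z \<in> Z" "g z \<in> A"
        have "Adj (f z) (g z)"
          using z(1,2) unfolding Adj_def Z_def by (intro conjI bexI[of _ z]) auto
        then show "f z \<in> space M" "\<exists>y\<in>A. Adj (f z) y"
          using fs z(1,3) by blast+
      next
        fix z assume z: "z \<in> space M" "z \<in> Z" "f z \<in> A"
        have "Adj (g z) (f z)"
          using z(1,2) unfolding Adj_def Z_def by (intro conjI bexI[of _ z]) auto
        then show "g z \<in> space M" "\<exists>y\<in>A. Adj (g z) y"
          using fs z(1,3) by blast+
      qed
      also have "\<dots> \<in> sets M"
        using measurable_sets[OF f A] measurable_sets[OF g A] Z
        by (intro sets.Un standard_borel_bounded_to_one_image[OF M M f _ ff]
            standard_borel_bounded_to_one_image[OF M M g _ fg]) auto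
      finally show ?thesis .
    qed
    show "finite {y \<in> space M. Adj x y} \<and> card {y \<in> space M. Adj x y} \<le> K + L" if x: "x \<in> space M" for x
    proof -
      have sub: "{y \<in> space M. Adj x y} \<subseteq> g ` {z \<in> space M. f z = x} \<union> f ` {z \<in> space M. g z = x}"
        by (auto simp: Adj_def)
      have fin: "finite (g ` {z \<in> space M. f z = x} \<union> f ` {z \<in> space M. g z = x})"
        using ff[OF x] fg[OF x] by auto
      have "card (g ` {z \<in> space M. f z = x} \<union> f ` {z \<in> space M. g z = x}) \<le>
          card {z \<in> space M. f z = x} + card {z \<in> space M. g z = x}"
        using ff[OF x] fg[OF x] by (meson card_Un_le card_image_le add_mono le_trans)
      also have "\<dots> \<le> K + L" using ff[OF x] fg[OF x] by auto
      finally show ?thesis using sub fin card_mono[OF fin sub] finite_subset[OF sub fin] by simp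
    qed
  qed
  then obtain c where c: "\<forall>x\<in>space M. c x \<le> K + L" "\<forall>j. {x \<in> space M. c x = j} \<in> sets M"
    "\<forall>x\<in>space M. \<forall>y\<in>space M. Adj x y \<longrightarrow> c x \<noteq> (c y :: nat)" by blast
  have "\<forall>z\<in>space M. f z \<noteq> g z \<longrightarrow> c (f z) \<noteq> c (g z)"
    using c(3) fs unfolding Adj_def by blast
  then show ?thesis using c(1,2) by (intro exI[of _ "Suc (K + L)"] exI[of _ c]) auto
qed

lemma borel_coloring_of_maps:
  fixes f g :: "'i \<Rightarrow> 'x \<Rightarrow> 'x"
  assumes M: "standard_borel M" and "finite I"
    and f: "\<And>i. i \<in> I \<Longrightarrow> f i \<in> M \<rightarrow>\<^sub>M M" and g: "\<And>i. i \<in> I \<Longrightarrow> g i \<in> M \<rightarrow>\<^sub>M M"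
    and ff: "\<And>i. i \<in> I \<Longrightarrow> \<exists>K. \<forall>y\<in>space M. finite {x \<in> space M. f i x = y} \<and> card {x \<in> space M. f i x = y} \<le> K"
    and fg: "\<And>i. i \<in> I \<Longrightarrow> \<exists>K. \<forall>y\<in>space M. finite {x \<in> space M. g i x = y} \<and> card {x \<in> space M. g i x = y} \<le> K"
  shows "\<exists>(N::nat) c. (\<forall>x\<in>space M. c x < N) \<and> (\<forall>j. {x \<in> space M. c x = j} \<in> sets M) \<and>
    (\<forall>i\<in>I. \<forall>z\<in>space M. f i z \<noteq> g i z \<longrightarrow> c (f i z) \<noteq> c (g i z))"
  using assms(2) f g ff fg
proof (induction I)
  case empty
  show ?case by (intro exI[of _ 1] exI[of _ "\<lambda>_. 0"]) auto
next
  case (insert i I)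
  have "\<exists>(N::nat) c. (\<forall>x\<in>space M. c x < N) \<and> (\<forall>j. {x \<in> space M. c x = j} \<in> sets M) \<and>
    (\<forall>i\<in>I. \<forall>z\<in>space M. f i z \<noteq> g i z \<longrightarrow> c (f i z) \<noteq> c (g i z))"
    by (rule insert.IH) (rule insert.prems; simp)+
  then obtain N c where c: "\<And>x. x \<in> space M \<Longrightarrow> c x < (N::nat)" "\<And>j. {x \<in> space M. c x = j} \<in> sets M"
    "\<And>i z. i \<in> I \<Longrightarrow> z \<in> space M \<Longrightarrow> f i z \<noteq> g i z \<Longrightarrow> c (f i z) \<noteq> c (g i z)"
    by blast
  obtain K where K: "\<And>y. y \<in> space M \<Longrightarrow> finite {x \<in> space M. f i x = y} \<and> card {x \<in> space M. f i x = y} \<le> K"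
    using insert.prems(3)[of i] by blast
  obtain L where L: "\<And>y. y \<in> space M \<Longrightarrow> finite {x \<in> space M. g i x = y} \<and> card {x \<in> space M. g i x = y} \<le> L"
    using insert.prems(4)[of i] by blast
  have "f i \<in> M \<rightarrow>\<^sub>M M" "g i \<in> M \<rightarrow>\<^sub>M M" using insert.prems(1,2)[of i] by simp_all
  from borel_coloring_of_two_maps[OF M this K L]
  obtain N' c' where c': "\<And>x. x \<in> space M \<Longrightarrow> c' x < (N'::nat)" "\<And>j. {x \<in> space M. c' x = j} \<in> sets M"
    "\<And>z. z \<in> space M \<Longrightarrow> f i z \<noteq> g i z \<Longrightarrow> c' (f i z) \<noteq> c' (g i z)" by blast
  define d where "d x = c x * N' + c' x" for x
  have dm: "d x div N' = c x" "d x mod N' = c' x" if "x \<in> space M" for x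
    using c'(1)[OF that] by (auto simp: d_def)
  show ?case
  proof (intro exI[of _ "N * N'"] exI[of _ d] conjI ballI allI impI)
    fix x assume x: "x \<in> space M"
    have "d x < Suc (c x) * N'" using c'(1)[OF x] by (simp add: d_def)
    also have "\<dots> \<le> N * N'" using c(1)[OF x] by (intro mult_right_mono) auto
    finally show "d x < N * N'" .
  next
    fix j
    have "{x \<in> space M. d x = j} = {x \<in> space M. c x = j div N'} \<inter> {x \<in> space M. c' x = j mod N'}"
      using dm by (auto simp: d_def)
    then show "{x \<in> space M. d x = j} \<in> sets M" using c(2) c'(2) by auto
  next
    fix k z assume k: "k \<in> insert i I" and z: "z \<in> space M" "f k z \<noteq> g k z"
    have "f k z \<in> space M" "g k z \<in> space M"
      using measurable_space[OF insert.prems(1)[OF k] z(1)] measurable_space[OF insert.prems(2)[OF k] z(1)] .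
    then show "d (f k z) \<noteq> d (g k z)"
      using c(3)[of k z] c'(3)[of z] dm k z by (metis insertE)
  qed
qed

section \<open>Commuting maps and greedy markers\<close>

text \<open>There are finitely many patterns, each a Borel event, so \<open>P\<close> may be
  arbitrary. This is how choices made through \<open>SOME\<close> and \<open>Min\<close> will be
  seen to be Borel.\<close>

lemma sets_Collect_pattern:
  assumes "finite I" "\<And>p. p \<in> I \<Longrightarrow> D p \<in> sets M"
  shows "{z \<in> space M. P {p \<in> I. z \<in> D p}} \<in> sets M"
proof -
  have "{z \<in> space M. {p \<in> I. z \<in> D p} = A} \<in> sets M" if A: "A \<subseteq> I" for A
  proof -
    have "{z \<in> space M. {p \<in> I. z \<in> D p} = A} = {z \<in> space M. \<forall>p\<in>I. z \<in> (if p \<in> A then D p else space M - D p)}"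
      using A by auto
    also have "\<dots> \<in> sets M"
    proof (intro sets.sets_Collect_finite_All assms(1))
      fix p assume "p \<in> I"
      have "{z \<in> space M. z \<in> (if p \<in> A then D p else space M - D p)} = (if p \<in> A then D p else space M - D p)"
        using sets.sets_into_space[OF assms(2)[OF \<open>p \<in> I\<close>]] by auto
      then show "{z \<in> space M. z \<in> (if p \<in> A then D p else space M - D p)} \<in> sets M"
        using assms(2)[OF \<open>p \<in> I\<close>] by simp
    qed
    finally show ?thesis .
  qed
  then have "(\<Union>A\<in>{A \<in> Pow I. P A}. {z \<in> space M. {p \<in> I. z \<in> D p} = A}) \<in> sets M"
    using assms(1) by (intro sets.finite_UN) auto
  moreover have "{z \<in> space M. P {p \<in> I. z \<in> D p}} =
      (\<Union>A\<in>{A \<in> Pow I. P A}. {z \<in> space M. {p \<in> I. z \<in> D p} = A})" by auto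
  ultimately show ?thesis by simp
qed

text \<open>Vectors in \<open>\<int>\<^sup>S\<close> are functions vanishing outside \<open>S\<close>.\<close>

definition vecs :: "'i set \<Rightarrow> ('i \<Rightarrow> int) set" where
  "vecs S = {v. \<forall>i. i \<notin> S \<longrightarrow> v i = 0}"

definition vbox :: "'i set \<Rightarrow> int \<Rightarrow> ('i \<Rightarrow> int) set" where
  "vbox S r = {v \<in> vecs S. \<forall>i. \<bar>v i\<bar> \<le> r}"

definition nonneg :: "'i set \<Rightarrow> ('i \<Rightarrow> int) set" where
  "nonneg S = {v \<in> vecs S. \<forall>i. 0 \<le> v i}"

definition cst :: "'i set \<Rightarrow> int \<Rightarrow> 'i \<Rightarrow> int" where
  "cst S r = (\<lambda>i. if i \<in> S then r else 0)"

lemma finite_vbox: "finite S \<Longrightarrow> finite (vbox S r)"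
proof -
  assume S: "finite S"
  have "vbox S r \<subseteq> {v. \<forall>i. (i \<in> S \<longrightarrow> v i \<in> {-r..r}) \<and> (i \<notin> S \<longrightarrow> v i = 0)}"
  proof
    fix v assume v: "v \<in> vbox S r"
    have "v i \<in> {-r..r}" for i
    proof -
      have "\<bar>v i\<bar> \<le> r" using v unfolding vbox_def by blast
      then show ?thesis by (simp add: abs_le_iff)
    qed
    then show "v \<in> {v. \<forall>i. (i \<in> S \<longrightarrow> v i \<in> {-r..r}) \<and> (i \<notin> S \<longrightarrow> v i = 0)}"
      using v by (simp add: vbox_def vecs_def)
  qed
  then show ?thesis using finite_set_of_finite_funs[OF S, of "{-r..r}" 0] finite_subset by auto
qed

lemma cst_add: "cst S (a + b) = cst S a + cst S b"
  by (auto simp: cst_def fun_eq_iff)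

lemma vecs_closed:
  "v \<in> vecs S \<Longrightarrow> w \<in> vecs S \<Longrightarrow> v + w \<in> vecs S" "v \<in> vecs S \<Longrightarrow> w \<in> vecs S \<Longrightarrow> v - w \<in> vecs S"
  "v \<in> vecs S \<Longrightarrow> - v \<in> vecs S" "0 \<in> vecs S" "cst S r \<in> vecs S"
  by (auto simp: vecs_def cst_def)

lemma nonneg_add: "v \<in> nonneg S \<Longrightarrow> w \<in> nonneg S \<Longrightarrow> v + w \<in> nonneg S"
  by (auto simp: nonneg_def vecs_def)

lemma zero_nonneg [simp]: "0 \<in> nonneg S" by (auto simp: nonneg_def vecs_def)

lemma cst_nonneg: "0 \<le> r \<Longrightarrow> cst S r \<in> nonneg S"
  by (auto simp: nonneg_def vecs_def cst_def)

lemma vboxD: "v \<in> vbox S r \<Longrightarrow> \<bar>v i\<bar> \<le> r" "v \<in> vbox S r \<Longrightarrow> v \<in> vecs S"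
  by (auto simp: vbox_def)

lemma vbox_mono: "v \<in> vbox S r \<Longrightarrow> r \<le> t \<Longrightarrow> v \<in> vbox S t"
  unfolding vbox_def using order_trans by blast

lemma vbox_add: "v \<in> vbox S r \<Longrightarrow> w \<in> vbox S t \<Longrightarrow> v + w \<in> vbox S (r + t)"
  unfolding vbox_def by (auto simp: vecs_closed intro: order_trans[OF abs_triangle_ineq] add_mono)

lemma vbox_minus: "v \<in> vbox S r \<Longrightarrow> - v \<in> vbox S r"
  unfolding vbox_def by (auto simp: vecs_closed)

lemma cst_add_vbox_nonneg: "v \<in> vbox S r \<Longrightarrow> r \<le> t \<Longrightarrow> cst S t + v \<in> nonneg S"
proof -
  assume v: "v \<in> vbox S r" "r \<le> t"
  have "0 \<le> t + v i" for i using vboxD(1)[OF v(1), of i] v(2) by linarith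
  moreover have "v i = 0" if "i \<notin> S" for i using v(1) that by (auto simp: vbox_def vecs_def)
  ultimately show ?thesis by (auto simp: nonneg_def vecs_def cst_def)
qed

lemma cst_add_vbox_nonneg_vbox:
  "v \<in> vbox S r \<Longrightarrow> r \<le> t \<Longrightarrow> cst S t + v \<in> nonneg S \<inter> vbox S (t + r)"
proof -
  assume v: "v \<in> vbox S r" "r \<le> t"
  have "\<bar>v i\<bar> \<le> r" for i using vboxD(1)[OF v(1)] .
  then have "\<bar>(if i \<in> S then t else 0) + v i\<bar> \<le> t + r" for i
    using v(2) by (smt (verit, best))
  then show ?thesis using cst_add_vbox_nonneg[OF v] by (auto simp: vbox_def nonneg_def cst_def)
qed

lemma nonneg_vbox_diff:
  assumes "a \<in> nonneg S \<inter> vbox S r" "b \<in> nonneg S \<inter> vbox S r"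
  shows "a - b \<in> vbox S r"
proof -
  have "\<bar>a i - b i\<bar> \<le> r" for i
  proof -
    have "0 \<le> a i" "0 \<le> b i" "\<bar>a i\<bar> \<le> r" "\<bar>b i\<bar> \<le> r" using assms by (auto simp: nonneg_def vbox_def)
    then show ?thesis by linarith
  qed
  then show ?thesis using assms by (auto simp: vbox_def vecs_closed)
qed

section \<open>The greedy selection rule and its properties relative to one viewer\<close>

locale commuting_maps =
  fixes M :: "'x measure" and S :: "'i set" and T :: "('i \<Rightarrow> int) \<Rightarrow> 'x \<Rightarrow> 'x"
  assumes standard_borel: "standard_borel M"
    and finite_index: "finite S"
    and T_measurable: "v \<in> nonneg S \<Longrightarrow> T v \<in> M \<rightarrow>\<^sub>M M"
    and T_zero: "x \<in> space M \<Longrightarrow> T 0 x = x"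
    and T_add: "v \<in> nonneg S \<Longrightarrow> w \<in> nonneg S \<Longrightarrow> x \<in> space M \<Longrightarrow> T (v + w) x = T v (T w x)"
    and T_bounded_to_one: "v \<in> nonneg S \<Longrightarrow>
      \<exists>k. \<forall>y\<in>space M. finite {x \<in> space M. T v x = y} \<and> card {x \<in> space M. T v x = y} \<le> k"
begin

lemma T_space: "v \<in> nonneg S \<Longrightarrow> x \<in> space M \<Longrightarrow> T v x \<in> space M"
  using measurable_space[OF T_measurable] .

lemma T_eq_shift:
  assumes "T a x = T b y" "a \<in> nonneg S" "b \<in> nonneg S" "c \<in> nonneg S" "x \<in> space M" "y \<in> space M"
  shows "T (c + a) x = T (c + b) y"
  using assms by (simp add: T_add)

lemma T_vimage_sets: "v \<in> nonneg S \<Longrightarrow> A \<in> sets M \<Longrightarrow> {x \<in> space M. T v x \<in> A} \<in> sets M"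
  using measurable_sets[OF T_measurable, of v A] by (simp add: vimage_def Int_def conj_commute)

text \<open>By commutativity a path in the orbit graph folds into two forward moves that meet. This
  agrees with the path metric up to the factor \<open>2 * card S\<close>.\<close>

definition near :: "int \<Rightarrow> 'x \<Rightarrow> 'x \<Rightarrow> bool" where
  "near r x y \<longleftrightarrow> (\<exists>a\<in>nonneg S \<inter> vbox S r. \<exists>b\<in>nonneg S \<inter> vbox S r. T a x = T b y)"

text \<open>\<open>selected c R j u\<close> says that the point \<open>T (cst S (j * R)) u\<close> of colour \<open>j\<close> is chosen by the greedy
  algorithm run on the view of \<open>u\<close>; the extra shift by \<open>(j - i) * R\<close> makes room for
  the backward steps \<open>h\<close>. The choice depends on \<open>u\<close>, not only on the point.\<close>

fun selected :: "('x \<Rightarrow> nat) \<Rightarrow> int \<Rightarrow> nat \<Rightarrow> 'x \<Rightarrow> bool" where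
  "selected c R j u \<longleftrightarrow> c (T (cst S (int j * R)) u) = j \<and>
     (\<forall>i<j. \<forall>h\<in>vbox S R. \<not> selected c R i (T (cst S (int (j - i) * R) + h) u))"

declare selected.simps [simp del]

lemma selected_sets:
  assumes R: "0 \<le> R" and c: "\<And>j. {x \<in> space M. c x = j} \<in> sets M"
  shows "{u \<in> space M. selected c R j u} \<in> sets M"
proof (induction j rule: less_induct)
  case (less j)
  have eq: "{u \<in> space M. selected c R j u} =
    {u \<in> space M. T (cst S (int j * R)) u \<in> {x \<in> space M. c x = j}} \<inter>
    {u \<in> space M. \<forall>i\<in>{..<j}. \<forall>h\<in>vbox S R. T (cst S (int (j - i) * R) + h) u \<notin> {u \<in> space M. selected c R i u}}"
  proof -
    have "cst S (int j * R) \<in> nonneg S" using R by (intro cst_nonneg) simp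
    moreover have "cst S (int (j - i) * R) + h \<in> nonneg S" if "i < j" "h \<in> vbox S R" for i h
    proof (rule cst_add_vbox_nonneg[OF that(2)])
      have "1 * R \<le> int (j - i) * R" using that(1) R by (intro mult_right_mono) auto
      then show "R \<le> int (j - i) * R" by simp
    qed
    ultimately show ?thesis by (subst selected.simps) (auto simp: T_space)
  qed
  have "{u \<in> space M. T (cst S (int (j - i) * R) + h) u \<notin> {u \<in> space M. selected c R i u}} \<in> sets M"
    if "i < j" "h \<in> vbox S R" for i h
  proof -
    have "1 * R \<le> int (j - i) * R" using that(1) R by (intro mult_right_mono) auto
    then have "cst S (int (j - i) * R) + h \<in> nonneg S" using cst_add_vbox_nonneg[OF that(2)] by simp
    from T_vimage_sets[OF this less[OF that(1)]] show ?thesis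
      by (rule sets.sets_Collect_neg)
  qed
  moreover have "{u \<in> space M. T (cst S (int j * R)) u \<in> {x \<in> space M. c x = j}} \<in> sets M"
    using R by (intro T_vimage_sets c cst_nonneg) simp
  ultimately show ?case
    unfolding eq using finite_vbox[OF finite_index]
    by (intro sets.Int sets.sets_Collect_finite_All) auto
qed

text \<open>Both candidates are compared at the same total shift \<open>int N * R\<close>. The
  marker of label \<open>i\<close> seen at \<open>g\<close> is then one of the points tested by the
  rule for \<open>j\<close>, with \<open>h = g - g'\<close>, and its selection would have vetoed
  \<open>j\<close>.\<close>

lemma selected_independent:
  assumes z: "z \<in> space M" and R: "0 \<le> R" and g: "g \<in> nonneg S" "g' \<in> nonneg S" "g - g' \<in> vbox S R"
    and ij: "i < j" "j < N"
    and i: "selected c R i (T (cst S (int (N - i) * R)) (T g z))"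
    and j: "selected c R j (T (cst S (int (N - j) * R)) (T g' z))"
  shows False
proof -
  have le: "R \<le> int (j - i) * R"
    using mult_right_mono[of 1 "int (j - i)" R] ij R by simp
  have nn: "cst S (int (N - i) * R) \<in> nonneg S" "cst S (int (N - j) * R) \<in> nonneg S"
    "cst S (int (j - i) * R) + (g - g') \<in> nonneg S"
    using R cst_add_vbox_nonneg[OF g(3) le] by (auto intro: cst_nonneg)
  have "int (N - i) * R = int (j - i) * R + int (N - j) * R"
    using ij by (simp add: of_nat_diff algebra_simps)
  then have veq: "cst S (int (N - i) * R) + g = (cst S (int (j - i) * R) + (g - g')) + (cst S (int (N - j) * R) + g')"
    by (simp add: cst_add algebra_simps)
  have "T (cst S (int (N - i) * R)) (T g z) =
      T (cst S (int (j - i) * R) + (g - g')) (T (cst S (int (N - j) * R)) (T g' z))"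
    by (simp only: T_add[OF nn(1) g(1) z, symmetric] T_add[OF nn(2) g(2) z, symmetric]
        T_add[OF nn(3) nonneg_add[OF nn(2) g(2)] z, symmetric] veq)
  then show False using i j ij(1) g(3) by (subst (asm) (2) selected.simps) auto
qed

text \<open>The point at the end of the full shift has some colour \<open>j\<close>. Either the rule
  selects it, or the veto comes from a selected point of smaller colour at an offset
  \<open>h\<close> in the box; the extra \<open>cst S R\<close> keeps the vector of that witness
  nonnegative.\<close>

lemma selected_maximal:
  assumes x: "x \<in> space M" and R: "0 \<le> R" and c: "\<And>x. x \<in> space M \<Longrightarrow> c x < N"
  shows "\<exists>h\<in>vbox S R. \<exists>j<N. selected c R j (T (cst S (int (N - j) * R)) (T (cst S R + h) x))"
proof -
  define u where "u = T (cst S R) x"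
  define j where "j = c (T (cst S (int N * R)) u)"
  have cR: "cst S R \<in> nonneg S" "\<And>k. cst S (int k * R) \<in> nonneg S" using R by (auto intro: cst_nonneg)
  have u: "u \<in> space M" unfolding u_def using T_space cR x by blast
  have j: "j < N" unfolding j_def using c T_space cR u by blast
  have z0: "0 \<in> vbox S R" using R by (auto simp: vbox_def vecs_def)
  show ?thesis
  proof (cases "selected c R j (T (cst S (int (N - j) * R)) u)")
    case True
    then show ?thesis using j z0 by (intro bexI[of _ 0]) (auto simp: u_def)
  next
    case False
    have "int N * R = int j * R + int (N - j) * R" using j by (simp add: of_nat_diff algebra_simps)
    then have eqT: "T (cst S (int N * R)) u = T (cst S (int j * R)) (T (cst S (int (N - j) * R)) u)"
      using T_add[OF cR(2) cR(2) u, of j "N - j"] by (simp add: cst_add)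
    have "c (T (cst S (int j * R)) (T (cst S (int (N - j) * R)) u)) = j"
      by (simp only: eqT[symmetric] j_def[symmetric])
    then obtain i h where ih: "i < j" "h \<in> vbox S R"
      "selected c R i (T (cst S (int (j - i) * R) + h) (T (cst S (int (N - j) * R)) u))"
      using False unfolding selected.simps[of c R j] by blast
    have le: "R \<le> int (j - i) * R"
      using mult_right_mono[of 1 "int (j - i)" R] ih R by simp
    have nn: "cst S (int (j - i) * R) + h \<in> nonneg S" "cst S R + h \<in> nonneg S"
      using cst_add_vbox_nonneg[OF ih(2) le] cst_add_vbox_nonneg[OF ih(2)] by auto
    have "int (N - i) * R = int (j - i) * R + int (N - j) * R"
      using ih j by (simp add: of_nat_diff algebra_simps)
    then have veq: "(cst S (int (j - i) * R) + h) + (cst S (int (N - j) * R) + cst S R) =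
        cst S (int (N - i) * R) + (cst S R + h)"
      by (simp add: cst_add algebra_simps)
    have "T (cst S (int (j - i) * R) + h) (T (cst S (int (N - j) * R)) u) =
        T (cst S (int (N - i) * R)) (T (cst S R + h) x)"
      unfolding u_def
      by (simp only: T_add[OF nn(1) nonneg_add[OF cR(2) cR(1)] x, symmetric] T_add[OF cR(2) cR(1) x, symmetric]
        T_add[OF cR(2) nn(2) x, symmetric] veq)
    then show ?thesis using ih j by (intro bexI[of _ h] exI[of _ i]) auto
  qed
qed

end

text \<open>Intervals of length \<open>R + 1\<close> numbered -2 to 1 cover [-2R, 2R], which is
  where the 4 comes from; vectors in the same cell differ by at most \<open>R\<close> in each
  coordinate.\<close>

lemma cells_bound:
  assumes finite_index: "finite S" and R: "0 \<le> R" and fin: "finite J"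
    and g: "\<And>j. j \<in> J \<Longrightarrow> g j \<in> vbox S (2 * R)"
    and sep: "\<And>i j. i \<in> J \<Longrightarrow> j \<in> J \<Longrightarrow> g i - g j \<in> vbox S R \<Longrightarrow> i = j"
  shows "card J \<le> 4 ^ card S"
proof -
  define cell where "cell j = restrict (\<lambda>s. g j s div (R + 1)) S" for j
  have sub: "cell ` J \<subseteq> PiE S (\<lambda>_. {-2..1})"
  proof (rule image_subsetI, rule PiE_I)
    fix j s assume j: "j \<in> J" "s \<in> S"
    have "\<bar>g j s\<bar> \<le> 2 * R" using vboxD(1)[OF g[OF j(1)]] .
    then have b: "- 2 * (R + 1) \<le> g j s" "g j s < 2 * (R + 1)" using R by auto
    have "(- 2 * (R + 1)) div (R + 1) \<le> g j s div (R + 1)" using R by (intro zdiv_mono1[OF b(1)]) simp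
    moreover have "(- 2 * (R + 1)) div (R + 1) = - 2" using R by (intro nonzero_mult_div_cancel_right) simp
    ultimately have "- 2 \<le> g j s div (R + 1)" by simp
    moreover have "g j s div (R + 1) < 2"
    proof (rule ccontr)
      assume "\<not> ?thesis"
      then have "2 * (R + 1) \<le> (g j s div (R + 1)) * (R + 1)" using R by (intro mult_right_mono) auto
      also have "\<dots> \<le> g j s"
        using R minus_mod_eq_div_mult[of "g j s" "R + 1", symmetric] pos_mod_sign[of "R + 1" "g j s"] by linarith
      finally show False using b(2) by simp
    qed
    ultimately have "- 2 \<le> g j s div (R + 1)" "g j s div (R + 1) < 2" by auto
    then show "cell j s \<in> {-2..1}" using j(2) by (simp add: cell_def)
  qed (simp add: cell_def)
  have "inj_on cell J"
  proof (rule inj_onI)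
    fix i j assume ij: "i \<in> J" "j \<in> J" "cell i = cell j"
    have "\<bar>(g i - g j) s\<bar> \<le> R" for s
    proof (cases "s \<in> S")
      case True
      then have "g i s div (R + 1) = g j s div (R + 1)" using fun_cong[OF ij(3), of s] by (simp add: cell_def)
      moreover have "g i s = (R + 1) * (g i s div (R + 1)) + g i s mod (R + 1)"
        "g j s = (R + 1) * (g j s div (R + 1)) + g j s mod (R + 1)" by simp_all
      moreover have "0 \<le> g i s mod (R + 1)" "g i s mod (R + 1) < R + 1" "0 \<le> g j s mod (R + 1)" "g j s mod (R + 1) < R + 1"
        using R pos_mod_bound[of "R + 1" "g i s"] pos_mod_bound[of "R + 1" "g j s"] by simp_all
      ultimately have "\<bar>g i s - g j s\<bar> \<le> R" by (smt (verit))
      then show ?thesis by simp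
    next
      case False
      then show ?thesis using g[OF ij(1)] g[OF ij(2)] R by (simp add: vbox_def vecs_def)
    qed
    moreover have "g i - g j \<in> vecs S" using g ij by (auto simp: vbox_def vecs_closed)
    ultimately show "i = j" using sep[OF ij(1,2)] by (auto simp: vbox_def)
  qed
  then have "card J = card (cell ` J)" by (simp add: card_image)
  also have "\<dots> \<le> card (PiE S (\<lambda>_. {-2..1::int}))"
    using sub finite_index by (intro card_mono finite_PiE) auto
  also have "\<dots> = 4 ^ card S" using finite_index by (simp add: card_PiE)
  finally show ?thesis .
qed

text \<open>If all \<open>C\<close> inclusions were strict, the cardinality would climb from at
  least 1 to at least \<open>C + 1\<close>.\<close>

lemma stationary_step:
  fixes J :: "nat \<Rightarrow> 'a set"
  assumes "\<And>i. i < C \<Longrightarrow> J i \<subseteq> J (Suc i)" "finite (J C)" "J 0 \<noteq> {}" "card (J C) \<le> C"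
  shows "\<exists>i<C. J i = J (Suc i)"
proof (rule ccontr)
  assume *: "\<not> ?thesis"
  have mono: "J i \<subseteq> J C" if "i \<le> C" for i
    using that
  proof (induction i rule: inc_induct)
    case (step n)
    then show ?case using assms(1)[of n] by blast
  qed simp
  have fin: "finite (J i)" if "i \<le> C" for i using mono[OF that] assms(2) finite_subset by blast
  have "i \<le> C \<Longrightarrow> Suc i \<le> card (J i)" for i
  proof (induction i)
    case 0
    then show ?case using assms(3) fin[of 0] by (simp add: Suc_le_eq card_gt_0_iff)
  next
    case (Suc i)
    have "J i \<subset> J (Suc i)" using assms(1)[of i] * Suc.prems by auto
    then have "card (J i) < card (J (Suc i))" using fin[OF Suc.prems] by (rule psubset_card_mono[rotated])
    then show ?case using Suc by simp
  qed
  from this[of C] show False using assms(4) by simp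
qed

section \<open>Borel pieces on which nearby points share a forward image\<close>

context commuting_maps
begin

lemma near_sym: "near r x y \<Longrightarrow> near r y x"
  unfolding near_def by metis

lemma borel_coloring_window:
  "\<exists>(N::nat) c. (\<forall>x\<in>space M. c x < N) \<and> (\<forall>j. {x \<in> space M. c x = j} \<in> sets M) \<and>
    (\<forall>a\<in>nonneg S \<inter> vbox S W. \<forall>b\<in>nonneg S \<inter> vbox S W. \<forall>z\<in>space M. T a z \<noteq> T b z \<longrightarrow> c (T a z) \<noteq> c (T b z))"
proof -
  let ?W = "nonneg S \<inter> vbox S W"
  have "\<exists>(N::nat) c. (\<forall>x\<in>space M. c x < N) \<and> (\<forall>j. {x \<in> space M. c x = j} \<in> sets M) \<and>
      (\<forall>p\<in>?W \<times> ?W. \<forall>z\<in>space M. T (fst p) z \<noteq> T (snd p) z \<longrightarrow> c (T (fst p) z) \<noteq> c (T (snd p) z))"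
    by (rule borel_coloring_of_maps[OF standard_borel])
      (use finite_vbox[OF finite_index] T_measurable T_bounded_to_one in auto)
  then show ?thesis by auto
qed

text \<open>\<open>J r z\<close> is the set of labels of the markers that \<open>z\<close> sees within distance \<open>r\<close>. It grows with \<open>r\<close> and
  has at most \<open>4 ^ card S\<close> elements, so it is stationary at one of the radii \<open>t i\<close>.\<close>

theorem finitely_many_bounded_pieces:
  assumes rho: "0 \<le> \<rho>"
  shows "\<exists>V h Q. 0 \<le> Q \<and> (\<forall>i<(4::nat) ^ card S. V i \<in> sets M) \<and> space M \<subseteq> (\<Union>i<4 ^ card S. V i) \<and>
    (\<forall>i<4 ^ card S. \<forall>z\<in>space M. h i z \<in> nonneg S \<inter> vbox S Q) \<and>
    (\<forall>i<4 ^ card S. \<forall>v. {z \<in> space M. h i z = v} \<in> sets M) \<and>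
    (\<forall>i<4 ^ card S. \<forall>z\<in>V i. \<forall>z'\<in>V i. near \<rho> z z' \<longrightarrow> T (h i z) z = T (h i z') z')"
proof -
  define C :: nat where "C = 4 ^ card S"
  \<comment> \<open>With this value the radii \<open>t i\<close> climb in \<open>C\<close> steps of
    length \<rho> from \<open>R\<close> to \<open>2 * R\<close>.\<close>
  define R where "R = int C * \<rho>"
  have R: "0 \<le> R" using rho by (simp add: R_def)
  \<comment> \<open>The vectors \<open>B + g\<close> with \<open>g\<close> of size at most
    \<open>2 * R\<close> have entries between 0 and \<open>4 * R\<close>; in this window colours
    have to distinguish points.\<close>
  obtain N :: nat and c where c: "\<And>x. x \<in> space M \<Longrightarrow> c x < N" "\<And>j. {x \<in> space M. c x = j} \<in> sets M"
    "\<And>a b z. a \<in> nonneg S \<inter> vbox S (4 * R) \<Longrightarrow> b \<in> nonneg S \<inter> vbox S (4 * R) \<Longrightarrow> z \<in> space M \<Longrightarrow>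
       T a z \<noteq> T b z \<Longrightarrow> c (T a z) \<noteq> c (T b z)"
    using borel_coloring_window[of "4 * R"] by blast
  define A where "A j = {u \<in> space M. selected c R j (T (cst S (int (N - j) * R)) u)}" for j
  define B where "B = cst S (2 * R)"
  define t where "t i = R + int i * \<rho>" for i
  have t: "0 \<le> t i" "R \<le> t i" "t (Suc i) = t i + \<rho>" for i using R rho by (auto simp: t_def algebra_simps)
  have t0: "t 0 = R" and tC: "t C = 2 * R" by (auto simp: t_def R_def)
  have tle: "t i \<le> 2 * R" if "i \<le> C" for i
  proof -
    have "int i * \<rho> \<le> int C * \<rho>" using that rho by (intro mult_right_mono) auto
    then show ?thesis unfolding t_def R_def by linarith
  qed
  have cR: "cst S (int k * R) \<in> nonneg S" for k :: nat using R by (intro cst_nonneg) simp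
  have A_sets: "A j \<in> sets M" for j
  proof -
    have "A j = {u \<in> space M. T (cst S (int (N - j) * R)) u \<in> {u \<in> space M. selected c R j u}}"
      using T_space[OF cR] by (auto simp: A_def)
    then show ?thesis using T_vimage_sets[OF cR selected_sets[OF R c(2)]] by simp
  qed
  have Bnn: "B + g \<in> nonneg S" if "g \<in> vbox S (2 * R)" for g
    unfolding B_def using cst_add_vbox_nonneg[OF that] by simp
  have Bbox: "B + g \<in> nonneg S \<inter> vbox S (4 * R)" if "g \<in> vbox S (2 * R)" for g
    unfolding B_def using cst_add_vbox_nonneg_vbox[OF that, of "2 * R"] by simp
  have A_label: "c (T (cst S (int N * R) + g) z) = j" if "T g z \<in> A j" "j < N" "g \<in> nonneg S" "z \<in> space M" for g z j
  proof -
    have "int N * R = int j * R + int (N - j) * R" using that(2) by (simp add: of_nat_diff algebra_simps)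
    then have veq: "cst S (int N * R) + g = cst S (int j * R) + (cst S (int (N - j) * R) + g)"
      by (simp add: cst_add algebra_simps)
    have "T (cst S (int N * R) + g) z = T (cst S (int j * R)) (T (cst S (int (N - j) * R)) (T g z))"
      by (simp only: T_add[OF cR that(3,4), symmetric] T_add[OF cR nonneg_add[OF cR that(3)] that(4), symmetric] veq)
    moreover have "selected c R j (T (cst S (int (N - j) * R)) (T g z))" using that(1) by (simp add: A_def)
    ultimately show ?thesis by (subst (asm) selected.simps) simp
  qed
  have A_sep: "i = j" if "z \<in> space M" "g \<in> nonneg S" "g' \<in> nonneg S" "g - g' \<in> vbox S R" "i < N" "j < N"
    "T g z \<in> A i" "T g' z \<in> A j" for z g g' i j
  proof -
    have "g' - g \<in> vbox S R" using vbox_minus[OF that(4)] by simp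
    moreover have "selected c R i (T (cst S (int (N - i) * R)) (T g z))" "selected c R j (T (cst S (int (N - j) * R)) (T g' z))"
      using that by (auto simp: A_def)
    ultimately show ?thesis
      using selected_independent[OF that(1) R that(2,3,4), of i j N c] selected_independent[OF that(1) R that(3,2), of j i N c] that(5,6)
      by (cases i j rule: linorder_cases) auto
  qed
  define J where "J r z = {j. j < N \<and> (\<exists>g\<in>vbox S r. T (B + g) z \<in> A j)}" for r z
  have J_fin: "finite (J r z)" for r z by (rule finite_subset[of _ "{..<N}"]) (auto simp: J_def)
  have J_mono: "J r z \<subseteq> J r' z" if "r \<le> r'" for r r' z using vbox_mono[OF _ that] by (auto simp: J_def)
  have J_ne: "J (t 0) z \<noteq> {}" if z: "z \<in> space M" for z
  proof -
    have cR1: "cst S R \<in> nonneg S" using cst_nonneg[OF R] .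
    obtain h j where h: "h \<in> vbox S R" "j < N" "selected c R j (T (cst S (int (N - j) * R)) (T (cst S R + h) (T (cst S R) z)))"
      using selected_maximal[where c = c and N = N, OF T_space[OF cR1 z] R c(1)] by blast
    have nn: "cst S R + h \<in> nonneg S" using cst_add_vbox_nonneg[OF h(1)] by simp
    have "cst S R + h + cst S R = B + h" using cst_add[of S R R] by (simp add: B_def algebra_simps)
    then have "T (cst S R + h) (T (cst S R) z) = T (B + h) z"
      using T_add[OF nn cR1 z] by simp
    then have "T (B + h) z \<in> A j" using h(3) T_space[OF nn T_space[OF cR1 z]] by (auto simp: A_def)
    then have "j \<in> J (t 0) z" using h(1,2) unfolding J_def t0 by blast
    then show ?thesis by blast
  qed
  have J_card: "card (J r z) \<le> C" if z: "z \<in> space M" and r: "r \<le> 2 * R" for r z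
  proof -
    have "\<forall>j\<in>J r z. \<exists>g. g \<in> vbox S r \<and> T (B + g) z \<in> A j" by (auto simp: J_def)
    then obtain g where g: "\<forall>j\<in>J r z. g j \<in> vbox S r \<and> T (B + g j) z \<in> A j" by (rule bchoice[THEN exE])
    have g2: "g j \<in> vbox S (2 * R)" if "j \<in> J r z" for j using g that vbox_mono[OF _ r] by blast
    show ?thesis
      unfolding C_def
    proof (rule cells_bound[OF finite_index R J_fin g2])
      fix i j assume ij: "i \<in> J r z" "j \<in> J r z" "g i - g j \<in> vbox S R"
      then have "(B + g i) - (B + g j) \<in> vbox S R" by simp
      then show "i = j"
        using A_sep[OF z Bnn[OF g2[OF ij(1)]] Bnn[OF g2[OF ij(2)]], of i j] ij(1,2) g by (auto simp: J_def)
    qed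
  qed
  define V where "V i = {z \<in> space M. J (t i) z = J (t (Suc i)) z}" for i
  define pick where "pick i z = (SOME g. g \<in> vbox S (t i) \<and> T (B + g) z \<in> A (Min (J (t i) z)))" for i z
  \<comment> \<open>The extra shift by \<open>int N * R\<close> carries a marker to the point whose
    colour equals its label; only there can equal labels be turned into equal points.\<close>
  define h where "h i z = cst S (int N * R) + (B + pick i z)" for i z
  have pick: "pick i z \<in> vbox S (t i)" "T (B + pick i z) z \<in> A (Min (J (t i) z))" "Min (J (t i) z) < N"
    if "z \<in> space M" for i z
  proof -
    have "J (t i) z \<noteq> {}" using J_ne[OF that] J_mono[of "t 0" "t i" z] t by (auto simp: t0)
    then have *: "Min (J (t i) z) \<in> J (t i) z" using J_fin by (rule Min_in[rotated])
    then have "\<exists>g. g \<in> vbox S (t i) \<and> T (B + g) z \<in> A (Min (J (t i) z))" unfolding J_def by blast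
    from someI_ex[OF this] show "pick i z \<in> vbox S (t i)" "T (B + pick i z) z \<in> A (Min (J (t i) z))"
      unfolding pick_def by blast+
    show "Min (J (t i) z) < N" using * unfolding J_def by blast
  qed
  \<comment> \<open>\<open>V\<close> and \<open>h\<close> depend on \<open>z\<close> only through
    which labels it sees at which offsets. This finite pattern gives their measurability.\<close>
  define I where "I = {..<N} \<times> vbox S (2 * R)"
  define D where "D p = {z \<in> space M. T (B + snd p) z \<in> A (fst p)}" for p
  define pat where "pat z = {p \<in> I. z \<in> D p}" for z
  have I_fin: "finite I" unfolding I_def using finite_vbox[OF finite_index] by blast
  have D_sets: "D p \<in> sets M" if "p \<in> I" for p
    unfolding D_def using that by (intro T_vimage_sets A_sets Bnn) (auto simp: I_def)
  have pat_iff: "T (B + g) z \<in> A j \<longleftrightarrow> (j, g) \<in> pat z" if "z \<in> space M" "j < N" "g \<in> vbox S (2 * R)" for z j g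
    using that by (auto simp: pat_def D_def I_def)
  have J_pat: "J r z = J r z'" if "z \<in> space M" "z' \<in> space M" "pat z = pat z'" "r \<le> 2 * R" for r z z'
    using that pat_iff vbox_mono[OF _ that(4)] unfolding J_def by blast
  have pat_meas: "{z \<in> space M. F z = v} \<in> sets M"
    if "\<And>z z'. z \<in> space M \<Longrightarrow> z' \<in> space M \<Longrightarrow> pat z = pat z' \<Longrightarrow> F z = F z'" for F :: "'x \<Rightarrow> 'b" and v
  proof -
    have "{z \<in> space M. F z = v} = {z \<in> space M. \<exists>z'\<in>space M. pat z = pat z' \<and> F z' = v}" using that by blast
    also have "\<dots> \<in> sets M"
      using sets_Collect_pattern[where P = "\<lambda>A. \<exists>z'\<in>space M. A = pat z' \<and> F z' = v", OF I_fin D_sets]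
      unfolding pat_def .
    finally show ?thesis .
  qed
  have V_sets: "V i \<in> sets M" if "i < C" for i
  proof -
    have "{z \<in> space M. (J (t i) z = J (t (Suc i)) z) = True} \<in> sets M"
    proof (rule pat_meas)
      fix z z' assume "z \<in> space M" "z' \<in> space M" "pat z = pat z'"
      then show "(J (t i) z = J (t (Suc i)) z) = (J (t i) z' = J (t (Suc i)) z')"
        using J_pat[of z z' "t i"] J_pat[of z z' "t (Suc i)"] tle[of i] tle[of "Suc i"] that by simp
    qed
    then show ?thesis by (simp add: V_def)
  qed
  have h_sets: "{z \<in> space M. h i z = v} \<in> sets M" if "i < C" for i v
  proof (rule pat_meas)
    fix z z' assume z: "z \<in> space M" "z' \<in> space M" "pat z = pat z'"
    have Jeq: "J (t i) z = J (t i) z'" using J_pat[OF z] tle[of i] that by simp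
    have "(g \<in> vbox S (t i) \<and> T (B + g) z \<in> A (Min (J (t i) z))) \<longleftrightarrow>
        (g \<in> vbox S (t i) \<and> T (B + g) z' \<in> A (Min (J (t i) z')))" for g
      using pat_iff[OF z(1) pick(3)[OF z(1)], of g i] pat_iff[OF z(2) pick(3)[OF z(2)], of g i]
        z(3) Jeq vbox_mono[of g S "t i" "2 * R"] tle[of i] that by auto
    then have "pick i z = pick i z'" unfolding pick_def by presburger
    then show "h i z = h i z'" by (simp add: h_def)
  qed
  have h_box: "h i z \<in> nonneg S \<inter> vbox S (int N * R + 4 * R)" if "i < C" "z \<in> space M" for i z
  proof -
    have "pick i z \<in> vbox S (2 * R)" using pick(1)[OF that(2)] vbox_mono tle[of i] that(1) by (metis less_imp_le)
    then have "B + pick i z \<in> nonneg S \<inter> vbox S (4 * R)" by (rule Bbox)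
    moreover have "cst S (int N * R) \<in> vbox S (int N * R)" using R by (auto simp: vbox_def vecs_def cst_def)
    ultimately show ?thesis unfolding h_def using cR by (auto intro: nonneg_add vbox_add)
  qed
  have cover: "space M \<subseteq> (\<Union>i<C. V i)"
  proof
    fix z assume z: "z \<in> space M"
    have "\<exists>i<C. J (t i) z = J (t (Suc i)) z"
    proof (rule stationary_step)
      show "J (t i) z \<subseteq> J (t (Suc i)) z" for i using rho by (intro J_mono) (simp add: t)
    qed (use J_fin J_ne[OF z] J_card[OF z] in \<open>auto simp: tC\<close>)
    then show "z \<in> (\<Union>i<C. V i)" using z by (auto simp: V_def)
  qed
  \<comment> \<open>A view from \<open>z'\<close> becomes a view from \<open>z\<close> after
    translation by \<open>a - b\<close>, at the cost of \<rho> in the radius; on \<open>V i\<close>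
    this enlargement adds no label.\<close>
  have near_step: "T (B + g) z' = T (B + (g + (a - b))) z" "g + (a - b) \<in> vbox S (t (Suc i))"
    if "z \<in> space M" "z' \<in> space M" "a \<in> nonneg S \<inter> vbox S \<rho>" "b \<in> nonneg S \<inter> vbox S \<rho>" "T a z = T b z'"
      "g \<in> vbox S (t i)" "i < C" for z z' a b g i
  proof -
    show *: "g + (a - b) \<in> vbox S (t (Suc i))"
      unfolding t(3) by (rule vbox_add[OF that(6) nonneg_vbox_diff[OF that(3,4)]])
    have "g + - b \<in> vbox S (t (Suc i))" unfolding t(3) using that(4) by (intro vbox_add[OF that(6) vbox_minus]) auto
    then have "g + - b \<in> vbox S (2 * R)" using tle[of "Suc i"] that(7) vbox_mono by (metis Suc_leI)
    then have nn: "B + (g + - b) \<in> nonneg S" by (rule Bnn)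
    have "T (B + g) z' = T (B + (g + - b)) (T b z')"
      using T_add[OF nn _ that(2), of b] that(4) by (simp add: add.assoc)
    also have "\<dots> = T (B + (g + - b)) (T a z)" using that(5) by simp
    also have "\<dots> = T (B + (g + (a - b))) z"
      using T_add[OF nn _ that(1), of a] that(3) by (simp add: algebra_simps)
    finally show "T (B + g) z' = T (B + (g + (a - b))) z" .
  qed
  have J_near: "J (t i) z' \<subseteq> J (t i) z" if th: "i < C" "z \<in> V i" "z' \<in> V i" "near \<rho> z z'" for i z z'
  proof
    fix j assume "j \<in> J (t i) z'"
    then obtain g where g: "g \<in> vbox S (t i)" "T (B + g) z' \<in> A j" "j < N" by (auto simp: J_def)
    obtain a b where ab: "a \<in> nonneg S \<inter> vbox S \<rho>" "b \<in> nonneg S \<inter> vbox S \<rho>" "T a z = T b z'"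
      using th(4) unfolding near_def by blast
    have "z \<in> space M" "z' \<in> space M" using that by (auto simp: V_def)
    from near_step[OF this ab g(1) that(1)] g have "j \<in> J (t (Suc i)) z" unfolding J_def by auto
    then show "j \<in> J (t i) z" using that(2) by (simp add: V_def)
  qed
  \<comment> \<open>Both points take the least label of the same set, but perhaps at different
    offsets. Seen from \<open>?w\<close>, both offsets lead to points of that colour within one
    window, so these points coincide.\<close>
  have const: "T (h i z) z = T (h i z') z'" if th: "i < C" "z \<in> V i" "z' \<in> V i" "near \<rho> z z'" for i z z'
  proof -
    obtain a b where ab: "a \<in> nonneg S \<inter> vbox S \<rho>" "b \<in> nonneg S \<inter> vbox S \<rho>" "T a z = T b z'"
      using th(4) unfolding near_def by blast
    have zs: "z \<in> space M" "z' \<in> space M" using that by (auto simp: V_def)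
    have Jeq: "J (t i) z = J (t i) z'" using J_near[OF that] J_near[OF that(1,3,2) near_sym[OF that(4)]] by blast
    define g where "g = pick i z' + (a - b)"
    note step = near_step[OF zs ab pick(1)[OF zs(2)] that(1), folded g_def]
    have g: "g \<in> vbox S (2 * R)" using step(2) vbox_mono tle[of "Suc i"] that(1) by (metis Suc_leI)
    have p: "pick i z \<in> vbox S (2 * R)" using pick(1)[OF zs(1)] vbox_mono tle[of i] that(1) by (metis less_imp_le)
    have p': "pick i z' \<in> vbox S (2 * R)" using pick(1)[OF zs(2)] vbox_mono tle[of i] that(1) by (metis less_imp_le)
    let ?j = "Min (J (t i) z)" and ?w = "T (cst S (int N * R)) z"
    have w: "?w \<in> space M" using T_space[OF cR zs(1)] .
    have sw: "T (cst S (int N * R) + (B + f)) y = T (cst S (int N * R)) (T (B + f) y)"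
      if "f \<in> vbox S (2 * R)" "y \<in> space M" for f y using T_add[OF cR Bnn[OF that(1)] that(2)] .
    have sw': "T (cst S (int N * R) + (B + f)) y = T (B + f) (T (cst S (int N * R)) y)"
      if "f \<in> vbox S (2 * R)" "y \<in> space M" for f y
      using T_add[OF Bnn[OF that(1)] cR that(2), of N] by (simp add: add.commute)
    have "T (B + g) z \<in> A ?j" using step(1) pick(2)[OF zs(2), of i] Jeq by simp
    then have "c (T (B + g) ?w) = ?j"
      using A_label[OF _ pick(3)[OF zs(1)] Bnn[OF g] zs(1)] sw'[OF g zs(1)] by simp
    moreover have "c (T (B + pick i z) ?w) = ?j"
      using A_label[OF pick(2)[OF zs(1)] pick(3)[OF zs(1)] Bnn[OF p] zs(1)] sw'[OF p zs(1)] by simp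
    ultimately have "T (B + g) ?w = T (B + pick i z) ?w" using c(3)[OF Bbox[OF g] Bbox[OF p] w] by metis
    then have "T (h i z) z = T (cst S (int N * R)) (T (B + g) z)"
      unfolding h_def using sw'[OF g zs(1)] sw'[OF p zs(1)] sw[OF g zs(1)] by simp
    also have "\<dots> = T (h i z') z'" using step(1) sw[OF p' zs(2)] by (simp add: h_def)
    finally show ?thesis .
  qed
  show ?thesis
    unfolding C_def[symmetric]
  proof (intro exI[of _ V] exI[of _ h] exI[of _ "int N * R + 4 * R"] conjI allI impI ballI)
    show "0 \<le> int N * R + 4 * R" using R by simp
  qed (use V_sets h_sets h_box cover const in \<open>simp_all\<close>)
qed

end

section \<open>Borel asymptotic dimension of commuting maps\<close>

lemma int_div_succ:
  fixes c N :: int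
  assumes "0 < N" "(c + 1) mod N \<noteq> 0"
  shows "(c + 1) div N = c div N"
proof -
  have "c mod N + 1 < N"
  proof (rule ccontr)
    assume "\<not> ?thesis"
    then have "c mod N = N - 1" using pos_mod_bound[OF assms(1), of c] by linarith
    then have "(c + 1) mod N = 0" by (metis add.commute diff_add_cancel mod_add_right_eq mod_self)
    then show False using assms(2) by blast
  qed
  moreover have "c + 1 = N * (c div N) + (c mod N + 1)" by simp
  ultimately show ?thesis
    using assms(1) by (metis add_increasing2 div_mult_self4 div_pos_pos_trivial less_le not_one_le_zero pos_mod_sign
        zero_le_one add.commute add_0 order_less_imp_le div_mult_self2 mult.commute)
qed

text \<open>A move shorter than \<open>m\<close> changes the block index by at most one, and passing
  from one run of \<open>N - 1\<close> permitted blocks to the next would mean entering a block of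
  index \<open>l\<close> modulo \<open>N\<close>. Subtracting \<open>l\<close> before dividing by
  \<open>N\<close> numbers these runs.\<close>

lemma same_block:
  fixes x y m N l :: int
  assumes m: "0 < m" and N: "0 < N" and "\<bar>x - y\<bar> < m"
    and l: "0 \<le> l" "l < N" "(x div m) mod N \<noteq> l" "(y div m) mod N \<noteq> l"
  shows "(x div m - l) div N = (y div m - l) div N"
proof -
  have step: "(a - l) div N = (b - l) div N" if "b = a + 1" "b mod N \<noteq> l" for a b
  proof -
    have "(a - l + 1) mod N \<noteq> 0"
    proof
      assume "(a - l + 1) mod N = 0"
      then have "N dvd b - l" using that(1) by (simp add: mod_eq_0_iff_dvd algebra_simps)
      then have "b mod N = l mod N" by (simp add: mod_eq_dvd_iff)
      then show False using that(2) l by simp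
    qed
    from int_div_succ[OF N this] show ?thesis using that(1) by (simp add: algebra_simps)
  qed
  have ge: "x' div m \<le> y' div m + 1" if "x' - y' < m" for x' y' :: int
  proof -
    have "x' div m \<le> (y' + m) div m" using that m by (intro zdiv_mono1) auto
    then show ?thesis using m by simp
  qed
  have "x div m = y div m \<or> x div m = y div m + 1 \<or> y div m = x div m + 1"
    using ge[of x y] ge[of y x] assms(3) by linarith
  then show ?thesis using step[of "x div m" "y div m"] step[of "y div m" "x div m"] l by metis
qed

text \<open>A run together with its forbidden block consists of \<open>N\<close> blocks of length
  \<open>m\<close>.\<close>

lemma same_block_bound:
  fixes x y m N l :: int
  assumes m: "0 < m" and N: "0 < N" and eq: "(x div m - l) div N = (y div m - l) div N"
  shows "\<bar>x - y\<bar> \<le> N * m"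
proof -
  have *: "z div m - l = N * ((z div m - l) div N) + (z div m - l) mod N" for z by simp
  have r: "0 \<le> (z div m - l) mod N" "(z div m - l) mod N < N" for z using N by simp_all
  have d: "\<bar>x div m - y div m\<bar> \<le> N - 1"
    using *[of x] *[of y] r[of x] r[of y] eq by (smt (verit))
  have x: "x = (x div m) * m + x mod m" "y = (y div m) * m + y mod m" by simp_all
  have mm: "0 \<le> x mod m" "x mod m < m" "0 \<le> y mod m" "y mod m < m" using m by simp_all
  have "\<bar>(x div m - y div m) * m\<bar> \<le> (N - 1) * m"
    unfolding abs_mult using d m by (intro mult_mono) auto
  moreover have "x - y = (x div m - y div m) * m + (x mod m - y mod m)"
    using x unfolding left_diff_distrib by linarith
  ultimately have "\<bar>x - y\<bar> \<le> (N - 1) * m + m" using mm by linarith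
  then show ?thesis by (simp add: left_diff_distrib)
qed

section \<open>Additive coordinates modulo a group of relations\<close>

definition additive :: "'i set \<Rightarrow> (('i \<Rightarrow> int) \<Rightarrow> int) \<Rightarrow> bool" where
  "additive S p \<longleftrightarrow> (\<forall>v\<in>vecs S. \<forall>w\<in>vecs S. p (v + w) = p v + p w)"

lemma additive_add: "additive S p \<Longrightarrow> v \<in> vecs S \<Longrightarrow> w \<in> vecs S \<Longrightarrow> p (v + w) = p v + p w"
  by (simp add: additive_def)

lemma additive_zero: "additive S p \<Longrightarrow> p 0 = 0"
  using additive_add[of S p 0 0] by (simp add: vecs_closed)

lemma additive_diff: "additive S p \<Longrightarrow> v \<in> vecs S \<Longrightarrow> w \<in> vecs S \<Longrightarrow> p (v - w) = p v - p w"
  using additive_add[of S p "v - w" w] by (simp add: vecs_closed)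

definition vscale :: "int \<Rightarrow> ('i \<Rightarrow> int) \<Rightarrow> 'i \<Rightarrow> int" where
  "vscale q v = (\<lambda>i. q * v i)"

lemma vscale_simps: "vscale 0 v = 0" "vscale (q + 1) v = vscale q v + v" "vscale (q - 1) v = vscale q v - v"
  by (auto simp: vscale_def fun_eq_iff algebra_simps)

lemma vscale_vecs: "v \<in> vecs S \<Longrightarrow> vscale q v \<in> vecs S"
  by (simp add: vscale_def vecs_def)

lemma additive_vscale: "additive S p \<Longrightarrow> v \<in> vecs S \<Longrightarrow> p (vscale q v) = q * p v"
  by (induction q rule: int_induct[where k = 0])
    (simp_all add: vscale_simps additive_zero additive_add additive_diff vscale_vecs algebra_simps)

definition vec_subgroup :: "'i set \<Rightarrow> ('i \<Rightarrow> int) set \<Rightarrow> bool" where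
  "vec_subgroup S L \<longleftrightarrow> L \<subseteq> vecs S \<and> 0 \<in> L \<and> (\<forall>v\<in>L. \<forall>w\<in>L. v + w \<in> L \<and> v - w \<in> L)"

lemma vscale_subgroup: "vec_subgroup S L \<Longrightarrow> v \<in> L \<Longrightarrow> vscale q v \<in> L"
  by (induction q rule: int_induct[where k = 0]) (simp_all add: vscale_simps vec_subgroup_def)

text \<open>The \<open>\<pi> j\<close> are the coordinates of a homomorphism \<open>\<int>\<^sup>S \<rightarrow> \<int>\<^sup>n\<close> such that, up to adding elements
  of \<open>L\<close>, only boundedly many vectors have bounded image. It need not vanish on \<open>L\<close>.\<close>

definition frame :: "'i set \<Rightarrow> ('i \<Rightarrow> int) set \<Rightarrow> nat \<Rightarrow> (nat \<Rightarrow> ('i \<Rightarrow> int) \<Rightarrow> int) \<Rightarrow> bool" where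
  "frame S L n \<pi> \<longleftrightarrow> (\<forall>j<n. additive S (\<pi> j)) \<and>
     (\<forall>D. \<exists>D'. \<forall>v\<in>vecs S. (\<forall>j<n. \<bar>\<pi> j v\<bar> \<le> D) \<longrightarrow> (\<exists>v'\<in>vbox S D'. v - v' \<in> L))"

text \<open>Eliminating a coordinate: once a vector \<open>\<eta>\<close> with \<open>\<pi>\<^sub>j \<eta> \<noteq> 0\<close> is a relation, division with
  remainder by \<open>\<pi>\<^sub>j \<eta>\<close> bounds the \<open>j\<close>-th coordinate.\<close>

lemma frame_eliminate:
  assumes fr: "frame S L (Suc n) \<pi>" and "L \<subseteq> L'" and L': "vec_subgroup S L'"
    and \<eta>: "\<eta> \<in> L'" and j: "j \<le> n" "\<pi> j \<eta> \<noteq> 0"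
  shows "\<exists>\<pi>'. frame S L' n \<pi>'"
proof -
  \<comment> \<open>\<sigma> lists the indices other than \<open>j\<close>, putting \<open>n\<close>
    into the slot of \<open>j\<close>. The cross product \<open>\<pi>'\<close> vanishes on \<eta>,
    so subtracting multiples of \<eta> does not change it.\<close>
  define \<sigma> where "\<sigma> l = (if l = j then n else l)" for l
  define \<pi>' where "\<pi>' l v = \<pi> j \<eta> * \<pi> (\<sigma> l) v - \<pi> (\<sigma> l) \<eta> * \<pi> j v" for l v
  have add: "additive S (\<pi> i)" if "i \<le> n" for i using fr that by (auto simp: frame_def)
  have \<sigma>: "\<sigma> l \<le> n" if "l < n" for l using that j(1) by (auto simp: \<sigma>_def)
  have \<eta>v: "\<eta> \<in> vecs S" using \<eta> L' by (auto simp: vec_subgroup_def)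
  have "frame S L' n \<pi>'"
    unfolding frame_def
  proof (intro conjI allI impI)
    fix l assume "l < n"
    then show "additive S (\<pi>' l)"
      using additive_add[OF add[OF j(1)]] additive_add[OF add[OF \<sigma>]]
      by (simp add: additive_def \<pi>'_def algebra_simps)
  next
    fix D
    define e where "e = \<bar>\<pi> j \<eta>\<bar>"
    define G where "G = (\<Sum>i\<le>n. \<bar>\<pi> i \<eta>\<bar>)"
    have e: "1 \<le> e" using j(2) by (simp add: e_def)
    have G: "\<bar>\<pi> i \<eta>\<bar> \<le> G" if "i \<le> n" for i unfolding G_def using that by (intro member_le_sum) auto
    \<comment> \<open>\<open>e\<close> bounds the reduced coordinate \<open>j\<close>; the others
      are recovered from the cross products, whose correction term is at most
      \<open>G * e\<close>.\<close>
    obtain D' where D': "\<And>v. v \<in> vecs S \<Longrightarrow> (\<And>j. j < Suc n \<Longrightarrow> \<bar>\<pi> j v\<bar> \<le> \<bar>D\<bar> + G * e + e) \<Longrightarrow> \<exists>v'\<in>vbox S D'. v - v' \<in> L"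
      using fr unfolding frame_def by blast
    show "\<exists>D'. \<forall>v\<in>vecs S. (\<forall>j<n. \<bar>\<pi>' j v\<bar> \<le> D) \<longrightarrow> (\<exists>v'\<in>vbox S D'. v - v' \<in> L')"
    proof (intro exI[of _ D'] ballI impI)
      fix v assume v: "v \<in> vecs S" "\<forall>l<n. \<bar>\<pi>' l v\<bar> \<le> D"
      define q where "q = \<pi> j v div \<pi> j \<eta>"
      define w where "w = v - vscale q \<eta>"
      have w: "w \<in> vecs S" using v \<eta>v by (auto simp: w_def intro: vecs_closed vscale_vecs)
      have \<pi>w: "\<pi> i w = \<pi> i v - q * \<pi> i \<eta>" if "i \<le> n" for i
        using additive_diff[OF add[OF that] v(1) vscale_vecs[OF \<eta>v]] additive_vscale[OF add[OF that] \<eta>v]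
        by (simp add: w_def)
      have "\<pi> j w = \<pi> j v mod \<pi> j \<eta>" using \<pi>w[OF j(1)] by (simp add: q_def minus_div_mult_eq_mod)
      then have jw: "\<bar>\<pi> j w\<bar> \<le> e" using abs_mod_less[OF j(2), of "\<pi> j v"] by (simp add: e_def)
      have Gpos: "0 \<le> G" unfolding G_def by (intro sum_nonneg) auto
      have Ge: "0 \<le> G * e" using Gpos e by simp
      have "\<bar>\<pi> i w\<bar> \<le> \<bar>D\<bar> + G * e + e" if i: "i < Suc n" for i
      proof (cases "i = j")
        case True
        then show ?thesis using jw Ge by simp
      next
        case False
        define l where "l = (if i = n then j else i)"
        have l: "l < n" "\<sigma> l = i" using i j(1) False by (auto simp: l_def \<sigma>_def)
        have "\<pi>' l w = \<pi>' l v"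
          unfolding \<pi>'_def \<pi>w[OF \<sigma>[OF l(1)]] \<pi>w[OF j(1)] by (simp add: algebra_simps)
        then have "\<pi> j \<eta> * \<pi> i w = \<pi>' l v + \<pi> i \<eta> * \<pi> j w" by (simp add: \<pi>'_def l(2) algebra_simps)
        then have "\<bar>\<pi> j \<eta> * \<pi> i w\<bar> \<le> \<bar>\<pi>' l v\<bar> + \<bar>\<pi> i \<eta>\<bar> * \<bar>\<pi> j w\<bar>"
          by (metis abs_mult abs_triangle_ineq)
        also have "\<dots> \<le> \<bar>D\<bar> + G * e"
          using v(2) l(1) G[of i] i jw Gpos by (intro add_mono mult_mono) (force, auto)
        finally have "e * \<bar>\<pi> i w\<bar> \<le> \<bar>D\<bar> + G * e" by (simp add: abs_mult e_def)
        moreover have "1 * \<bar>\<pi> i w\<bar> \<le> e * \<bar>\<pi> i w\<bar>" using e by (intro mult_right_mono) auto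
        ultimately show ?thesis using e by linarith
      qed
      then obtain v' where v': "v' \<in> vbox S D'" "w - v' \<in> L" using D'[OF w] by blast
      have "v - v' = (w - v') + vscale q \<eta>" by (simp add: w_def)
      also have "\<dots> \<in> L'"
        using vscale_subgroup[OF L' \<eta>, of q] v'(2) assms(2) L' unfolding vec_subgroup_def by blast
      finally have "v - v' \<in> L'" .
      then show "\<exists>v'\<in>vbox S D'. v - v' \<in> L'" using v'(1) by blast
    qed
  qed
  then show ?thesis by blast
qed

section \<open>Near-chains and unions of covers\<close>

context commuting_maps
begin

lemma near_refl: "0 \<le> r \<Longrightarrow> near r x x"
  unfolding near_def by (intro bexI[of _ 0]) (auto simp: vbox_def vecs_def)

lemma near_mono: "near r x y \<Longrightarrow> r \<le> s \<Longrightarrow> near s x y"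
  unfolding near_def using vbox_mono by blast

text \<open>Commutativity lets the two meeting points be pushed to a common one, the first by
  \<open>c\<close> and the second by \<open>b\<close>.\<close>

lemma near_trans:
  assumes "near r x y" "near s y z" and sp: "x \<in> space M" "y \<in> space M" "z \<in> space M"
  shows "near (r + s) x z"
proof -
  obtain a b where ab: "a \<in> nonneg S \<inter> vbox S r" "b \<in> nonneg S \<inter> vbox S r" "T a x = T b y"
    using assms(1) unfolding near_def by blast
  obtain c d where cd: "c \<in> nonneg S \<inter> vbox S s" "d \<in> nonneg S \<inter> vbox S s" "T c y = T d z"
    using assms(2) unfolding near_def by blast
  have "T (c + a) x = T (c + b) y" using T_eq_shift[OF ab(3)] ab cd sp by blast
  also have "\<dots> = T (b + d) z" using T_eq_shift[OF cd(3), of b] ab cd sp by (simp add: add.commute)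
  finally have "T (a + c) x = T (b + d) z" by (simp add: add.commute)
  then show ?thesis unfolding near_def using ab cd by (intro bexI) (auto intro: nonneg_add vbox_add)
qed

definition near_chain :: "int \<Rightarrow> 'x set \<Rightarrow> ('x \<times> 'x) set" where
  "near_chain r U = {(x, y). x \<in> U \<and> y \<in> U \<and> near r x y}\<^sup>*"

definition good_cover :: "'x set \<Rightarrow> int \<Rightarrow> nat \<Rightarrow> (nat \<Rightarrow> 'x set) \<Rightarrow> int \<Rightarrow> bool" where
  "good_cover Y r n U R \<longleftrightarrow> 0 \<le> R \<and> (\<forall>l\<le>n. U l \<in> sets M) \<and> Y \<subseteq> (\<Union>l\<le>n. U l) \<and>
     (\<forall>l\<le>n. \<forall>x\<in>U l. \<forall>y. (x, y) \<in> near_chain r (U l) \<longrightarrow> near R x y)"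

lemma near_chain_mem: "(x, y) \<in> near_chain r U \<Longrightarrow> x \<in> U \<Longrightarrow> y \<in> U"
  unfolding near_chain_def by (induction rule: rtrancl_induct) auto

lemma near_chain_step: "(x, y) \<in> near_chain r U \<Longrightarrow> y \<in> U \<Longrightarrow> z \<in> U \<Longrightarrow> near r y z \<Longrightarrow> (x, z) \<in> near_chain r U"
  unfolding near_chain_def by (auto intro: rtrancl_into_rtrancl)

lemma near_chain_refl: "(x, x) \<in> near_chain r U"
  by (simp add: near_chain_def)

text \<open>An \<open>r\<close>-chain in \<open>U l \<union> U' l\<close> leaves \<open>U' l\<close> only for excursions of size \<open>R\<close>, so its points in
  \<open>U' l\<close> form an \<open>r'\<close>-chain.\<close>

lemma good_cover_Un:
  assumes A: "good_cover A r n U R" and B: "good_cover B r' n U' R'" and r: "0 \<le> r" "R + 2 * r \<le> r'"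
  shows "good_cover (A \<union> B) r n (\<lambda>l. U l \<union> U' l) (R' + 2 * R + 2 * r)"
  unfolding good_cover_def
proof (intro conjI allI ballI impI)
  have R: "0 \<le> R" "0 \<le> R'" using A B by (auto simp: good_cover_def)
  then show "0 \<le> R' + 2 * R + 2 * r" using r by simp
  show "U l \<union> U' l \<in> sets M" if "l \<le> n" for l using that A B by (auto simp: good_cover_def)
  show "A \<union> B \<subseteq> (\<Union>l\<le>n. U l \<union> U' l)" using A B unfolding good_cover_def by blast
  fix l x y assume l: "l \<le> n" and x: "x \<in> U l \<union> U' l" and xy: "(x, y) \<in> near_chain r (U l \<union> U' l)"
  have bU: "near R z w" if "z \<in> U l" "(z, w) \<in> near_chain r (U l)" for z w
    using A l that by (auto simp: good_cover_def)
  have bU': "near R' z w" if "z \<in> U' l" "(z, w) \<in> near_chain r' (U' l)" for z w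
    using B l that by (auto simp: good_cover_def)
  have sp: "U l \<subseteq> space M" "U' l \<subseteq> space M" using A B l sets.sets_into_space by (auto simp: good_cover_def)
  \<comment> \<open>\<open>I1\<close>: the chain has stayed in \<open>U l\<close> so far.
    \<open>I2\<close>: it reached \<open>U' l\<close> at \<open>u\<close>, its visits there are
    linked by an \<open>r'\<close>-chain ending in \<open>w\<close>, and since \<open>w\<close> it
    has made at most one excursion inside \<open>U l\<close>.\<close>
  define I1 where "I1 y \<longleftrightarrow> x \<in> U l \<and> (x, y) \<in> near_chain r (U l)" for y
  define I2 where "I2 y \<longleftrightarrow> (\<exists>u w. u \<in> U' l \<and> near (R + r) x u \<and> (u, w) \<in> near_chain r' (U' l) \<and>
      (y = w \<or> (\<exists>z\<in>U l. near r w z \<and> (z, y) \<in> near_chain r (U l))))" for y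
  have I2I: "I2 y" if "y \<in> U' l" "near (R + r) x y" for y
    unfolding I2_def using that near_chain_refl by blast
  from xy have "I1 y \<or> I2 y"
    unfolding near_chain_def
  proof (induction rule: rtrancl_induct)
    case base
    then show ?case
      using x I2I[of x] near_refl[of "R + r" x] R r near_chain_refl unfolding I1_def by auto
  next
    case (step y y')
    then have yy: "y \<in> U l \<union> U' l" "y' \<in> U l \<union> U' l" "near r y y'" by auto
    have ysp: "x \<in> space M" "y \<in> space M" "y' \<in> space M" using x yy sp by auto
    from step.IH show ?case
    proof
      assume I1: "I1 y"
      then have yU: "y \<in> U l" using near_chain_mem unfolding I1_def by blast
      show ?case
      proof (cases "y' \<in> U l")
        case True
        then show ?thesis using I1 near_chain_step yU yy(3) unfolding I1_def by blast
      next
        case False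
        have "near (R + r) x y'"
          using near_trans[OF bU yy(3) ysp] I1 unfolding I1_def by blast
        then show ?thesis using I2I[of y'] False yy(2) by blast
      qed
    next
      assume "I2 y"
      then obtain u w where uw: "u \<in> U' l" "near (R + r) x u" "(u, w) \<in> near_chain r' (U' l)"
        "y = w \<or> (\<exists>z\<in>U l. near r w z \<and> (z, y) \<in> near_chain r (U l))" unfolding I2_def by blast
      have w: "w \<in> U' l" using near_chain_mem[OF uw(3,1)] .
      have wsp: "w \<in> space M" using w sp by blast
      show ?case
      proof (cases "y' \<in> U' l")
        case True
        have "near r' w y'"
        proof (cases "y = w")
          case True
          then show ?thesis using yy(3) near_mono[of r y y' r'] R r by simp
        next
          case False
          then obtain z where z: "z \<in> U l" "near r w z" "(z, y) \<in> near_chain r (U l)" using uw(4) by blast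
          have "near (r + R) w y" using near_trans[OF z(2) bU[OF z(1,3)] wsp _ ysp(2)] z(1) sp by blast
          from near_trans[OF this yy(3) wsp ysp(2,3)] have "near (r + R + r) w y'" .
          then show ?thesis by (rule near_mono) (use r in simp)
        qed
        then have "(u, y') \<in> near_chain r' (U' l)" using near_chain_step[OF uw(3) w True] by blast
        then show ?thesis using uw(1,2) unfolding I2_def by blast
      next
        case False
        then have y'U: "y' \<in> U l" using yy(2) by blast
        have "\<exists>z\<in>U l. near r w z \<and> (z, y') \<in> near_chain r (U l)"
        proof (cases "y = w")
          case True
          then show ?thesis using y'U yy(3) near_chain_refl by blast
        next
          case False
          then obtain z where z: "z \<in> U l" "near r w z" "(z, y) \<in> near_chain r (U l)" using uw(4) by blast
          have "y \<in> U l" using near_chain_mem[OF z(3,1)] .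
          then show ?thesis using near_chain_step[OF z(3) _ y'U yy(3)] z by blast
        qed
        then show ?thesis using uw unfolding I2_def by blast
      qed
    qed
  qed
  then show "near (R' + 2 * R + 2 * r) x y"
  proof
    assume "I1 y"
    then have "near R x y" using bU unfolding I1_def by blast
    then show ?thesis by (rule near_mono) (use R r in simp)
  next
    assume "I2 y"
    then obtain u w where uw: "u \<in> U' l" "near (R + r) x u" "(u, w) \<in> near_chain r' (U' l)"
      "y = w \<or> (\<exists>z\<in>U l. near r w z \<and> (z, y) \<in> near_chain r (U l))" unfolding I2_def by blast
    have w: "w \<in> U' l" using near_chain_mem[OF uw(3,1)] .
    have s: "x \<in> space M" "u \<in> space M" "w \<in> space M" using x uw(1) w sp by auto
    have xw: "near (R + r + R') x w" using near_trans[OF uw(2) bU'[OF uw(1,3)] s] .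
    show ?thesis
    proof (cases "y = w")
      case True
      then show ?thesis using near_mono[OF xw] R r by simp
    next
      case False
      then obtain z where z: "z \<in> U l" "near r w z" "(z, y) \<in> near_chain r (U l)" using uw(4) by blast
      have ys: "y \<in> space M" "z \<in> space M" using near_chain_mem[OF z(3,1)] z(1) sp by auto
      \<comment> \<open>The summands are the approach to \<open>U' l\<close>, the chain inside it
        and the last excursion.\<close>
      have "near (R + r + R' + (r + R)) x y"
        using near_trans[OF xw near_trans[OF z(2) bU[OF z(1,3)] s(3) ys(2,1)] s(1,3) ys(1)] .
      then show ?thesis by (rule near_mono) simp
    qed
  qed
qed

definition bdim_le :: "'x set \<Rightarrow> nat \<Rightarrow> bool" where
  "bdim_le Y n \<longleftrightarrow> (\<forall>r\<ge>0. \<exists>U R. good_cover Y r n U R)"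

lemma good_cover_empty: "good_cover {} r n (\<lambda>_. {}) 0"
  by (simp add: good_cover_def)

lemma bdim_le_Un: "bdim_le A n \<Longrightarrow> bdim_le B n \<Longrightarrow> bdim_le (A \<union> B) n"
  unfolding bdim_le_def
proof (intro allI impI)
  fix r :: int assume AB: "\<forall>r\<ge>0. \<exists>U R. good_cover A r n U R" "\<forall>r\<ge>0. \<exists>U R. good_cover B r n U R" and r: "0 \<le> r"
  obtain U R where U: "good_cover A r n U R" using AB r by blast
  then have "0 \<le> R + 2 * r" using r by (simp add: good_cover_def)
  then obtain U' R' where "good_cover B (R + 2 * r) n U' R'" using AB by blast
  from good_cover_Un[OF U this r] show "\<exists>U R. good_cover (A \<union> B) r n U R" by auto
qed

lemma bdim_le_UN:
  assumes "finite I" "\<And>i. i \<in> I \<Longrightarrow> bdim_le (A i) n"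
  shows "bdim_le (\<Union>i\<in>I. A i) n"
  using assms
proof (induction I)
  case empty
  show ?case using good_cover_empty unfolding bdim_le_def by auto
next
  case (insert i I)
  then show ?case using bdim_le_Un[of "A i" n "\<Union>i\<in>I. A i"] by simp
qed

lemma bdim_le_Suc: "bdim_le Y n \<Longrightarrow> bdim_le Y (Suc n)"
  unfolding bdim_le_def
proof (intro allI impI)
  fix r :: int assume "\<forall>r\<ge>0. \<exists>U R. good_cover Y r n U R" "0 \<le> r"
  then obtain U R where U: "good_cover Y r n U R" by blast
  have "good_cover Y r (Suc n) (\<lambda>l. if l \<le> n then U l else {}) R"
    unfolding good_cover_def
  proof (intro conjI allI ballI impI)
    have "Y \<subseteq> (\<Union>l\<le>n. U l)" using U by (simp add: good_cover_def)
    then show "Y \<subseteq> (\<Union>l\<le>Suc n. if l \<le> n then U l else {})" by (fastforce split: if_splits)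
  qed (use U in \<open>auto simp: good_cover_def split: if_splits\<close>)
  then show "\<exists>U R. good_cover Y r (Suc n) U R" by blast
qed

text \<open>The bound of \<open>good_cover_Un\<close> iterated, with \<open>D s\<close> bounding the
  cover of any single piece at scale \<open>s\<close>. It involves neither the pieces nor \<rho>, so
  all scales are known before the pieces are chosen.\<close>

primrec union_bound :: "(int \<Rightarrow> int) \<Rightarrow> int \<Rightarrow> nat \<Rightarrow> int" where
  "union_bound D r 0 = 0"
| "union_bound D r (Suc i) = D (union_bound D r i + 2 * r) + 2 * union_bound D r i + 2 * r"

lemma union_bound_nonneg: "(\<And>s. 0 \<le> D s) \<Longrightarrow> 0 \<le> r \<Longrightarrow> 0 \<le> union_bound D r i"
  by (induction i) (auto intro!: add_nonneg_nonneg)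

lemma good_cover_UN_controlled:
  assumes r: "0 \<le> r" and D: "\<And>s. 0 \<le> D s"
    and "\<And>i. i < C \<Longrightarrow> \<exists>U. good_cover (A i) (union_bound D r i + 2 * r) n U (D (union_bound D r i + 2 * r))"
  shows "\<exists>U. good_cover (\<Union>i<C. A i) r n U (union_bound D r C)"
  using assms(3)
proof (induction C)
  case 0
  show ?case using good_cover_empty by auto
next
  case (Suc C)
  then obtain U where U: "good_cover (\<Union>i<C. A i) r n U (union_bound D r C)" by fastforce
  obtain U' where U': "good_cover (A C) (union_bound D r C + 2 * r) n U' (D (union_bound D r C + 2 * r))"
    using Suc.prems[of C] by blast
  have "(\<Union>i<Suc C. A i) = (\<Union>i<C. A i) \<union> A C" by (auto simp: less_Suc_eq)
  then show ?case using good_cover_Un[OF U U' r] by auto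
qed

text \<open>Since \<open>T\<close> is only meaningful on nonnegative vectors, a relation \<open>T l x = x\<close> is stated after
  a shift by \<open>c\<close>.\<close>

definition rels :: "'x set \<Rightarrow> ('i \<Rightarrow> int) set" where
  "rels Y = {l \<in> vecs S. \<exists>c\<in>nonneg S. c + l \<in> nonneg S \<and> (\<forall>x\<in>Y. T (c + l) x = T c x)}"

lemma rels_mono:
  assumes "Y \<subseteq> space M" "c \<in> nonneg S" "c + l \<in> nonneg S" "\<forall>x\<in>Y. T (c + l) x = T c x" "d - c \<in> nonneg S" "x \<in> Y"
  shows "T (d + l) x = T d x" "d + l \<in> nonneg S"
proof -
  have x: "x \<in> space M" using assms by blast
  have "T ((d - c) + (c + l)) x = T ((d - c) + c) x"
    using assms by (intro T_eq_shift[OF _ _ _ _ x x]) auto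
  then show "T (d + l) x = T d x" by (simp add: algebra_simps)
  have "(d - c) + (c + l) \<in> nonneg S" by (rule nonneg_add) (use assms in auto)
  moreover have "(d - c) + (c + l) = d + l" by simp
  ultimately show "d + l \<in> nonneg S" by simp
qed

text \<open>Negation trades the shift \<open>c\<close> for \<open>c + l\<close>, and a sum of
  relations holds after the sum of their shifts.\<close>

lemma rels_subgroup:
  assumes Y: "Y \<subseteq> space M"
  shows "vec_subgroup S (rels Y)"
proof -
  have neg: "- l \<in> rels Y" if "l \<in> rels Y" for l
  proof -
    obtain c where c: "l \<in> vecs S" "c \<in> nonneg S" "c + l \<in> nonneg S" "\<forall>x\<in>Y. T (c + l) x = T c x"
      using \<open>l \<in> rels Y\<close> unfolding rels_def by blast
    then show ?thesis unfolding rels_def by (auto intro!: bexI[of _ "c + l"] vecs_closed)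
  qed
  have add: "l + k \<in> rels Y" if lk: "l \<in> rels Y" "k \<in> rels Y" for l k
  proof -
    obtain c where c: "l \<in> vecs S" "c \<in> nonneg S" "c + l \<in> nonneg S" "\<forall>x\<in>Y. T (c + l) x = T c x"
      using lk unfolding rels_def by blast
    obtain d where d: "k \<in> vecs S" "d \<in> nonneg S" "d + k \<in> nonneg S" "\<forall>x\<in>Y. T (d + k) x = T d x"
      using lk unfolding rels_def by blast
    have "T ((c + d) + (l + k)) x = T (c + d) x" if x: "x \<in> Y" for x
    proof -
      have xs: "x \<in> space M" using x Y by blast
      have "T ((d + k) + (c + l)) x = T ((d + k) + c) x"
        using c d x xs by (intro T_eq_shift) auto
      moreover have "T (c + (d + k)) x = T (c + d) x"
        using c d x xs by (intro T_eq_shift) auto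
      ultimately show ?thesis by (simp add: algebra_simps)
    qed
    moreover have "(c + d) + (l + k) \<in> nonneg S"
      using nonneg_add[OF c(3) d(3)] by (simp add: algebra_simps)
    ultimately show ?thesis
      unfolding rels_def using c(1,2) d(1,2) by (auto intro!: bexI[of _ "c + d"] vecs_closed nonneg_add)
  qed
  have "l - k \<in> rels Y" if "l \<in> rels Y" "k \<in> rels Y" for l k
    using add[OF that(1) neg[OF that(2)]] by simp
  moreover have "0 \<in> rels Y" unfolding rels_def
    by (auto simp: vecs_closed intro: exI[of _ 0] zero_nonneg)
  ultimately show ?thesis
    unfolding vec_subgroup_def using add by (auto simp: rels_def)
qed

text \<open>A relation persists under every larger shift, so finitely many of them hold beyond a
  common one; later this is applied to the relations of bounded length.\<close>

lemma rels_uniform: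
  assumes Y: "Y \<subseteq> space M" and "finite \<Lambda>" "\<Lambda> \<subseteq> rels Y"
  shows "\<exists>e\<ge>0. \<forall>c\<in>vecs S. (\<forall>i\<in>S. e \<le> c i) \<longrightarrow> (\<forall>l\<in>\<Lambda>. \<forall>x\<in>Y. T (c + l) x = T c x)"
  using assms(2,3)
proof (induction \<Lambda>)
  case empty
  then show ?case by auto
next
  case (insert l \<Lambda>)
  then obtain e where e: "0 \<le> e"
    "\<forall>c\<in>vecs S. (\<forall>i\<in>S. e \<le> c i) \<longrightarrow> (\<forall>l\<in>\<Lambda>. \<forall>x\<in>Y. T (c + l) x = T c x)"
    by blast
  obtain c where c: "c \<in> nonneg S" "c + l \<in> nonneg S" "\<forall>x\<in>Y. T (c + l) x = T c x"
    using insert.prems unfolding rels_def by blast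
  define e' where "e' = max e (\<Sum>i\<in>S. c i)"
  have ce: "c i \<le> e'" if "i \<in> S" for i
    using member_le_sum[of i S c] that c(1) finite_index by (auto simp: nonneg_def e'_def)
  have "T (d + k) x = T d x" if d: "d \<in> vecs S" "\<forall>i\<in>S. e' \<le> d i" "k \<in> insert l \<Lambda>" "x \<in> Y" for d k x
  proof (cases "k \<in> \<Lambda>")
    case True
    have "\<forall>i\<in>S. e \<le> d i" using d(2) by (auto simp: e'_def)
    then show ?thesis using e(2) d(1,4) True by blast
  next
    case False
    have "0 \<le> (d - c) i" for i
    proof (cases "i \<in> S")
      case True
      then show ?thesis using ce[of i] d(2) by fastforce
    next
      case False
      then show ?thesis using d(1) c(1) by (auto simp: vecs_def nonneg_def)
    qed
    then have "d - c \<in> nonneg S" using d(1) c(1) vecs_closed(2) by (auto simp: nonneg_def)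
    then show ?thesis using rels_mono(1)[OF Y c _ d(4)] False d(3) by blast
  qed
  moreover have "0 \<le> e'" using e(1) by (simp add: e'_def)
  ultimately show ?case by blast
qed

end

context commuting_maps
begin

text \<open>\<open>\<pi> j (h z)\<close> acts as the position of \<open>z\<close> in
  \<open>\<int>\<^sup>n\<close>: the identity says that it changes from \<open>z\<close> to
  \<open>z'\<close> exactly as the step given by \<open>a\<close> and \<open>b\<close> dictates. The
  bound \<open>Q\<close> makes finitely many values of \<open>h\<close> occur, for measurability; it
  does not enter the size of the cover.\<close>

definition displacement_coordinates ::
    "'x set \<Rightarrow> int \<Rightarrow> nat \<Rightarrow> (nat \<Rightarrow> ('i \<Rightarrow> int) \<Rightarrow> int) \<Rightarrow> ('x \<Rightarrow> 'i \<Rightarrow> int) \<Rightarrow> bool" where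
  "displacement_coordinates A s n \<pi> h \<longleftrightarrow>
     (\<exists>Q. \<forall>z\<in>space M. h z \<in> vbox S Q) \<and> (\<forall>v. {z \<in> space M. h z = v} \<in> sets M) \<and>
     (\<forall>z\<in>A. \<forall>z'\<in>A. \<forall>a\<in>nonneg S \<inter> vbox S s. \<forall>b\<in>nonneg S \<inter> vbox S s. T a z = T b z' \<longrightarrow>
       (\<forall>j<n. \<pi> j (h z) + \<pi> j b = \<pi> j (h z') + \<pi> j a))"

text \<open>The standard cover of \<open>\<int>\<^sup>n\<close>: family \<open>l\<close> omits the points one of whose \<open>n\<close> coordinates lies
  in a block of length \<open>m\<close> whose index is \<open>l\<close> modulo \<open>n + 1\<close>, so a point is omitted by at most \<open>n\<close>
  of the \<open>n + 1\<close> families. In the proof \<open>v\<close> is a representative, bounded independently of the chain,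
  of its total displacement \<open>u\<close> modulo the relations.\<close>

lemma good_cover_coordinates:
  assumes Y: "Y \<subseteq> space M" and fr: "frame S (rels Y) n \<pi>" and s: "0 \<le> s"
  shows "\<exists>D\<ge>0. \<forall>A h. A \<in> sets M \<longrightarrow> A \<subseteq> Y \<longrightarrow> displacement_coordinates A s n \<pi> h \<longrightarrow>
    (\<exists>U. good_cover A s n U D)"
proof -
  have add: "additive S (\<pi> j)" if "j < n" for j using fr that by (auto simp: frame_def)
  \<comment> \<open>Bounds the change of every coordinate along one \<open>s\<close>-step, so that a
    step is shorter than a block of length \<open>m\<close>.\<close>
  define K where "K = (\<Sum>v\<in>vbox S s. \<Sum>j<n. \<bar>\<pi> j v\<bar>)"
  have K: "\<bar>\<pi> j v\<bar> \<le> K" if "v \<in> vbox S s" "j < n" for j v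
  proof -
    have "\<bar>\<pi> j v\<bar> \<le> (\<Sum>j<n. \<bar>\<pi> j v\<bar>)" using that by (intro member_le_sum) auto
    also have "\<dots> \<le> K" unfolding K_def
      using that finite_vbox[OF finite_index] by (intro member_le_sum[where f = "\<lambda>v. \<Sum>j<n. \<bar>\<pi> j v\<bar>"] sum_nonneg) auto
    finally show ?thesis .
  qed
  have "0 \<le> K" unfolding K_def by (intro sum_nonneg) auto
  define m where "m = K + 1"
  define N where "N = int n + 1"
  have m: "0 < m" and N: "0 < N" using \<open>0 \<le> K\<close> by (auto simp: m_def N_def)
  obtain D' where D': "\<And>v. v \<in> vecs S \<Longrightarrow> (\<And>j. j < n \<Longrightarrow> \<bar>\<pi> j v\<bar> \<le> N * m) \<Longrightarrow> \<exists>v'\<in>vbox S D'. v - v' \<in> rels Y"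
    using fr unfolding frame_def by blast
  define E where "E = max D' 0"
  have E: "0 \<le> E" "\<And>v. v \<in> vbox S D' \<Longrightarrow> v \<in> vbox S E" using vbox_mono unfolding E_def by (auto simp: max_def)
  \<comment> \<open>An old representative extended by one step differs from the new one by a
    relation of at most this length. There are finitely many of these, hence one shift
    \<open>e\<close> for all.\<close>
  define \<Lambda> where "\<Lambda> = rels Y \<inter> vbox S (E + (E + s))"
  obtain e where e: "0 \<le> e" "\<forall>c\<in>vecs S. (\<forall>i\<in>S. e \<le> c i) \<longrightarrow> (\<forall>l\<in>\<Lambda>. \<forall>x\<in>Y. T (c + l) x = T c x)"
    using rels_uniform[OF Y, of \<Lambda>] finite_vbox[OF finite_index] unfolding \<Lambda>_def by blast
  \<comment> \<open>\<open>E + s\<close> keeps \<open>cst S F - v - a\<close> nonnegative, and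
    \<open>e\<close> is what remains for applying the relations in \<Lambda> after subtracting
    \<open>v'\<close>.\<close>
  define F where "F = E + s + e"
  have F: "0 \<le> F" "E \<le> F" "E + s \<le> F" using E(1) e(1) s by (auto simp: F_def)
  have sub: "vec_subgroup S (rels Y)" by (rule rels_subgroup[OF Y])
  show ?thesis
  proof (intro exI[of _ "F + E"] conjI allI impI)
    show "0 \<le> F + E" using F E by simp
    fix A h
    assume A: "A \<in> sets M" "A \<subseteq> Y" and coord: "displacement_coordinates A s n \<pi> h"
    obtain Q where h: "\<forall>z\<in>space M. h z \<in> vbox S Q"
      using coord unfolding displacement_coordinates_def by blast
    have hm: "\<forall>v. {z \<in> space M. h z = v} \<in> sets M"
      using coord unfolding displacement_coordinates_def by blast
    define U where "U l = {z \<in> A. \<forall>j<n. (\<pi> j (h z) div m) mod N \<noteq> int l}" for l :: nat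
    have "good_cover A s n U (F + E)"
      unfolding good_cover_def
    proof (intro conjI allI ballI impI)
      show "0 \<le> F + E" using F E by simp
    next
      fix l :: nat assume "l \<le> n"
      let ?P = "\<lambda>v. \<forall>j<n. (\<pi> j v div m) mod N \<noteq> int l"
      have "U l = A \<inter> (\<Union>v\<in>{v \<in> vbox S Q. ?P v}. {z \<in> space M. h z = v})"
        using A Y h by (auto simp: U_def)
      also have "\<dots> \<in> sets M" using A(1) hm finite_vbox[OF finite_index, of Q] by (intro sets.Int sets.finite_UN) auto
      finally show "U l \<in> sets M" .
    next
      show "A \<subseteq> (\<Union>l\<le>n. U l)"
      proof
        fix z assume z: "z \<in> A"
        define G where "G = (\<lambda>j. nat ((\<pi> j (h z) div m) mod N)) ` {..<n}"
        have "card G \<le> n" unfolding G_def using card_image_le[of "{..<n}"] by (metis card_lessThan finite_lessThan)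
        moreover have "card {..n} = Suc n" by simp
        ultimately have "\<not> {..n} \<subseteq> G" using card_mono[of G "{..n}"] by (auto simp: G_def)
        then obtain l where l: "l \<le> n" "l \<notin> G" by auto
        have "(\<pi> j (h z) div m) mod N \<noteq> int l" if "j < n" for j
          using l(2) that by (auto simp: G_def image_iff) (metis lessThan_iff nat_int)
        then show "z \<in> (\<Union>l\<le>n. U l)" using z l(1) by (auto simp: U_def)
      qed
    next
      fix l :: nat and z0 z assume l: "l \<le> n" and z0: "z0 \<in> U l" and chain: "(z0, z) \<in> near_chain s (U l)"
      define I where "I z \<longleftrightarrow> (\<forall>j<n. (\<pi> j (h z) div m - int l) div N = (\<pi> j (h z0) div m - int l) div N) \<and>
        (\<exists>v\<in>vbox S E. \<exists>u\<in>vecs S. u - v \<in> rels Y \<and> (\<forall>j<n. \<pi> j u = \<pi> j (h z0) - \<pi> j (h z)) \<and>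
          T (cst S F) z0 = T (cst S F - v) z)" for z
      have "I z"
        using chain unfolding near_chain_def
      proof (induction rule: rtrancl_induct)
        case base
        show ?case
          unfolding I_def using sub E(1) additive_zero[OF add]
          by (intro conjI allI impI bexI[of _ 0]) (auto simp: vec_subgroup_def vbox_def vecs_closed)
      next
        case (step z z')
        then have zz: "z \<in> U l" "z' \<in> U l" "near s z z'" by auto
        then have zA: "z \<in> A" "z' \<in> A" "z \<in> Y" "z' \<in> Y" "z \<in> space M" "z' \<in> space M"
          using A Y by (auto simp: U_def)
        obtain a b where ab: "a \<in> nonneg S \<inter> vbox S s" "b \<in> nonneg S \<inter> vbox S s" "T a z = T b z'"
          using zz(3) unfolding near_def by blast
        have abv: "a \<in> vecs S" "b \<in> vecs S" using ab by (auto simp: nonneg_def)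
        have \<pi>ab: "\<pi> j (h z) + \<pi> j b = \<pi> j (h z') + \<pi> j a" if "j < n" for j
          using coord zA(1,2) ab that unfolding displacement_coordinates_def by blast
        have ab_box: "a - b \<in> vbox S s" by (rule nonneg_vbox_diff[OF ab(1,2)])
        from step.IH obtain v u where v: "v \<in> vbox S E" and u: "u \<in> vecs S" "u - v \<in> rels Y"
          "\<And>j. j < n \<Longrightarrow> \<pi> j u = \<pi> j (h z0) - \<pi> j (h z)" "T (cst S F) z0 = T (cst S F - v) z"
          and blk: "\<And>j. j < n \<Longrightarrow> (\<pi> j (h z) div m - int l) div N = (\<pi> j (h z0) div m - int l) div N"
          unfolding I_def by blast
        have blk': "(\<pi> j (h z') div m - int l) div N = (\<pi> j (h z0) div m - int l) div N" if j: "j < n" for j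
        proof -
          have "\<pi> j (h z) - \<pi> j (h z') = \<pi> j (a - b)"
            using \<pi>ab[OF j] additive_diff[OF add[OF j] abv] by simp
          then have "\<bar>\<pi> j (h z) - \<pi> j (h z')\<bar> < m" using K[OF ab_box j] by (simp add: m_def)
          then show ?thesis
            using same_block[OF m N, of "\<pi> j (h z)" "\<pi> j (h z')" "int l"] zz(1,2) j l blk[OF j] by (auto simp: U_def N_def)
        qed
        define u' where "u' = u + (a - b)"
        have u'v: "u' \<in> vecs S" using u(1) abv by (auto simp: u'_def intro!: vecs_closed)
        have \<pi>u': "\<pi> j u' = \<pi> j (h z0) - \<pi> j (h z')" if "j < n" for j
          using additive_add[OF add[OF that] u(1) vecs_closed(2)[OF abv]] additive_diff[OF add[OF that] abv]
            u(3)[OF that] \<pi>ab[OF that] by (simp add: u'_def)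
        \<comment> \<open>However long the chain, its displacement has the coordinates of a
          difference of two positions in one run of blocks; the frame turns this into a
          representative of fixed size.\<close>
        have "\<bar>\<pi> j u'\<bar> \<le> N * m" if "j < n" for j
          unfolding \<pi>u'[OF that] by (rule same_block_bound[OF m N, where l = "int l"]) (use blk'[OF that] in simp)
        then obtain v' where v': "v' \<in> vbox S D'" "u' - v' \<in> rels Y" using D'[OF u'v] by blast
        have v'E: "v' \<in> vbox S E" using E(2) v'(1) .
        define k where "k = v' - (v + (a - b))"
        have "k = (u - v) - (u' - v')" by (simp add: k_def u'_def algebra_simps)
        then have "k \<in> rels Y" using sub u(2) v'(2) by (auto simp: vec_subgroup_def)
        moreover have "k \<in> vbox S (E + (E + s))"
          using vbox_add[OF v'E vbox_minus[OF vbox_add[OF v ab_box]]] by (simp add: k_def algebra_simps)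
        ultimately have k: "k \<in> \<Lambda>" by (simp add: \<Lambda>_def)
        have nn: "cst S F - v - a \<in> nonneg S"
        proof -
          have "cst S F - v - a = cst S F + - (v + a)" by (simp add: algebra_simps)
          also have "\<dots> \<in> nonneg S"
            using vbox_minus[OF vbox_add[OF v, of a s]] ab(1) F by (intro cst_add_vbox_nonneg[of _ S "E + s"]) auto
          finally show ?thesis .
        qed
        have "T (cst S F) z0 = T ((cst S F - v - a) + a) z" using u(4) by simp
        also have "\<dots> = T (cst S F - v - a) (T b z')" using T_add[OF nn _ zA(5), of a] ab by simp
        also have "\<dots> = T ((cst S F - v - a) + b) z'" using T_add[OF nn _ zA(6), of b] ab by simp
        also have "(cst S F - v - a) + b = (cst S F - v') + k" by (simp add: k_def algebra_simps)
        also have "T ((cst S F - v') + k) z' = T (cst S F - v') z'"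
        proof -
          have "e \<le> (cst S F - v') i" if "i \<in> S" for i
            using vboxD(1)[OF v'E, of i] that s by (simp add: cst_def F_def)
          moreover have "cst S F - v' \<in> vecs S" using vboxD(2)[OF v'E] by (intro vecs_closed)
          ultimately show ?thesis using e(2) k zA(4) by blast
        qed
        finally show ?case unfolding I_def using blk' v'E u'v v'(2) E(2) \<pi>u' by blast
      qed
      then obtain v where v: "v \<in> vbox S E" "T (cst S F) z0 = T (cst S F - v) z" unfolding I_def by blast
      have "cst S F + 0 \<in> nonneg S \<inter> vbox S (F + E)"
        using cst_add_vbox_nonneg_vbox[of 0 S E F] F E by (auto simp: vbox_def vecs_def)
      moreover have "cst S F + - v \<in> nonneg S \<inter> vbox S (F + E)"
        using cst_add_vbox_nonneg_vbox[OF vbox_minus[OF v(1)]] F(2) by blast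
      ultimately show "near (F + E) z0 z" unfolding near_def using v(2) by (auto intro: bexI)
    qed
    then show "\<exists>U. good_cover A s n U (F + E)" by blast
  qed
qed

lemma rels_antimono: "Y' \<subseteq> Y \<Longrightarrow> rels Y \<subseteq> rels Y'"
  unfolding rels_def by blast

text \<open>Two routes from \<open>z'\<close> end at the same point: along \<open>b\<close> to
  \<open>T a z\<close> and then along \<open>h\<close>, or along \<open>h'\<close> to the common
  image and then along \<open>a\<close>. Their difference is a relation at
  \<open>z'\<close>.\<close>

lemma near_relation:
  assumes z: "z \<in> space M" "z' \<in> space M" and h: "h \<in> nonneg S \<inter> vbox S Q" "h' \<in> nonneg S \<inter> vbox S Q"
    and ab: "a \<in> nonneg S \<inter> vbox S r" "b \<in> nonneg S \<inter> vbox S r" "T a z = T b z'" and eq: "T h z = T h' z'"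
  shows "T (cst S (Q + r) + ((h + b) - (h' + a))) z' = T (cst S (Q + r)) z'" "(h + b) - (h' + a) \<in> vbox S (Q + r)"
proof -
  have hb: "h + b \<in> nonneg S \<inter> vbox S (Q + r)" and ha: "h' + a \<in> nonneg S \<inter> vbox S (Q + r)"
    using h ab by (auto intro: nonneg_add vbox_add)
  show "(h + b) - (h' + a) \<in> vbox S (Q + r)" by (rule nonneg_vbox_diff[OF hb ha])
  have "T (h + b) z' = T h (T a z)" using T_add[of h b z'] h ab z by simp
  also have "\<dots> = T a (T h z)" using T_add[of h a z] T_add[of a h z] h ab z by (simp add: add.commute)
  also have "\<dots> = T (h' + a) z'" using T_add[of a h' z'] h ab z eq by (simp add: add.commute)
  finally have *: "T (h + b) z' = T (h' + a) z'" .
  define d where "d = cst S (Q + r) - (h' + a)"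
  have "d = cst S (Q + r) + - (h' + a)" by (simp add: d_def)
  also have "\<dots> \<in> nonneg S" using ha by (intro cst_add_vbox_nonneg[OF vbox_minus]) auto
  finally have "d \<in> nonneg S" .
  then have "T (d + (h + b)) z' = T (d + (h' + a)) z'" using * hb ha z by (intro T_eq_shift) auto
  moreover have "d + (h + b) = cst S (Q + r) + ((h + b) - (h' + a))" "d + (h' + a) = cst S (Q + r)"
    by (simp_all add: d_def algebra_simps)
  ultimately show "T (cst S (Q + r) + ((h + b) - (h' + a))) z' = T (cst S (Q + r)) z'" by simp
qed

text \<open>The points of \<open>Y\<close> satisfying no new relation of length \<open>W\<close> carry displacement coordinates on each
  of the \<open>4 ^ card S\<close> pieces; the scale \<open>\<rho>\<close> of the pieces is fixed in advance by the scales \<open>sc i\<close> at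
  which these are merged, and \<open>W\<close> depends on \<open>\<rho>\<close> only.\<close>

lemma bdim_le_step:
  assumes Y: "Y \<in> sets M" and fr: "frame S (rels Y) n \<pi>"
    and smaller: "\<And>Y' \<eta> j. Y' \<in> sets M \<Longrightarrow> Y' \<subseteq> Y \<Longrightarrow> \<eta> \<in> rels Y' \<Longrightarrow> j < n \<Longrightarrow> \<pi> j \<eta> \<noteq> 0 \<Longrightarrow> bdim_le Y' n"
  shows "bdim_le Y n"
  unfolding bdim_le_def
proof (intro allI impI)
  fix r :: int assume r: "0 \<le> r"
  have YM: "Y \<subseteq> space M" using sets.sets_into_space[OF Y] .
  have add: "additive S (\<pi> j)" if "j < n" for j using fr that by (auto simp: frame_def)
  \<comment> \<open>One bound serves all sets \<open>A\<close> and all coordinate functions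
    \<open>h\<close> at once. This uniformity is essential, because the \<open>h\<close> used below
    are built for a scale computed from these very bounds.\<close>
  define ctrl where "ctrl s D \<longleftrightarrow> 0 \<le> D \<and>
    (\<forall>A h. A \<in> sets M \<longrightarrow> A \<subseteq> Y \<longrightarrow> displacement_coordinates A s n \<pi> h \<longrightarrow> (\<exists>U. good_cover A s n U D))" for s D
  have "\<exists>D. ctrl (max s 0) D" for s
    using good_cover_coordinates[OF YM fr, of "max s 0"] unfolding ctrl_def by auto
  then obtain D where D: "\<And>s. ctrl (max s 0) (D s)" by metis
  have D0: "0 \<le> D s" for s using D[of s] by (simp add: ctrl_def)
  define C :: nat where "C = 4 ^ card S"
  define sc where "sc i = union_bound D r i + 2 * r" for i
  have sc0: "0 \<le> sc i" for i unfolding sc_def using union_bound_nonneg[of D, OF D0 r] r by (intro add_nonneg_nonneg) auto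
  define \<rho> where "\<rho> = (\<Sum>i<C. sc i)"
  have \<rho>: "0 \<le> \<rho>" "\<And>i. i < C \<Longrightarrow> sc i \<le> \<rho>"
    unfolding \<rho>_def using sc0 by (auto intro: sum_nonneg member_le_sum)
  obtain V h Q where V: "0 \<le> Q" "\<forall>i<C. V i \<in> sets M" "space M \<subseteq> (\<Union>i<C. V i)"
    and h': "\<forall>i<C. \<forall>z\<in>space M. h i z \<in> nonneg S \<inter> vbox S Q"
    "\<forall>i<C. \<forall>v. {z \<in> space M. h i z = v} \<in> sets M"
    "\<forall>i<C. \<forall>z\<in>V i. \<forall>z'\<in>V i. near \<rho> z z' \<longrightarrow> T (h i z) z = T (h i z') z'"
    using finitely_many_bounded_pieces[OF \<rho>(1), folded C_def] by (elim exE conjE) (rule that; assumption)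
  have h: "\<And>i z. i < C \<Longrightarrow> z \<in> space M \<Longrightarrow> h i z \<in> nonneg S \<inter> vbox S Q"
    "\<And>i v. i < C \<Longrightarrow> {z \<in> space M. h i z = v} \<in> sets M"
    "\<And>i z z'. i < C \<Longrightarrow> z \<in> V i \<Longrightarrow> z' \<in> V i \<Longrightarrow> near \<rho> z z' \<Longrightarrow> T (h i z) z = T (h i z') z'"
    using h' by blast+
  define W where "W = Q + \<rho>"
  have W: "0 \<le> W" using V(1) \<rho>(1) by (simp add: W_def)
  \<comment> \<open>Only relations with some nonzero coordinate count as new: on their solution sets
    the hypothesis \<open>smaller\<close> applies, while relations annihilated by all coordinates do
    not disturb positions.\<close>
  define B where "B = {\<eta> \<in> vbox S W. \<exists>j<n. \<pi> j \<eta> \<noteq> 0}"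
  have finB: "finite B" using finite_vbox[OF finite_index, of W] by (simp add: B_def)
  define X where "X \<eta> = {x \<in> Y. T (cst S W + \<eta>) x = T (cst S W) x}" for \<eta>
  have cW: "cst S W \<in> nonneg S" using cst_nonneg[OF W] .
  have \<eta>nn: "cst S W + \<eta> \<in> nonneg S" if "\<eta> \<in> B" for \<eta> using that cst_add_vbox_nonneg by (auto simp: B_def)
  have X_sets: "X \<eta> \<in> sets M" if "\<eta> \<in> B" for \<eta>
  proof -
    have "X \<eta> = Y \<inter> {x \<in> space M. T (cst S W + \<eta>) x = T (cst S W) x}" using YM by (auto simp: X_def)
    then show ?thesis
      using Y standard_borel_eq_sets[OF standard_borel T_measurable[OF \<eta>nn[OF that]] T_measurable[OF cW]] by auto
  qed
  have X_dim: "bdim_le (X \<eta>) n" if "\<eta> \<in> B" for \<eta>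
  proof -
    obtain j where j: "j < n" "\<pi> j \<eta> \<noteq> 0" using \<open>\<eta> \<in> B\<close> unfolding B_def by blast
    have "\<eta> \<in> rels (X \<eta>)"
      unfolding rels_def using \<open>\<eta> \<in> B\<close> cW \<eta>nn[OF \<open>\<eta> \<in> B\<close>] by (auto simp: B_def X_def vbox_def)
    from smaller[OF X_sets[OF \<open>\<eta> \<in> B\<close>] _ this j] show ?thesis by (auto simp: X_def)
  qed
  define Z where "Z = Y - (\<Union>\<eta>\<in>B. X \<eta>)"
  have Z_sets: "Z \<in> sets M" unfolding Z_def using Y X_sets finB by (intro sets.Diff sets.finite_UN) auto
  have "\<exists>U. good_cover (Z \<inter> V i) (sc i) n U (D (sc i))" if i: "i < C" for i
  proof -
    have c1: "ctrl (sc i) (D (sc i))" using D[of "sc i"] sc0[of i] by simp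
    have c2: "Z \<inter> V i \<in> sets M" "Z \<inter> V i \<subseteq> Y" using Z_sets V(2) i by (auto simp: Z_def)
    have c3: "\<forall>z\<in>space M. h i z \<in> vbox S Q" using h(1)[OF i] by blast
    have c4: "\<forall>v. {z \<in> space M. h i z = v} \<in> sets M" using h(2)[OF i] by blast
    have "\<pi> j (h i z) + \<pi> j b = \<pi> j (h i z') + \<pi> j a"
      if z: "z \<in> Z \<inter> V i" "z' \<in> Z \<inter> V i" and ab: "a \<in> nonneg S \<inter> vbox S (sc i)" "b \<in> nonneg S \<inter> vbox S (sc i)"
        "T a z = T b z'" and j: "j < n" for z z' a b j
    proof -
      have ab': "a \<in> nonneg S \<inter> vbox S \<rho>" "b \<in> nonneg S \<inter> vbox S \<rho>"
        using ab(1,2) vbox_mono[OF _ \<rho>(2)[OF i]] by auto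
      have zs: "z \<in> space M" "z' \<in> space M" using z YM by (auto simp: Z_def)
      have nr: "near \<rho> z z'" unfolding near_def using ab' ab(3) by blast
      have eq: "T (h i z) z = T (h i z') z'" using h(3)[OF i _ _ nr] z by blast
      \<comment> \<open>The discrepancy to be ruled out. It is a relation at \<open>z'\<close> of
        length at most \<open>W\<close>, so outside the sets \<open>X\<close> all its coordinates
        vanish, which is the displacement identity.\<close>
      let ?\<eta> = "(h i z + b) - (h i z' + a)"
      note rel = near_relation[OF zs h(1)[OF i zs(1)] h(1)[OF i zs(2)] ab' ab(3) eq, folded W_def]
      have "?\<eta> \<notin> B"
      proof
        assume "?\<eta> \<in> B"
        moreover have "z' \<in> X ?\<eta>" using rel(1) z(2) by (simp add: X_def Z_def)
        ultimately show False using z(2) by (auto simp: Z_def)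
      qed
      then have "\<pi> j ?\<eta> = 0" using rel(2) j unfolding B_def by blast
      moreover have vs: "h i z \<in> vecs S" "h i z' \<in> vecs S" "a \<in> vecs S" "b \<in> vecs S"
        using h(1)[OF i] zs ab by (auto simp: nonneg_def)
      ultimately show ?thesis
        using additive_diff[OF add[OF j] vecs_closed(1)[OF vs(1,4)] vecs_closed(1)[OF vs(2,3)]]
          additive_add[OF add[OF j] vs(1,4)] additive_add[OF add[OF j] vs(2,3)] by simp
    qed
    then have c5: "\<forall>z\<in>Z \<inter> V i. \<forall>z'\<in>Z \<inter> V i. \<forall>a\<in>nonneg S \<inter> vbox S (sc i). \<forall>b\<in>nonneg S \<inter> vbox S (sc i).
        T a z = T b z' \<longrightarrow> (\<forall>j<n. \<pi> j (h i z) + \<pi> j b = \<pi> j (h i z') + \<pi> j a)"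
      by (intro ballI allI impI)
    have "displacement_coordinates (Z \<inter> V i) (sc i) n \<pi> (h i)"
      unfolding displacement_coordinates_def by (intro conjI exI[of _ Q] c3 c4 c5)
    then show ?thesis using c1 c2 unfolding ctrl_def by blast
  qed
  then have "\<exists>U. good_cover (\<Union>i<C. Z \<inter> V i) r n U (union_bound D r C)"
    unfolding sc_def by (intro good_cover_UN_controlled[OF r D0]) blast
  moreover have "(\<Union>i<C. Z \<inter> V i) = Z" using V(3) YM by (auto simp: Z_def)
  ultimately obtain U where U: "good_cover Z r n U (union_bound D r C)" by auto
  \<comment> \<open>The bound for this last part depends on \<open>W\<close> and hence on \<rho>,
    which is harmless because nothing is merged after it.\<close>
  have "0 \<le> union_bound D r C + 2 * r" using U r by (simp add: good_cover_def)
  moreover have "bdim_le (\<Union>\<eta>\<in>B. X \<eta>) n" by (rule bdim_le_UN[OF finB]) (rule X_dim)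
  ultimately obtain U' R' where U': "good_cover (\<Union>\<eta>\<in>B. X \<eta>) (union_bound D r C + 2 * r) n U' R'"
    unfolding bdim_le_def by blast
  have "Z \<union> (\<Union>\<eta>\<in>B. X \<eta>) = Y" by (auto simp: Z_def X_def)
  then show "\<exists>U R. good_cover Y r n U R" using good_cover_Un[OF U U' r] by auto
qed

text \<open>For \<open>n = 0\<close> there is no coordinate on which a relation could be nonzero, so
  the condition of \<open>bdim_le_step\<close> is vacuous. Otherwise a new relation with nonzero
  coordinate \<open>j\<close> eliminates that coordinate on \<open>Y'\<close>.\<close>

theorem bdim_le_frame:
  "Y \<in> sets M \<Longrightarrow> frame S (rels Y) n \<pi> \<Longrightarrow> bdim_le Y n"
proof (induction n arbitrary: Y \<pi>)
  case (0 Y \<pi>)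
  then show ?case by (rule bdim_le_step) simp
next
  case (Suc n Y \<pi>)
  show ?case
  proof (rule bdim_le_step[OF Suc.prems])
    fix Y' \<eta> j assume Y': "Y' \<in> sets M" "Y' \<subseteq> Y" "\<eta> \<in> rels Y'" "j < Suc n" "\<pi> j \<eta> \<noteq> 0"
    obtain \<pi>' where "frame S (rels Y') n \<pi>'"
      using frame_eliminate[OF Suc.prems(2) rels_antimono[OF Y'(2)] rels_subgroup Y'(3) _ Y'(5)]
        sets.sets_into_space[OF Y'(1)] Y'(4) by auto
    then show "bdim_le Y' (Suc n)" using Suc.IH[OF Y'(1)] bdim_le_Suc by blast
  qed
qed

end

section \<open>The rank of a commutative monoid\<close>

text \<open>Fraction-free elimination: the last equation expresses unknown \<open>k\<close> through
  the others once these are scaled by its coefficient.\<close>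

lemma integer_kernel_vector:
  fixes a :: "nat \<Rightarrow> 'j \<Rightarrow> int"
  assumes "finite J" "n < card J"
  shows "\<exists>c. (\<exists>j\<in>J. c j \<noteq> 0) \<and> (\<forall>i<n. (\<Sum>j\<in>J. a i j * c j) = 0)"
  using assms
proof (induction n arbitrary: J a)
  case 0
  then have "J \<noteq> {}" by auto
  then show ?case by (intro exI[of _ "\<lambda>_. 1"]) auto
next
  case (Suc n)
  show ?case
  proof (cases "\<forall>j\<in>J. a n j = 0")
    case True
    obtain c where "\<exists>j\<in>J. c j \<noteq> 0" "\<forall>i<n. (\<Sum>j\<in>J. a i j * c j) = 0"
      using Suc.IH[OF Suc.prems(1), of a] Suc.prems(2) by auto
    then show ?thesis using True by (auto simp: less_Suc_eq intro!: exI[of _ c])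
  next
    case False
    then obtain k where k: "k \<in> J" "a n k \<noteq> 0" by blast
    define K where "K = J - {k}"
    have K: "finite K" "n < card K" "J = insert k K" "k \<notin> K"
      using Suc.prems k(1) by (auto simp: K_def)
    obtain c where c: "\<exists>j\<in>K. c j \<noteq> 0"
      "\<forall>i<n. (\<Sum>j\<in>K. (a n k * a i j - a n j * a i k) * c j) = 0"
      using Suc.IH[OF K(1,2), of "\<lambda>i j. a n k * a i j - a n j * a i k"] by auto
    define d where "d j = (if j = k then - (\<Sum>j\<in>K. a n j * c j) else a n k * c j)" for j
    have sum_d: "(\<Sum>j\<in>J. a i j * d j) = (\<Sum>j\<in>K. (a n k * a i j - a n j * a i k) * c j)" for i
    proof -
      have "(\<Sum>j\<in>J. a i j * d j) = a i k * d k + (\<Sum>j\<in>K. a i j * d j)" using K by simp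
      also have "(\<Sum>j\<in>K. a i j * d j) = (\<Sum>j\<in>K. a i j * (a n k * c j))"
        using K(4) by (intro sum.cong) (auto simp: d_def)
      also have "a i k * d k = (\<Sum>j\<in>K. - (a i k * (a n j * c j)))"
        by (simp add: d_def sum_distrib_left sum_negf)
      finally show ?thesis by (simp add: sum.distrib[symmetric] algebra_simps)
    qed
    have "\<exists>j\<in>J. d j \<noteq> 0" using c(1) k(2) K(3,4) by (auto simp: d_def)
    moreover have "(\<Sum>j\<in>J. a i j * d j) = 0" if "i < Suc n" for i
    proof (cases "i = n")
      case True
      then show ?thesis unfolding sum_d by (simp add: mult.commute)
    next
      case False
      then show ?thesis unfolding sum_d using c(2) that by simp
    qed
    ultimately show ?thesis by blast
  qed
qed

section \<open>Splitting a commutative group into a lattice and a kernel\<close>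

definition int_hom :: "('g, 'c) monoid_scheme \<Rightarrow> ('g \<Rightarrow> int) \<Rightarrow> bool" where
  "int_hom G p \<longleftrightarrow> (\<forall>x\<in>carrier G. \<forall>y\<in>carrier G. p (x \<otimes>\<^bsub>G\<^esub> y) = p x + p y)"

definition common_kernel :: "('g, 'c) monoid_scheme \<Rightarrow> nat \<Rightarrow> (nat \<Rightarrow> 'g \<Rightarrow> int) \<Rightarrow> 'g set" where
  "common_kernel G n p = {g \<in> carrier G. \<forall>i<n. p i g = 0}"

text \<open>The \<open>t j\<close> split the homomorphism to \<open>\<int>\<^sup>n\<close> given by
  the \<open>p i\<close>, so the group is the product of the common kernel and a free part of rank
  \<open>n\<close>.\<close>

definition dual_system :: "('g, 'c) monoid_scheme \<Rightarrow> nat \<Rightarrow> (nat \<Rightarrow> 'g \<Rightarrow> int) \<Rightarrow> (nat \<Rightarrow> 'g) \<Rightarrow> bool" where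
  "dual_system G n p t \<longleftrightarrow> (\<forall>i<n. int_hom G (p i) \<and> t i \<in> carrier G) \<and>
     (\<forall>i<n. \<forall>j<n. p i (t j) = (if i = j then 1 else 0))"

context comm_group
begin

lemma int_hom_mult: "int_hom G p \<Longrightarrow> x \<in> carrier G \<Longrightarrow> y \<in> carrier G \<Longrightarrow> p (x \<otimes> y) = p x + p y"
  by (simp add: int_hom_def)

lemma int_hom_one: "int_hom G p \<Longrightarrow> p \<one> = 0"
  using int_hom_mult[of p \<one> \<one>] by simp

lemma int_hom_inv: "int_hom G p \<Longrightarrow> x \<in> carrier G \<Longrightarrow> p (inv x) = - p x"
  using int_hom_mult[of p x "inv x"] int_hom_one[of p] by simp

lemma int_hom_nat_pow: "int_hom G p \<Longrightarrow> x \<in> carrier G \<Longrightarrow> p (x [^] (k::nat)) = int k * p x"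
  by (induction k) (simp_all add: int_hom_one int_hom_mult algebra_simps)

lemma int_hom_int_pow: "int_hom G p \<Longrightarrow> x \<in> carrier G \<Longrightarrow> p (x [^] (k::int)) = k * p x"
proof (cases k rule: int_cases2)
  case (nonneg n)
  assume "int_hom G p" "x \<in> carrier G"
  then show ?thesis unfolding nonneg int_pow_int by (rule int_hom_nat_pow)
next
  case (nonpos n)
  assume p: "int_hom G p" "x \<in> carrier G"
  have "p (inv (x [^] n)) = - p (x [^] n)" by (rule int_hom_inv[OF p(1)]) (use p(2) in simp)
  then show ?thesis unfolding nonpos int_pow_neg_int[OF p(2)] int_hom_nat_pow[OF p] by simp
qed

lemma int_hom_finprod:
  assumes p: "int_hom G p" and "finite A" "f \<in> A \<rightarrow> carrier G"
  shows "p (finprod G f A) = (\<Sum>i\<in>A. p (f i))"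
  using assms(2,3)
proof (induction A rule: finite_induct)
  case empty
  then show ?case by (simp add: int_hom_one[OF p])
next
  case (insert x A)
  then have f: "f \<in> A \<rightarrow> carrier G" "f x \<in> carrier G" by auto
  then show ?case using insert by (simp add: int_hom_mult[OF p] finprod_closed[OF f(1)])
qed

definition combination :: "nat \<Rightarrow> (nat \<Rightarrow> 'a) \<Rightarrow> (nat \<Rightarrow> int) \<Rightarrow> 'a" where
  "combination n t c = finprod G (\<lambda>i. t i [^] c i) {..<n}"

lemma combination_closed: "(\<And>i. i < n \<Longrightarrow> t i \<in> carrier G) \<Longrightarrow> combination n t c \<in> carrier G"
  unfolding combination_def by (intro finprod_closed) auto

lemma int_hom_combination:
  "int_hom G p \<Longrightarrow> (\<And>i. i < n \<Longrightarrow> t i \<in> carrier G) \<Longrightarrow> p (combination n t c) = (\<Sum>i<n. c i * p (t i))"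
  unfolding combination_def by (subst int_hom_finprod) (auto simp: int_hom_int_pow)

lemma combination_add:
  assumes "\<And>i. i < n \<Longrightarrow> t i \<in> carrier G"
  shows "combination n t (\<lambda>i. c i + d i) = combination n t c \<otimes> combination n t d"
proof -
  have "combination n t (\<lambda>i. c i + d i) = finprod G (\<lambda>i. t i [^] c i \<otimes> t i [^] d i) {..<n}"
    unfolding combination_def using assms by (intro finprod_cong') (auto simp: int_pow_mult)
  then show ?thesis unfolding combination_def using assms by (simp add: finprod_multf Pi_iff)
qed

lemma combination_cong: "(\<And>i. i < n \<Longrightarrow> t i \<in> carrier G) \<Longrightarrow> (\<And>i. i < n \<Longrightarrow> c i = d i) \<Longrightarrow> combination n t c = combination n t d"
  unfolding combination_def by (intro finprod_cong') auto

lemma dual_systemD: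
  assumes "dual_system G n p t"
  shows "i < n \<Longrightarrow> int_hom G (p i)" "i < n \<Longrightarrow> t i \<in> carrier G"
    "i < n \<Longrightarrow> p i (combination n t c) = c i"
proof -
  show h: "i < n \<Longrightarrow> int_hom G (p i)" and t: "\<And>i. i < n \<Longrightarrow> t i \<in> carrier G" for i
    using assms by (auto simp: dual_system_def)
  assume i: "i < n"
  have "p i (combination n t c) = (\<Sum>j<n. c j * p i (t j))" by (rule int_hom_combination[OF h[OF i] t])
  also have "\<dots> = (\<Sum>j<n. if j = i then c j else 0)"
    using assms i by (intro sum.cong) (auto simp: dual_system_def)
  also have "\<dots> = c i" using i by simp
  finally show "p i (combination n t c) = c i" .
qed

definition residual :: "nat \<Rightarrow> (nat \<Rightarrow> 'a \<Rightarrow> int) \<Rightarrow> (nat \<Rightarrow> 'a) \<Rightarrow> 'a \<Rightarrow> 'a" where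
  "residual n p t g = g \<otimes> inv (combination n t (\<lambda>i. p i g))"

lemma residual:
  assumes d: "dual_system G n p t" and g: "g \<in> carrier G"
  shows "residual n p t g \<in> common_kernel G n p" "g = residual n p t g \<otimes> combination n t (\<lambda>i. p i g)"
proof -
  have c: "combination n t c \<in> carrier G" for c using combination_closed dual_systemD(2)[OF d] by blast
  have "p i (residual n p t g) = 0" if "i < n" for i
    using int_hom_mult[OF dual_systemD(1)[OF d that]] int_hom_inv[OF dual_systemD(1)[OF d that]] g c
      dual_systemD(3)[OF d that] by (simp add: residual_def)
  then show "residual n p t g \<in> common_kernel G n p" using g c by (simp add: common_kernel_def residual_def)
  show "g = residual n p t g \<otimes> combination n t (\<lambda>i. p i g)"
    using g c by (simp add: residual_def m_assoc)
qed

lemma common_kernel_closed: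
  assumes "\<forall>i<n. int_hom G (p i)"
  shows "x \<in> common_kernel G n p \<Longrightarrow> y \<in> common_kernel G n p \<Longrightarrow> x \<otimes> y \<in> common_kernel G n p"
    and "x \<in> common_kernel G n p \<Longrightarrow> inv x \<in> common_kernel G n p"
    and "\<one> \<in> common_kernel G n p"
    and "x \<in> common_kernel G n p \<Longrightarrow> x [^] (k::int) \<in> common_kernel G n p"
  using int_hom_mult[OF assms[rule_format]] int_hom_inv[OF assms[rule_format]]
    int_hom_one[OF assms[rule_format]] int_hom_int_pow[OF assms[rule_format]]
  by (auto simp: common_kernel_def)

text \<open>Homomorphisms are added one at a time. On the kernel of those already treated, the new
  one takes the multiples of its least positive value \<open>e\<close>, attained at
  \<open>u\<close>. Corrected by the earlier coordinates it vanishes on the old \<open>t i\<close>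
  and is divisible by \<open>e\<close> everywhere; the quotient by \<open>e\<close> extends the
  system, with \<open>u\<close> as new dual element.\<close>

lemma dual_system_exists:
  assumes "\<And>i. i < N \<Longrightarrow> int_hom G (q i)"
  shows "\<exists>n p t. dual_system G n p t \<and> common_kernel G n p \<subseteq> common_kernel G N q"
  using assms
proof (induction N)
  case 0
  have "dual_system G 0 p t \<and> common_kernel G 0 p \<subseteq> common_kernel G 0 q" for p t
    by (auto simp: dual_system_def common_kernel_def)
  then show ?case by blast
next
  case (Suc N)
  then obtain n p t where d: "dual_system G n p t" and sub: "common_kernel G n p \<subseteq> common_kernel G N q" by fastforce
  let ?K = "common_kernel G n p"
  have hp: "\<And>i. i < n \<Longrightarrow> int_hom G (p i)" and tc: "\<And>i. i < n \<Longrightarrow> t i \<in> carrier G" using dual_systemD[OF d] by auto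
  have hq: "int_hom G (q N)" using Suc.prems by simp
  have "\<forall>i<n. int_hom G (p i)" using hp by blast
  note K = common_kernel_closed[OF this]
  show ?case
  proof (cases "\<forall>g\<in>?K. q N g = 0")
    case True
    then have "?K \<subseteq> common_kernel G (Suc N) q"
      using sub by (auto simp: common_kernel_def less_Suc_eq)
    then show ?thesis using d by blast
  next
    case False
    have "\<exists>m g. g \<in> ?K \<and> q N g = int (Suc m)"
    proof -
      obtain g where g: "g \<in> ?K" "q N g \<noteq> 0" using False by blast
      have "q N (inv g) = - q N g" using g int_hom_inv[OF hq] by (simp add: common_kernel_def)
      then obtain h where h: "h \<in> ?K" "q N h > 0"
        using g K(2)[OF g(1)] by (cases "q N g > 0") auto
      then show ?thesis by (intro exI[of _ "nat (q N h) - 1"] exI[of _ h]) auto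
    qed
    then have ex: "\<exists>g. g \<in> ?K \<and> q N g = int (Suc (LEAST m. \<exists>g. g \<in> ?K \<and> q N g = int (Suc m)))"
      by (rule LeastI_ex)
    define m where "m = (LEAST m. \<exists>g. g \<in> ?K \<and> q N g = int (Suc m))"
    obtain u where u: "u \<in> ?K" "q N u = int (Suc m)" using ex unfolding m_def by blast
    have uc: "u \<in> carrier G" using u by (simp add: common_kernel_def)
    define e where "e = int (Suc m)"
    have e: "0 < e" by (simp add: e_def)
    have ue: "q N u = e" using u(2) by (simp only: e_def)
    \<comment> \<open>Division with remainder inside the kernel: a nonzero remainder would be a
      smaller positive value.\<close>
    have dvd: "e dvd q N g" if g: "g \<in> ?K" for g
    proof -
      have gc: "g \<in> carrier G" using g by (simp add: common_kernel_def)
      define h where "h = g \<otimes> u [^] (- (q N g div e))"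
      have hK: "h \<in> ?K" unfolding h_def using K(1)[OF g K(4)[OF u(1)]] .
      have "q N h = q N g mod e"
        using int_hom_mult[OF hq gc, of "u [^] (- (q N g div e))"] int_hom_int_pow[OF hq uc] uc ue
        by (simp add: h_def minus_div_mult_eq_mod)
      moreover have "q N g mod e < e" "0 \<le> q N g mod e" using e by simp_all
      ultimately have "\<not> 0 < q N h"
      proof -
        assume a: "q N h = q N g mod e" "q N g mod e < e" "0 \<le> q N g mod e"
        show ?thesis
        proof
          assume pos: "0 < q N h"
          then have "\<exists>g. g \<in> ?K \<and> q N g = int (Suc (nat (q N h) - 1))" using hK by auto
          then have "m \<le> nat (q N h) - 1" unfolding m_def by (rule Least_le)
          then have "e \<le> q N h" using pos unfolding e_def by linarith
          then show False using a by linarith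
        qed
      qed
      then have "q N g mod e = 0" using \<open>q N h = q N g mod e\<close> e by (metis not_less pos_mod_sign order_antisym)
      then show ?thesis by presburger
    qed
    \<comment> \<open>The value of \<open>q N\<close> on the residual of \<open>g\<close>, written
      so that additivity is visible.\<close>
    define \<theta> where "\<theta> g = q N g - (\<Sum>i<n. p i g * q N (t i))" for g
    have \<theta>r: "\<theta> g = q N (residual n p t g)" if g: "g \<in> carrier G" for g
    proof -
      have "q N g = q N (residual n p t g) + q N (combination n t (\<lambda>i. p i g))"
      proof -
        have "residual n p t g \<in> carrier G" using residual(1)[OF d g] by (simp add: common_kernel_def)
        from int_hom_mult[OF hq this combination_closed[OF tc]]
        show ?thesis using arg_cong[OF residual(2)[OF d g], of "q N"] by simp
      qed
      then show ?thesis using int_hom_combination[of "q N" n t "\<lambda>i. p i g", OF hq tc] by (simp add: \<theta>_def)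
    qed
    have \<theta>dvd: "e dvd \<theta> g" if "g \<in> carrier G" for g using \<theta>r[OF that] dvd residual(1)[OF d that] by simp
    have \<theta>hom: "int_hom G \<theta>"
      unfolding int_hom_def \<theta>_def using int_hom_mult[OF hq] int_hom_mult[OF hp]
      by (auto simp: sum.distrib[symmetric] algebra_simps)
    have \<theta>K: "\<theta> g = q N g" if "g \<in> ?K" for g using that by (simp add: \<theta>_def common_kernel_def)
    define p' where "p' = p(n := \<lambda>g. \<theta> g div e)"
    define t' where "t' = t(n := u)"
    have "dual_system G (Suc n) p' t'"
      unfolding dual_system_def
    proof (intro conjI allI impI)
      fix i assume i: "i < Suc n"
      show "int_hom G (p' i)"
        using i hp[of i] \<theta>hom \<theta>dvd by (auto simp: p'_def less_Suc_eq int_hom_def)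
      show "t' i \<in> carrier G" using i tc uc by (auto simp: t'_def less_Suc_eq)
    next
      fix i j assume ij: "i < Suc n" "j < Suc n"
      have pp: "p i (t j) = (if i = j then 1 else 0)" if "i < n" "j < n" for i j
        using d that by (auto simp: dual_system_def)
      have "\<theta> (t j) = 0" if "j < n"
      proof -
        have "(\<Sum>i<n. p i (t j) * q N (t i)) = (\<Sum>i<n. if i = j then q N (t i) else 0)"
          using pp that by (intro sum.cong) auto
        then show ?thesis using that by (simp add: \<theta>_def)
      qed
      moreover have "\<theta> u = e" using \<theta>K[OF u(1)] ue by simp
      moreover have "p i u = 0" if "i < n" using u(1) that by (simp add: common_kernel_def)
      ultimately show "p' i (t' j) = (if i = j then 1 else 0)"
        using ij pp e by (auto simp: p'_def t'_def less_Suc_eq)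
    qed
    moreover have "common_kernel G (Suc n) p' \<subseteq> common_kernel G (Suc N) q"
    proof
      fix g assume g: "g \<in> common_kernel G (Suc n) p'"
      then have gc: "g \<in> carrier G" and z: "\<And>i. i < Suc n \<Longrightarrow> p' i g = 0" by (auto simp: common_kernel_def)
      have "p i g = 0" if "i < n" for i using z[of i] that by (simp add: p'_def)
      then have gK: "g \<in> ?K" using gc by (simp add: common_kernel_def)
      have "\<theta> g div e = 0" using z[of n] by (simp add: p'_def)
      moreover have "\<theta> g = \<theta> g div e * e" using \<theta>dvd[OF gc] by simp
      ultimately have "q N g = 0" using \<theta>K[OF gK] by simp
      then show "g \<in> common_kernel G (Suc N) q" using sub gK by (auto simp: common_kernel_def less_Suc_eq)
    qed
    ultimately show ?thesis by blast
  qed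
qed

text \<open>If \<open>m > n\<close>, a nontrivial integer combination of the \<open>t'\<close> is
  annihilated by all \<open>p i\<close>. Some \<open>p'\<close> distinguishes its powers, so the
  kernel of \<open>p\<close> would be infinite. Used in both directions, this makes the rank
  unique.\<close>

lemma dual_system_size_le:
  assumes d: "dual_system G n p t" "finite (common_kernel G n p)" and d': "dual_system G m p' t'"
  shows "m \<le> n"
proof (rule ccontr)
  assume "\<not> m \<le> n"
  then have "n < card {..<m}" by simp
  from integer_kernel_vector[OF _ this, of "\<lambda>i j. p i (t' j)"]
  obtain c where c: "\<exists>j<m. c j \<noteq> 0" "\<And>i. i < n \<Longrightarrow> (\<Sum>j<m. p i (t' j) * c j) = 0" by auto
  let ?v = "combination m t' c"
  have v: "?v \<in> carrier G" using combination_closed dual_systemD(2)[OF d'] by blast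
  have vK: "?v [^] (k::int) \<in> common_kernel G n p" for k
  proof -
    have "p i ?v = 0" if "i < n" for i
      using int_hom_combination[where n = m and t = t' and c = c, OF dual_systemD(1)[OF d(1) that] dual_systemD(2)[OF d']] c(2)[OF that]
      by (simp add: mult.commute)
    then have "?v \<in> common_kernel G n p" using v by (simp add: common_kernel_def)
    then show ?thesis using common_kernel_closed(4)[of n p] dual_systemD(1)[OF d(1)] by blast
  qed
  obtain j where j: "j < m" "c j \<noteq> 0" using c(1) by blast
  have "inj (\<lambda>k::int. ?v [^] k)"
  proof (rule injI)
    fix k l :: int assume "?v [^] k = ?v [^] l"
    then have "p' j (?v [^] k) = p' j (?v [^] l)" by simp
    then show "k = l"
      using int_hom_int_pow[OF dual_systemD(1)[OF d' j(1)] v] dual_systemD(3)[OF d' j(1)] j(2) by simp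
  qed
  moreover have "finite (range (\<lambda>k::int. ?v [^] k))" using vK d(2) finite_subset by (metis image_subsetI)
  ultimately have "finite (UNIV :: int set)" by (rule finite_imageD[rotated])
  then show False by simp
qed

text \<open>The isomorphism pairs the coordinates of an element with its residual; the finite kernel
  is renumbered by \<beta> to live on natural numbers.\<close>

lemma iso_of_dual_system:
  assumes d: "dual_system G n p t" and fin: "finite (common_kernel G n p)"
  shows "\<exists>T :: nat monoid. comm_group T \<and> finite (carrier T) \<and>
    G \<cong> product_group {..<n} (\<lambda>_. integer_group) \<times>\<times> T"
proof -
  let ?K = "common_kernel G n p"
  have hp: "\<And>i. i < n \<Longrightarrow> int_hom G (p i)" and tc: "\<And>i. i < n \<Longrightarrow> t i \<in> carrier G" using dual_systemD[OF d] by auto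
  have "\<forall>i<n. int_hom G (p i)" using hp by blast
  note K = common_kernel_closed[OF this]
  note oneK = K(3)
  have KG: "?K \<subseteq> carrier G" by (auto simp: common_kernel_def)
  obtain \<beta> where \<beta>: "bij_betw \<beta> ?K {0..<card ?K}" using ex_bij_betw_finite_nat[OF fin] by blast
  define \<alpha> where "\<alpha> = inv_into ?K \<beta>"
  define N where "N = {0..<card ?K}"
  have \<alpha>: "\<alpha> k \<in> ?K" "\<beta> (\<alpha> k) = k" if "k \<in> N" for k
    using \<beta> that unfolding \<alpha>_def N_def bij_betw_def by (metis inv_into_into, metis f_inv_into_f)
  have \<beta>N: "\<beta> g \<in> N" "\<alpha> (\<beta> g) = g" if "g \<in> ?K" for g
    using \<beta> that unfolding \<alpha>_def N_def bij_betw_def by (metis imageI, metis inv_into_f_f)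
  define T where "T = \<lparr>carrier = N, monoid.mult = (\<lambda>k l. \<beta> (\<alpha> k \<otimes> \<alpha> l)), one = \<beta> \<one>\<rparr>"
  have Tc: "carrier T = N" "\<And>k l. k \<otimes>\<^bsub>T\<^esub> l = \<beta> (\<alpha> k \<otimes> \<alpha> l)" "\<one>\<^bsub>T\<^esub> = \<beta> \<one>" by (simp_all add: T_def)
  have \<alpha>c: "\<alpha> k \<in> carrier G" if "k \<in> N" for k using \<alpha>(1)[OF that] KG by blast
  have mK: "\<alpha> k \<otimes> \<alpha> l \<in> ?K" if "k \<in> N" "l \<in> N" for k l using K(1) \<alpha>(1) that by blast
  have "comm_group T"
  proof (rule comm_groupI, unfold Tc)
    fix x assume x: "x \<in> N"
    show "\<exists>y\<in>N. \<beta> (\<alpha> y \<otimes> \<alpha> x) = \<beta> \<one>"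
    proof
      show "\<beta> (inv (\<alpha> x)) \<in> N" using \<beta>N(1) K(2) \<alpha>(1)[OF x] by blast
      have "inv (\<alpha> x) \<in> ?K" using K(2) \<alpha>(1)[OF x] by blast
      then show "\<beta> (\<alpha> (\<beta> (inv (\<alpha> x))) \<otimes> \<alpha> x) = \<beta> \<one>" using \<beta>N(2) \<alpha>c[OF x] by simp
    qed
  qed (use \<beta>N mK \<alpha> \<alpha>c oneK in \<open>auto simp: m_ac\<close>)
  moreover have "finite (carrier T)" by (simp add: Tc N_def)
  moreover have "G \<cong> product_group {..<n} (\<lambda>_. integer_group) \<times>\<times> T"
  proof (rule is_isoI, rule isoI)
    let ?H = "product_group {..<n} (\<lambda>_. integer_group) \<times>\<times> T"
    define f where "f g = (restrict (\<lambda>i. p i g) {..<n}, \<beta> (residual n p t g))" for g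
    have cc: "combination n t c \<in> carrier G" for c using combination_closed tc by blast
    have res_mult: "residual n p t (g \<otimes> h) = residual n p t g \<otimes> residual n p t h"
      if "g \<in> carrier G" "h \<in> carrier G" for g h
    proof -
      have "combination n t (\<lambda>i. p i (g \<otimes> h)) = combination n t (\<lambda>i. p i g) \<otimes> combination n t (\<lambda>i. p i h)"
      proof -
        have "combination n t (\<lambda>i. p i (g \<otimes> h)) = combination n t (\<lambda>i. p i g + p i h)"
          by (intro combination_cong tc) (use int_hom_mult[OF hp] that in auto)
        then show ?thesis using combination_add[OF tc] by simp
      qed
      then show ?thesis using that cc by (simp add: residual_def inv_mult m_ac)
    qed
    show "f \<in> hom G ?H"
    proof (rule homI)
      fix g assume g: "g \<in> carrier G"
      show "f g \<in> carrier ?H" using \<beta>N(1)[OF residual(1)[OF d g]] by (auto simp: f_def Tc)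
    next
      fix g h assume gh: "g \<in> carrier G" "h \<in> carrier G"
      show "f (g \<otimes> h) = f g \<otimes>\<^bsub>?H\<^esub> f h"
        using gh int_hom_mult[OF hp] res_mult[OF gh] \<beta>N(2)[OF residual(1)[OF d gh(1)]] \<beta>N(2)[OF residual(1)[OF d gh(2)]]
        by (auto simp: f_def Tc mult_DirProd' fun_eq_iff)
    qed
    show "bij_betw f (carrier G) (carrier ?H)"
      unfolding bij_betw_def
    proof
      show "inj_on f (carrier G)"
      proof (rule inj_onI)
        fix g h assume gh: "g \<in> carrier G" "h \<in> carrier G" "f g = f h"
        have "\<beta> (residual n p t g) = \<beta> (residual n p t h)" using gh(3) by (simp add: f_def)
        then have r: "residual n p t g = residual n p t h"
          using \<beta>N(2)[OF residual(1)[OF d gh(1)]] \<beta>N(2)[OF residual(1)[OF d gh(2)]] by metis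
        have "p i g = p i h" if "i < n" for i
          using gh(3) that unfolding f_def by (metis Pair_inject lessThan_iff restrict_apply')
        then have "combination n t (\<lambda>i. p i g) = combination n t (\<lambda>i. p i h)" by (intro combination_cong tc)
        then show "g = h" using residual(2)[OF d gh(1)] residual(2)[OF d gh(2)] r by metis
      qed
      show "f ` carrier G = carrier ?H"
      proof
        show "f ` carrier G \<subseteq> carrier ?H" by (rule hom_carrier[OF \<open>f \<in> hom G ?H\<close>])
        show "carrier ?H \<subseteq> f ` carrier G"
        proof
          fix y assume "y \<in> carrier ?H"
          then obtain z k where y: "y = (z, k)" "z \<in> {..<n} \<rightarrow>\<^sub>E UNIV" "k \<in> N" by (auto simp: Tc)
          let ?g = "\<alpha> k \<otimes> combination n t z"
          have g: "?g \<in> carrier G" using \<alpha>c[OF y(3)] cc by simp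
          have pg: "p i ?g = z i" if "i < n" for i
            using int_hom_mult[OF hp[OF that] \<alpha>c[OF y(3)] cc] \<alpha>(1)[OF y(3)] dual_systemD(3)[OF d that] that
            by (simp add: common_kernel_def)
          have "combination n t (\<lambda>i. p i ?g) = combination n t z" by (intro combination_cong tc pg)
          then have "residual n p t ?g = \<alpha> k" using \<alpha>c[OF y(3)] cc by (simp add: residual_def m_assoc)
          moreover have "restrict (\<lambda>i. p i ?g) {..<n} = z"
            using y(2) pg by (auto simp: fun_eq_iff PiE_def extensional_def)
          ultimately have "f ?g = y" using \<alpha>(2)[OF y(3)] y(1) by (simp add: f_def)
          then show "y \<in> f ` carrier G" using g by blast
        qed
      qed
    qed
  qed
  ultimately show ?thesis by blast
qed

text \<open>Projections and unit vectors of the product are dual and are carried back through the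
  isomorphism; the kernel of the projections embeds into \<open>T\<close>.\<close>

lemma dual_system_of_iso:
  assumes iso: "G \<cong> product_group {..<n::nat} (\<lambda>_. integer_group) \<times>\<times> T" and T: "comm_group T" "finite (carrier T)"
  shows "\<exists>p t. dual_system G n p t \<and> finite (common_kernel G n p)"
proof -
  let ?P = "product_group {..<n} (\<lambda>_. integer_group)"
  let ?H = "?P \<times>\<times> T"
  obtain f where f: "f \<in> hom G ?H" "bij_betw f (carrier G) (carrier ?H)"
    using iso unfolding is_iso_def iso_def by blast
  interpret T: comm_group T by (rule T)
  define p where "p i g = fst (f g) i" for i g
  define b where "b i = (restrict (\<lambda>j. if i = j then 1 else 0 :: int) {..<n}, \<one>\<^bsub>T\<^esub>)" for i
  define t where "t i = inv_into (carrier G) f (b i)" for i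
  have b: "b i \<in> carrier ?H" for i by (auto simp: b_def)
  have t: "t i \<in> carrier G" "f (t i) = b i" for i
    using f(2) b[of i] unfolding t_def bij_betw_def by (metis inv_into_into, metis f_inv_into_f)
  have fm: "f (x \<otimes> y) = f x \<otimes>\<^bsub>?H\<^esub> f y" if "x \<in> carrier G" "y \<in> carrier G" for x y
    using f(1) that by (simp add: hom_def)
  have "dual_system G n p t"
    unfolding dual_system_def int_hom_def
    using t fm by (auto simp: p_def b_def mult_DirProd')
  moreover have "finite (common_kernel G n p)"
  proof -
    have fH: "f g \<in> carrier ?H" if "g \<in> common_kernel G n p" for g
      using hom_carrier[OF f(1)] that by (auto simp: common_kernel_def)
    then have "snd ` f ` common_kernel G n p \<subseteq> carrier T" by (auto simp: mem_Times_iff DirProd_def)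
    then have "finite (snd ` f ` common_kernel G n p)" using T(2) finite_subset by blast
    moreover have "inj_on snd (f ` common_kernel G n p)"
    proof (rule inj_onI)
      fix x y assume "x \<in> f ` common_kernel G n p" "y \<in> f ` common_kernel G n p" "snd x = snd y"
      then obtain g h where gh: "g \<in> common_kernel G n p" "h \<in> common_kernel G n p" "snd (f g) = snd (f h)"
        and xy: "x = f g" "y = f h" by blast
      have e: "fst (f g) \<in> {..<n} \<rightarrow>\<^sub>E UNIV" "fst (f h) \<in> {..<n} \<rightarrow>\<^sub>E UNIV" using fH[OF gh(1)] fH[OF gh(2)] by (auto simp: mem_Times_iff DirProd_def)
      have "fst (f g) = fst (f h)"
        by (rule PiE_ext[OF e]) (use gh in \<open>auto simp: common_kernel_def p_def\<close>)
      then show "x = y" using gh(3) xy by (simp add: prod_eq_iff)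
    qed
    ultimately have "finite (f ` common_kernel G n p)" by (rule finite_imageD)
    moreover have "inj_on f (common_kernel G n p)"
      using f(2) by (auto simp: bij_betw_def common_kernel_def inj_on_def)
    ultimately show ?thesis by (rule finite_imageD)
  qed
  ultimately show ?thesis by blast
qed

end

lemma (in comm_monoid) monoid_rank_eq:
  assumes d: "dual_system (group_completion G) n p t" and fin: "finite (common_kernel (group_completion G) n p)"
  shows "monoid_rank G = n"
proof -
  interpret C: comm_group "group_completion G" by (rule comm_group_group_completion)
  show ?thesis
    unfolding monoid_rank_def
  proof (rule the_equality)
    show "\<exists>T :: nat monoid. comm_group T \<and> finite (carrier T) \<and>
        group_completion G \<cong> product_group {..<n} (\<lambda>_. integer_group) \<times>\<times> T"
      by (rule C.iso_of_dual_system[OF d fin])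
    fix m :: nat assume "\<exists>T :: nat monoid. comm_group T \<and> finite (carrier T) \<and>
        group_completion G \<cong> product_group {..<m} (\<lambda>_. integer_group) \<times>\<times> T"
    then obtain p' t' where d': "dual_system (group_completion G) m p' t'" "finite (common_kernel (group_completion G) m p')"
      using C.dual_system_of_iso by blast
    show "m = n" using C.dual_system_size_le[OF d fin d'(1)] C.dual_system_size_le[OF d' d] by simp
  qed
qed

section \<open>Schreier graphs\<close>

lemma frame_mono: "frame S L n \<pi> \<Longrightarrow> L \<subseteq> L' \<Longrightarrow> frame S L' n \<pi>"
  unfolding frame_def by blast

lemma frame_coordinates:
  assumes "finite S"
  shows "\<exists>\<pi>. frame S {0} (card S) \<pi>"
proof -
  obtain e where e: "bij_betw e {0..<card S} S" using ex_bij_betw_nat_finite[OF assms] by blast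
  have "frame S {0} (card S) (\<lambda>j v. v (e j))"
    unfolding frame_def
  proof (intro conjI allI impI)
    fix D
    have "v \<in> vbox S \<bar>D\<bar>" if v: "v \<in> vecs S" "\<forall>j<card S. \<bar>v (e j)\<bar> \<le> D" for v
    proof -
      have "\<bar>v i\<bar> \<le> \<bar>D\<bar>" for i
      proof (cases "i \<in> S")
        case True
        then obtain j where "j < card S" "i = e j" using e by (force simp: bij_betw_def)
        then show ?thesis using v(2) by fastforce
      next
        case False
        then show ?thesis using v(1) by (simp add: vecs_def)
      qed
      then show ?thesis using v(1) by (simp add: vbox_def)
    qed
    then show "\<exists>D'. \<forall>v\<in>vecs S. (\<forall>j<card S. \<bar>v (e j)\<bar> \<le> D) \<longrightarrow> (\<exists>v'\<in>vbox S D'. v - v' \<in> {0})"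
      by (intro exI[of _ "\<bar>D\<bar>"]) force
  qed (simp add: additive_def)
  then show ?thesis by blast
qed

text \<open>In a frame of least size no coordinate can be nonzero on \<open>L\<close>, since
  elimination would shorten the frame.\<close>

lemma frame_annihilating:
  assumes "finite S" and L: "vec_subgroup S L"
  shows "\<exists>n \<pi>. frame S L n \<pi> \<and> (\<forall>v\<in>L. \<forall>j<n. \<pi> j v = 0)"
proof -
  have "\<exists>n \<pi>. frame S L n \<pi>"
    using frame_coordinates[OF assms(1)] frame_mono[of S "{0}" _ _ L] L by (force simp: vec_subgroup_def)
  then have ex: "\<exists>\<pi>. frame S L (LEAST n. \<exists>\<pi>. frame S L n \<pi>) \<pi>" by (rule LeastI_ex)
  define n where "n = (LEAST n. \<exists>\<pi>. frame S L n \<pi>)"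
  obtain \<pi> where \<pi>: "frame S L n \<pi>" using ex unfolding n_def by blast
  have "\<pi> j v = 0" if v: "v \<in> L" "j < n" for v j
  proof (rule ccontr)
    assume "\<pi> j v \<noteq> 0"
    obtain m where m: "n = Suc m" using v(2) by (cases n) auto
    have "\<exists>\<pi>'. frame S L m \<pi>'"
      using frame_eliminate[OF \<pi>[unfolded m] order_refl L v(1) _ \<open>\<pi> j v \<noteq> 0\<close>] v(2) m by simp
    then have "n \<le> m" unfolding n_def by (rule Least_le)
    then show False using m by simp
  qed
  then show ?thesis using \<pi> by blast
qed

definition unit_vec :: "'i \<Rightarrow> 'i \<Rightarrow> int" where
  "unit_vec s = (\<lambda>i. if i = s then 1 else 0)"

lemma unit_vec: "s \<in> S \<Longrightarrow> unit_vec s \<in> nonneg S \<inter> vbox S 1"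
  by (auto simp: unit_vec_def nonneg_def vbox_def vecs_def)

definition pos_part :: "('i \<Rightarrow> int) \<Rightarrow> 'i \<Rightarrow> int" where
  "pos_part v = (\<lambda>i. max (v i) 0)"

lemma pos_part: "v \<in> vecs S \<Longrightarrow> pos_part v \<in> nonneg S" "v = pos_part v - pos_part (- v)"
  by (auto simp: pos_part_def nonneg_def vecs_def fun_eq_iff)

section \<open>From vectors over the generators to the group completion\<close>

locale generated_comm_monoid = comm_monoid +
  fixes S
  assumes finite_gens: "finite S" and generates: "monoid_generates G S"
begin

lemma gens_closed: "S \<subseteq> carrier G"
  using generates by (simp add: monoid_generates_def)

text \<open>The canonical map from the free commutative monoid on \<open>S\<close>. Since
  \<open>nat\<close> truncates, it is additive on nonnegative vectors only.\<close>

definition ev :: "('a \<Rightarrow> int) \<Rightarrow> 'a" where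
  "ev v = finprod G (\<lambda>s. s [^] nat (v s)) S"

lemma ev_closed: "ev v \<in> carrier G"
  unfolding ev_def using gens_closed by (intro finprod_closed) auto

lemma ev_add:
  assumes "v \<in> nonneg S" "w \<in> nonneg S"
  shows "ev (v + w) = ev v \<otimes> ev w"
proof -
  have "s [^] nat ((v + w) s) = s [^] nat (v s) \<otimes> s [^] nat (w s)" if "s \<in> S" for s
  proof -
    have "nat ((v + w) s) = nat (v s) + nat (w s)" using assms by (simp add: nonneg_def nat_add_distrib)
    then show ?thesis using gens_closed that by (simp only: nat_pow_mult subset_iff)
  qed
  then have "ev (v + w) = finprod G (\<lambda>s. s [^] nat (v s) \<otimes> s [^] nat (w s)) S"
    unfolding ev_def using gens_closed by (intro finprod_cong') auto
  then show ?thesis unfolding ev_def using gens_closed by (simp add: finprod_multf Pi_iff subset_iff)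
qed

lemma ev_zero: "ev 0 = \<one>"
  by (simp add: ev_def)

lemma ev_unit_vec: "s \<in> S \<Longrightarrow> ev (unit_vec s) = s"
proof -
  assume s: "s \<in> S"
  have "i [^] nat (unit_vec s i) = (if s = i then i else \<one>)" if "i \<in> S" for i
  proof -
    have "nat (unit_vec s i) = (if s = i then 1 else 0)" by (simp add: unit_vec_def)
    moreover have "i [^] (1::nat) = i" unfolding One_nat_def nat_pow_Suc using gens_closed that by auto
    ultimately show ?thesis by (cases "s = i") (simp_all only: if_True if_False nat_pow_0 refl)
  qed
  then have "ev (unit_vec s) = finprod G (\<lambda>i. if s = i then i else \<one>) S"
    unfolding ev_def using gens_closed by (intro finprod_cong') auto
  also have "\<dots> = s" using finprod_singleton[OF s finite_gens, of "\<lambda>i. i"] gens_closed by auto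
  finally show ?thesis .
qed

lemma ev_surj:
  assumes "a \<in> carrier G"
  shows "\<exists>v\<in>nonneg S. a = ev v"
proof -
  have "submonoid (ev ` nonneg S) G"
  proof
    show "ev ` nonneg S \<subseteq> carrier G" using ev_closed by blast
    show "\<one> \<in> ev ` nonneg S" using ev_zero zero_nonneg by (metis imageI)
    fix x y assume "x \<in> ev ` nonneg S" "y \<in> ev ` nonneg S"
    then obtain v w where vw: "v \<in> nonneg S" "w \<in> nonneg S" "x = ev v" "y = ev w" by blast
    then have "x \<otimes> y = ev (v + w)" by (simp add: ev_add)
    then show "x \<otimes> y \<in> ev ` nonneg S" using nonneg_add[OF vw(1,2)] by blast
  qed
  moreover have "S \<subseteq> ev ` nonneg S"
  proof
    fix s assume s: "s \<in> S"
    show "s \<in> ev ` nonneg S" using ev_unit_vec[OF s] unit_vec[OF s] by (metis IntD1 imageI)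
  qed
  ultimately have "carrier G \<subseteq> ev ` nonneg S" using generates unfolding monoid_generates_def by blast
  then show ?thesis using assms by blast
qed

sublocale completion: comm_group "group_completion G"
  by (rule comm_group_group_completion)

definition fraction :: "('a \<Rightarrow> int) \<Rightarrow> ('a \<times> 'a) set" where
  "fraction v = gp_rel G `` {(ev (pos_part v), ev (pos_part (- v)))}"

text \<open>\<open>pos_part v + b\<close> and \<open>a + pos_part (- v)\<close> are the same vector,
  so the cross products already agree with the unit as witness. Later computations may use any
  presentation of \<open>v\<close> as a difference.\<close>

lemma fraction_eq:
  assumes "a \<in> nonneg S" "b \<in> nonneg S" "v = a - b"
  shows "fraction v = gp_rel G `` {(ev a, ev b)}"
proof -
  have v: "v \<in> vecs S" "- v \<in> vecs S" using assms by (auto simp: nonneg_def vecs_closed)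
  have "pos_part v + b = a + pos_part (- v)"
    using assms(3) by (auto simp: pos_part_def fun_eq_iff)
  then have "ev (pos_part v) \<otimes> ev b = ev a \<otimes> ev (pos_part (- v))"
    using ev_add[OF pos_part(1)[OF v(1)] assms(2)] ev_add[OF assms(1) pos_part(1)[OF v(2)]] by simp
  then have "((ev (pos_part v), ev (pos_part (- v))), (ev a, ev b)) \<in> gp_rel G"
    using ev_closed by (auto simp: gp_rel_def intro!: bexI[of _ \<one>])
  then show ?thesis unfolding fraction_def by (rule equiv_class_eq[OF equiv_gp_rel])
qed

lemma completion_carrier: "carrier (group_completion G) = (carrier G \<times> carrier G) // gp_rel G"
  by (simp add: group_completion_def)

lemma fraction_closed: "fraction v \<in> carrier (group_completion G)"
  unfolding fraction_def completion_carrier using ev_closed by (intro quotientI) simp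

lemma fraction_add:
  assumes v: "v \<in> vecs S" and w: "w \<in> vecs S"
  shows "fraction (v + w) = fraction v \<otimes>\<^bsub>group_completion G\<^esub> fraction w"
proof -
  have p: "pos_part v \<in> nonneg S" "pos_part w \<in> nonneg S" "pos_part (- v) \<in> nonneg S" "pos_part (- w) \<in> nonneg S"
    using v w by (auto intro: pos_part vecs_closed)
  have "v + w = (pos_part v + pos_part w) - (pos_part (- v) + pos_part (- w))"
    by (auto simp: pos_part_def fun_eq_iff)
  from fraction_eq[OF nonneg_add[OF p(1,2)] nonneg_add[OF p(3,4)] this]
  show ?thesis
    unfolding fraction_def[of v] fraction_def[of w] group_completion_mult[OF ev_closed ev_closed ev_closed ev_closed]
    using ev_add p by simp
qed

lemma fraction_zero: "fraction 0 = \<one>\<^bsub>group_completion G\<^esub>"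
  using fraction_eq[of 0 0 0] by (simp add: ev_zero group_completion_def)

lemma fraction_diff:
  assumes "v \<in> vecs S" "w \<in> vecs S"
  shows "fraction (v - w) = \<one>\<^bsub>group_completion G\<^esub> \<longleftrightarrow> fraction v = fraction w"
proof -
  have eq: "fraction v = fraction (v - w) \<otimes>\<^bsub>group_completion G\<^esub> fraction w"
    using fraction_add[OF vecs_closed(2)[OF assms] assms(2)] by simp
  show ?thesis by (subst eq) (rule completion.r_cancel_one[OF fraction_closed fraction_closed, symmetric])
qed

lemma fraction_surj:
  assumes "P \<in> carrier (group_completion G)"
  shows "\<exists>v\<in>vecs S. fraction v = P"
proof -
  obtain a b where ab: "a \<in> carrier G" "b \<in> carrier G" "P = gp_rel G `` {(a, b)}"
    using assms unfolding completion_carrier by (auto elim!: quotientE)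
  obtain v w where v: "v \<in> nonneg S" "a = ev v" and w: "w \<in> nonneg S" "b = ev w"
    using ev_surj ab by metis
  have "fraction (v - w) = P" using fraction_eq[OF v(1) w(1)] ab v w by simp
  moreover have "v - w \<in> vecs S" using v w by (auto simp: nonneg_def vecs_closed)
  ultimately show ?thesis by blast
qed

definition fraction_kernel :: "('a \<Rightarrow> int) set" where
  "fraction_kernel = {v \<in> vecs S. fraction v = \<one>\<^bsub>group_completion G\<^esub>}"

text \<open>Cancellation may fail in the monoid, so a vector that is trivial in the completion gives
  a relation only after multiplication by a witness; this witness supplies the shift demanded by
  \<open>rels\<close>.\<close>

lemma fraction_kernel_relation:
  assumes "v \<in> fraction_kernel"
  shows "\<exists>c\<in>nonneg S. c + v \<in> nonneg S \<and> ev (c + v) = ev c"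
proof -
  have v: "v \<in> vecs S" "- v \<in> vecs S" using assms by (auto simp: fraction_kernel_def vecs_closed)
  have p: "pos_part v \<in> nonneg S" "pos_part (- v) \<in> nonneg S" using v by (auto intro: pos_part)
  have "gp_rel G `` {(ev (pos_part v), ev (pos_part (- v)))} = gp_rel G `` {(\<one>, \<one>)}"
    using assms by (simp add: fraction_kernel_def fraction_def group_completion_def)
  then have "((ev (pos_part v), ev (pos_part (- v))), (\<one>, \<one>)) \<in> gp_rel G"
    using eq_equiv_class[OF _ equiv_gp_rel] by simp
  then obtain c where c: "c \<in> carrier G" "ev (pos_part v) \<otimes> c = ev (pos_part (- v)) \<otimes> c"
    using ev_closed by (auto simp: gp_rel_def)
  obtain w where w: "w \<in> nonneg S" "c = ev w" using ev_surj[OF c(1)] by blast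
  have eq: "(pos_part (- v) + w) + v = pos_part v + w"
    by (auto simp: pos_part_def fun_eq_iff)
  show ?thesis
  proof (intro bexI[of _ "pos_part (- v) + w"] conjI)
    show "(pos_part (- v) + w) + v \<in> nonneg S" unfolding eq by (rule nonneg_add[OF p(1) w(1)])
    show "ev (pos_part (- v) + w + v) = ev (pos_part (- v) + w)"
      unfolding eq using ev_add p w c(2) by simp
    show "pos_part (- v) + w \<in> nonneg S" by (rule nonneg_add[OF p(2) w(1)])
  qed
qed

lemma fraction_kernel_subgroup: "vec_subgroup S fraction_kernel"
  unfolding vec_subgroup_def fraction_kernel_def
  by (auto simp: fraction_zero fraction_add fraction_diff vecs_closed)

text \<open>A frame vanishing on the kernel descends to homomorphisms of the completion, whose
  common kernel is represented by bounded vectors and hence finite. The dual system extracted from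
  them has the rank as its size, and its coordinates pull back to a frame.\<close>

theorem monoid_rank_frame: "\<exists>\<pi>. frame S fraction_kernel (monoid_rank G) \<pi>"
proof -
  let ?C = "group_completion G"
  obtain n \<pi> where \<pi>: "frame S fraction_kernel n \<pi>" "\<And>v j. v \<in> fraction_kernel \<Longrightarrow> j < n \<Longrightarrow> \<pi> j v = 0"
    using frame_annihilating[OF finite_gens fraction_kernel_subgroup] by blast
  have add: "additive S (\<pi> j)" if "j < n" for j using \<pi>(1) that by (auto simp: frame_def)
  have ker: "v - w \<in> fraction_kernel \<longleftrightarrow> fraction v = fraction w" if "v \<in> vecs S" "w \<in> vecs S" for v w
    using fraction_diff[OF that] that by (simp add: fraction_kernel_def vecs_closed)
  define rep where "rep P = (SOME v. v \<in> vecs S \<and> fraction v = P)" for P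
  have rep: "rep P \<in> vecs S" "fraction (rep P) = P" if "P \<in> carrier ?C" for P
    using someI_ex[of "\<lambda>v. v \<in> vecs S \<and> fraction v = P"] fraction_surj[OF that] unfolding rep_def by blast+
  define q where "q j P = \<pi> j (rep P)" for j P
  have q: "q j (fraction v) = \<pi> j v" if "v \<in> vecs S" "j < n" for j v
  proof -
    have "rep (fraction v) - v \<in> fraction_kernel" using ker[OF rep(1)[OF fraction_closed] that(1)] rep(2)[OF fraction_closed] by simp
    from \<pi>(2)[OF this that(2)] show ?thesis
      using additive_diff[OF add[OF that(2)] rep(1)[OF fraction_closed] that(1)] by (simp add: q_def)
  qed
  have "int_hom ?C (q j)" if j: "j < n" for j
    unfolding int_hom_def
  proof (intro ballI)
    fix x y assume "x \<in> carrier ?C" "y \<in> carrier ?C"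
    then obtain v w where vw: "v \<in> vecs S" "x = fraction v" "w \<in> vecs S" "y = fraction w" using fraction_surj by metis
    then show "q j (x \<otimes>\<^bsub>?C\<^esub> y) = q j x + q j y"
      using q[OF vecs_closed(1)[OF vw(1,3)] j] q[OF vw(1) j] q[OF vw(3) j] additive_add[OF add[OF j] vw(1,3)]
        fraction_add[OF vw(1,3)] by simp
  qed
  then obtain m p t where d: "dual_system ?C m p t" and sub: "common_kernel ?C m p \<subseteq> common_kernel ?C n q"
    using completion.dual_system_exists[of n q] by blast
  obtain D' where D': "\<And>v. v \<in> vecs S \<Longrightarrow> (\<And>j. j < n \<Longrightarrow> \<bar>\<pi> j v\<bar> \<le> 0) \<Longrightarrow> \<exists>v'\<in>vbox S D'. v - v' \<in> fraction_kernel"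
    using \<pi>(1) unfolding frame_def by blast
  have "common_kernel ?C n q \<subseteq> fraction ` vbox S D'"
  proof
    fix x assume x: "x \<in> common_kernel ?C n q"
    then obtain v where v: "v \<in> vecs S" "x = fraction v" using fraction_surj by (force simp: common_kernel_def)
    then have "\<bar>\<pi> j v\<bar> \<le> 0" if "j < n" for j using x q[OF v(1) that] that by (simp add: common_kernel_def)
    then obtain v' where v': "v' \<in> vbox S D'" "v - v' \<in> fraction_kernel" using D'[OF v(1)] by blast
    then have "fraction v = fraction v'" using ker[OF v(1)] vboxD(2) by blast
    then show "x \<in> fraction ` vbox S D'" using v v' by blast
  qed
  then have fin: "finite (common_kernel ?C m p)"
    using sub finite_vbox[OF finite_gens] by (meson finite_imageI finite_subset)
  have rank: "monoid_rank G = m" by (rule monoid_rank_eq[OF d fin])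
  have "frame S fraction_kernel m (\<lambda>j v. p j (fraction v))"
    unfolding frame_def
  proof (intro conjI allI impI)
    fix j assume "j < m"
    then show "additive S (\<lambda>v. p j (fraction v))"
      using completion.int_hom_mult[OF completion.dual_systemD(1)[OF d]] fraction_closed by (simp add: additive_def fraction_add)
  next
    fix D
    \<comment> \<open>Finite, because an element is determined by its coordinates and its residual;
      the chosen representatives therefore have a common bound.\<close>
    define F where "F = {x \<in> carrier ?C. \<forall>j<m. \<bar>p j x\<bar> \<le> D}"
    have "finite F"
    proof (rule finite_imageD)
      let ?f = "\<lambda>x. (restrict (\<lambda>j. p j x) {..<m}, completion.residual m p t x)"
      have "?f ` F \<subseteq> PiE {..<m} (\<lambda>_. {-D..D}) \<times> common_kernel ?C m p"
        using completion.residual(1)[OF d] by (auto simp: F_def abs_le_iff) (metis minus_le_iff)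
      then show "finite (?f ` F)" by (rule finite_subset) (use fin in \<open>auto intro!: finite_PiE\<close>)
      show "inj_on ?f F"
      proof (rule inj_onI)
        fix x y assume xy: "x \<in> F" "y \<in> F" "?f x = ?f y"
        have "p j x = p j y" if "j < m" for j
          using xy(3) that by (metis (no_types, lifting) Pair_inject lessThan_iff restrict_apply')
        then have "completion.combination m t (\<lambda>j. p j x) = completion.combination m t (\<lambda>j. p j y)"
          by (intro completion.combination_cong completion.dual_systemD(2)[OF d])
        moreover have "completion.residual m p t x = completion.residual m p t y" using xy(3) by simp
        ultimately show "x = y"
          using completion.residual(2)[OF d, of x] completion.residual(2)[OF d, of y] xy(1,2) by (simp add: F_def)
      qed
    qed
    define B where "B = (\<Sum>x\<in>F. \<Sum>i\<in>S. \<bar>rep x i\<bar>)"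
    have B: "rep x \<in> vbox S B" if x: "x \<in> F" for x
    proof -
      have rv: "rep x \<in> vecs S" using rep(1) x by (simp add: F_def)
      have le: "(\<Sum>i\<in>S. \<bar>rep x i\<bar>) \<le> B"
        unfolding B_def using x \<open>finite F\<close>
        by (intro member_le_sum[where f = "\<lambda>x. \<Sum>i\<in>S. \<bar>rep x i\<bar>"] sum_nonneg) auto
      have "\<bar>rep x i\<bar> \<le> B" for i
      proof (cases "i \<in> S")
        case True
        then have "\<bar>rep x i\<bar> \<le> (\<Sum>i\<in>S. \<bar>rep x i\<bar>)"
          using finite_gens by (intro member_le_sum[where f = "\<lambda>i. \<bar>rep x i\<bar>"]) auto
        then show ?thesis using le by simp
      next
        case False
        have "0 \<le> B" unfolding B_def by (intro sum_nonneg) auto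
        then show ?thesis using rv False by (simp add: vecs_def)
      qed
      then show ?thesis using rv by (simp add: vbox_def)
    qed
    show "\<exists>D'. \<forall>v\<in>vecs S. (\<forall>j<m. \<bar>p j (fraction v)\<bar> \<le> D) \<longrightarrow> (\<exists>v'\<in>vbox S D'. v - v' \<in> fraction_kernel)"
    proof (intro exI[of _ B] ballI impI)
      fix v assume v: "v \<in> vecs S" "\<forall>j<m. \<bar>p j (fraction v)\<bar> \<le> D"
      then have "fraction v \<in> F" using fraction_closed by (simp add: F_def)
      moreover have "v - rep (fraction v) \<in> fraction_kernel"
        using ker[OF v(1) rep(1)[OF fraction_closed]] rep(2)[OF fraction_closed] by simp
      ultimately show "\<exists>v'\<in>vbox S B. v - v' \<in> fraction_kernel" using B by blast
    qed
  qed
  then show ?thesis using rank by blast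
qed

end

section \<open>Comparison of \<open>near\<close> with the path metric\<close>

lemma sym_relpow: "sym E \<Longrightarrow> sym (E ^^ k)"
proof (induction k)
  case (Suc k)
  show ?case
  proof (rule symI)
    fix x y assume "(x, y) \<in> E ^^ Suc k"
    then obtain z where "(x, z) \<in> E ^^ k" "(z, y) \<in> E" by auto
    then have "(y, z) \<in> E" "(z, x) \<in> E ^^ k" using Suc by (auto dest: symD)
    then show "(y, x) \<in> E ^^ Suc k" by (rule relpow_Suc_I2)
  qed
qed (auto simp: sym_def)

context commuting_maps
begin

lemma near_power:
  assumes step: "\<And>x y. (x, y) \<in> E \<Longrightarrow> x \<in> space M \<and> y \<in> space M \<and> near 1 x y"
  shows "(x, y) \<in> E ^^ k \<Longrightarrow> x \<in> space M \<Longrightarrow> y \<in> space M \<and> near (int k) x y"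
proof (induction k arbitrary: y)
  case 0
  then show ?case using near_refl[of 0 x] by simp
next
  case (Suc k)
  then obtain z where z: "(x, z) \<in> E ^^ k" "(z, y) \<in> E" by auto
  then have "z \<in> space M \<and> near (int k) x z" using Suc by blast
  then show ?case using near_trans[of "int k" x z 1 y] step[OF z(2)] Suc.prems(2) by (auto simp: add.commute)
qed

text \<open>One generator is applied per unit of the coordinate sum. The graph has no loops, so a
  generator fixing the current point adds no edge and the walk may be shorter than the sum.\<close>

lemma T_walk:
  assumes E: "\<And>s y. s \<in> S \<Longrightarrow> y \<in> space M \<Longrightarrow> T (unit_vec s) y = y \<or> (y, T (unit_vec s) y) \<in> E"
    and x: "x \<in> space M"
  shows "a \<in> nonneg S \<Longrightarrow> \<exists>k. int k \<le> (\<Sum>i\<in>S. a i) \<and> (x, T a x) \<in> E ^^ k"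
proof (induction "nat (\<Sum>i\<in>S. a i)" arbitrary: a)
  case 0
  have nn: "\<And>i. i \<in> S \<Longrightarrow> 0 \<le> a i" using 0 by (simp add: nonneg_def)
  then have "(\<Sum>i\<in>S. a i) = 0" using 0 sum_nonneg[of S a] by simp
  then have "\<And>i. i \<in> S \<Longrightarrow> a i = 0" using nn finite_index by (simp add: sum_nonneg_eq_0_iff)
  then have "a = 0" using 0 by (auto simp: nonneg_def vecs_def fun_eq_iff)
  then show ?case unfolding \<open>a = 0\<close> T_zero[OF x] by (intro exI[of _ 0]) simp
next
  case (Suc m)
  then obtain s where s: "s \<in> S" "a s \<noteq> 0" by (metis nat_0 old.nat.distinct(2) sum.neutral)
  define b where "b = a - unit_vec s"
  have "1 \<le> a s" using s Suc.prems by (auto simp: nonneg_def le_less dest: spec[of _ s])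
  then have b: "b \<in> nonneg S" using Suc.prems s(1) by (auto simp: b_def nonneg_def unit_vec_def vecs_def)
  have "(\<Sum>i\<in>S. unit_vec s i) = 1" using s(1) finite_index by (simp add: unit_vec_def)
  then have sum: "(\<Sum>i\<in>S. b i) = (\<Sum>i\<in>S. a i) - 1" by (simp add: b_def sum_subtractf)
  have "m = nat (\<Sum>i\<in>S. b i)" using Suc.hyps(2) sum by linarith
  then obtain k where k: "int k \<le> (\<Sum>i\<in>S. b i)" "(x, T b x) \<in> E ^^ k"
    using Suc.hyps(1)[of b] b by blast
  have "a = unit_vec s + b" by (simp add: b_def)
  then have "T a x = T (unit_vec s) (T b x)" using T_add[of "unit_vec s" b x] unit_vec[OF s(1)] b x by simp
  then consider "T a x = T b x" | "(T b x, T a x) \<in> E" using E[OF s(1) T_space[OF b x]] by auto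
  then show ?case
  proof cases
    case 1
    then show ?thesis using k sum by (intro exI[of _ k]) auto
  next
    case 2
    then show ?thesis using k sum by (intro exI[of _ "Suc k"]) auto
  qed
qed

lemma near_walk:
  assumes E: "\<And>s y. s \<in> S \<Longrightarrow> y \<in> space M \<Longrightarrow> T (unit_vec s) y = y \<or> (y, T (unit_vec s) y) \<in> E"
    and "sym E" and x: "x \<in> space M" "y \<in> space M" and "near r x y"
  shows "\<exists>k. int k \<le> 2 * int (card S) * r \<and> (x, y) \<in> E ^^ k"
proof -
  obtain a b where ab: "a \<in> nonneg S \<inter> vbox S r" "b \<in> nonneg S \<inter> vbox S r" "T a x = T b y"
    using assms(5) unfolding near_def by blast
  have le: "(\<Sum>i\<in>S. c i) \<le> int (card S) * r" if "c \<in> vbox S r" for c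
  proof -
    have "c i \<le> r" for i using vboxD(1)[OF that, of i] by simp
    then show ?thesis using sum_bounded_above[of S c r] by simp
  qed
  obtain k where k: "int k \<le> (\<Sum>i\<in>S. a i)" "(x, T a x) \<in> E ^^ k" using T_walk[OF E x(1)] ab by blast
  obtain l where l: "int l \<le> (\<Sum>i\<in>S. b i)" "(y, T b y) \<in> E ^^ l" using T_walk[OF E x(2)] ab by blast
  have "sym (E ^^ l)" using assms(2) by (rule sym_relpow)
  then have "(T a x, y) \<in> E ^^ l" using l(2) ab(3) by (simp add: symD)
  then have "(x, y) \<in> E ^^ (k + l)" using k(2) by (auto simp: relpow_add)
  moreover have "int (k + l) \<le> 2 * int (card S) * r" using k l le[of a] le[of b] ab by simp
  ultimately show ?thesis by blast
qed

theorem borel_asdim_le_of_bdim_le: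
  assumes E: "\<And>s y. s \<in> S \<Longrightarrow> y \<in> space M \<Longrightarrow> T (unit_vec s) y = y \<or> (y, T (unit_vec s) y) \<in> E"
    and "sym E" and step: "\<And>x y. (x, y) \<in> E \<Longrightarrow> x \<in> space M \<and> y \<in> space M \<and> near 1 x y"
    and dim: "bdim_le (space M) n"
  shows "borel_asdim_le M E n"
  unfolding borel_asdim_le_def
proof (intro allI impI)
  fix r :: real assume r: "r > 0"
  obtain U R where U: "good_cover (space M) \<lfloor>r\<rfloor> n U R"
    using dim r unfolding bdim_le_def by (metis less_imp_le zero_le_floor)
  have R: "0 \<le> R" and Us: "\<And>i. i \<le> n \<Longrightarrow> U i \<in> sets M" and cov: "space M \<subseteq> (\<Union>i\<le>n. U i)"
    and chain: "\<And>i x y. i \<le> n \<Longrightarrow> x \<in> U i \<Longrightarrow> (x, y) \<in> near_chain \<lfloor>r\<rfloor> (U i) \<Longrightarrow> near R x y"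
    using U by (auto simp: good_cover_def)
  have Usp: "U i \<subseteq> space M" if "i \<le> n" for i using sets.sets_into_space[OF Us[OF that]] .
  have close: "near \<lfloor>r\<rfloor> x y" if "path_metric E x y \<le> ennreal r" "x \<in> space M" for x y
  proof -
    \<comment> \<open>Walk lengths are integers: without a walk of length at most
      \<open>\<lfloor>r\<rfloor>\<close> the infimum is at least
      \<open>\<lfloor>r\<rfloor> + 1 > r\<close>, also when there is no walk and it is
      infinite.\<close>
    have "\<exists>k. (x, y) \<in> E ^^ k \<and> int k \<le> \<lfloor>r\<rfloor>"
    proof (rule ccontr)
      assume "\<nexists>k. (x, y) \<in> E ^^ k \<and> int k \<le> \<lfloor>r\<rfloor>"
      then have *: "\<lfloor>r\<rfloor> + 1 \<le> int k" if "(x, y) \<in> E ^^ k" for k using that by force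
      have "ennreal (real_of_int (\<lfloor>r\<rfloor> + 1)) \<le> path_metric E x y"
        unfolding path_metric_def
      proof (rule INF_greatest)
        fix k assume "k \<in> {k. (x, y) \<in> E ^^ k}"
        then have "real_of_int (\<lfloor>r\<rfloor> + 1) \<le> real k" using * by (metis mem_Collect_eq of_int_le_iff of_int_of_nat_eq)
        then show "ennreal (real_of_int (\<lfloor>r\<rfloor> + 1)) \<le> of_nat k" by (simp add: ennreal_of_nat_eq_real_of_nat ennreal_leI)
      qed
      then have "ennreal (real_of_int (\<lfloor>r\<rfloor> + 1)) \<le> ennreal r" using that(1) by (rule order_trans)
      then have "real_of_int (\<lfloor>r\<rfloor> + 1) \<le> r" using r ennreal_le_iff[of r "real_of_int (\<lfloor>r\<rfloor> + 1)"] by linarith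
      then show False by linarith
    qed
    then obtain k where k: "(x, y) \<in> E ^^ k" "int k \<le> \<lfloor>r\<rfloor>" by blast
    then show ?thesis using near_power[OF step k(1) that(2)] near_mono by blast
  qed
  \<comment> \<open>Two points of a component are each at \<open>near\<close>-distance
    \<open>R\<close> from its base point, hence \<open>2 * R\<close> apart; the other factor
    converts \<open>near\<close> into walks.\<close>
  define L where "L = 2 * int (card S) * (2 * R)"
  show "\<exists>U R. (\<forall>i\<le>n. U i \<in> sets M) \<and> (\<Union>i\<le>n. U i) = space M \<and>
      (\<forall>i\<le>n. \<forall>C\<in>r_components (path_metric E) r (U i). ediameter (path_metric E) C \<le> ennreal R)"
  proof (intro exI[of _ U] exI[of _ "real_of_int L"] conjI allI impI ballI)
    show "(\<Union>i\<le>n. U i) = space M" using cov Usp by blast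
    fix i C assume i: "i \<le> n" and "C \<in> r_components (path_metric E) r (U i)"
    then obtain x0 where x0: "x0 \<in> U i"
      and C: "C = {(x, y). x \<in> U i \<and> y \<in> U i \<and> path_metric E x y \<le> ennreal r}\<^sup>* `` {x0}"
      unfolding r_components_def by (auto elim!: quotientE)
    have sub: "{(x, y). x \<in> U i \<and> y \<in> U i \<and> path_metric E x y \<le> ennreal r}\<^sup>* \<subseteq> near_chain \<lfloor>r\<rfloor> (U i)"
      unfolding near_chain_def using close Usp[OF i] by (intro rtrancl_mono) auto
    have bound: "path_metric E x y \<le> ennreal (real_of_int L)" if xy: "x \<in> C" "y \<in> C" for x y
    proof -
      have ch: "(x0, x) \<in> near_chain \<lfloor>r\<rfloor> (U i)" "(x0, y) \<in> near_chain \<lfloor>r\<rfloor> (U i)" using xy sub C by auto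
      then have sp: "x0 \<in> space M" "x \<in> space M" "y \<in> space M" using near_chain_mem x0 Usp[OF i] by blast+
      have "near (R + R) x y"
        using near_trans[OF near_sym[OF chain[OF i x0 ch(1)]] chain[OF i x0 ch(2)]] sp by blast
      then have "near (2 * R) x y" by simp
      then obtain k where k: "int k \<le> L" "(x, y) \<in> E ^^ k"
        using near_walk[OF E assms(2) sp(2,3)] unfolding L_def by blast
      have "path_metric E x y \<le> of_nat k" unfolding path_metric_def using k(2) by (intro INF_lower) simp
      also have "\<dots> = ennreal (real k)" by (simp add: ennreal_of_nat_eq_real_of_nat)
      also have "\<dots> \<le> ennreal (real_of_int L)" using k(1) by (intro ennreal_leI) linarith
      finally show ?thesis .
    qed
    then show "ediameter (path_metric E) C \<le> ennreal (real_of_int L)"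
      unfolding ediameter_def by (intro SUP_least)
  qed (rule Us)
qed

end

theorem corollary1p5:
  fixes M :: "('m, 'c) monoid_scheme"
    and \<Omega> :: "'x measure"
    and act :: "'m \<Rightarrow> 'x \<Rightarrow> 'x"
    and S :: "'m set"
  assumes "comm_monoid M"
    and "finite S" and "monoid_generates M S"
    and "standard_borel \<Omega>"
    and "borel_monoid_action M \<Omega> act"
    and "bounded_to_one M \<Omega> act"
  shows "borel_asdim_action \<Omega> S act \<le> enat (monoid_rank M)"
proof -
  interpret gen: generated_comm_monoid M S
    using assms(1-3) by (intro generated_comm_monoid.intro generated_comm_monoid_axioms.intro)
  define T where "T v = act (gen.ev v)" for v
  have act: "\<And>a. a \<in> carrier M \<Longrightarrow> act a \<in> \<Omega> \<rightarrow>\<^sub>M \<Omega>" "\<And>x. x \<in> space \<Omega> \<Longrightarrow> act \<one>\<^bsub>M\<^esub> x = x"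
    "\<And>a b x. a \<in> carrier M \<Longrightarrow> b \<in> carrier M \<Longrightarrow> x \<in> space \<Omega> \<Longrightarrow> act (a \<otimes>\<^bsub>M\<^esub> b) x = act a (act b x)"
    using assms(5) by (auto simp: borel_monoid_action_def)
  interpret commuting_maps \<Omega> S T
  proof
    show "\<exists>k. \<forall>y\<in>space \<Omega>. finite {x \<in> space \<Omega>. T v x = y} \<and> card {x \<in> space \<Omega>. T v x = y} \<le> k" for v
      using assms(6) gen.ev_closed unfolding bounded_to_one_def T_def by blast
  qed (use assms(2,4) act gen.ev_closed gen.ev_zero gen.ev_add in \<open>auto simp: T_def\<close>)
  let ?E = "schreier_graph \<Omega> S act"
  have T_unit: "T (unit_vec s) = act s" if "s \<in> S" for s using gen.ev_unit_vec[OF that] by (simp add: T_def)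
  \<comment> \<open>A relation of the monoid holds at every point, so the frame whose size is the
    rank is also a frame for the relations on the whole space.\<close>
  have "gen.fraction_kernel \<subseteq> rels (space \<Omega>)"
    using gen.fraction_kernel_relation by (force simp: rels_def gen.fraction_kernel_def T_def)
  then have "\<exists>\<pi>. frame S (rels (space \<Omega>)) (monoid_rank M) \<pi>"
    using gen.monoid_rank_frame frame_mono by blast
  then have dim: "bdim_le (space \<Omega>) (monoid_rank M)" using bdim_le_frame[OF sets.top] by blast
  have "borel_asdim_le \<Omega> ?E (monoid_rank M)"
  proof (rule borel_asdim_le_of_bdim_le[OF _ _ _ dim])
    fix s y assume s: "s \<in> S" "y \<in> space \<Omega>"
    then have "act s y \<in> space \<Omega>" using T_space[of "unit_vec s" y] unit_vec[OF s(1)] T_unit by auto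
    then show "T (unit_vec s) y = y \<or> (y, T (unit_vec s) y) \<in> ?E"
      using s T_unit by (auto simp: schreier_graph_def)
  next
    show "sym ?E" by (auto simp: sym_def schreier_graph_def)
  next
    fix x y assume "(x, y) \<in> ?E"
    then obtain s where s: "x \<in> space \<Omega>" "y \<in> space \<Omega>" "s \<in> S" "y = act s x \<or> x = act s y"
      by (auto simp: schreier_graph_def)
    have "0 \<in> nonneg S \<inter> vbox S 1" by (simp add: vbox_def vecs_def)
    moreover have "T (unit_vec s) x = T 0 y \<or> T 0 x = T (unit_vec s) y"
      using s T_unit T_zero by auto
    ultimately show "x \<in> space \<Omega> \<and> y \<in> space \<Omega> \<and> near 1 x y"
      unfolding near_def using s unit_vec[OF s(3)] by blast
  qed
  then show ?thesis unfolding borel_asdim_action_def borel_asdim_le_iff .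
qed

end
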